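(* Let $a\in\{2,3,4,6\}$, let $n>5a^2$ be an integer prime to $a$, and let $r$ be an integer with $r\equiv\pm a$ or $ar\equiv\pm1\pmod n$. Put $D_a=\{d\ge2\mid d\text{ divides }a-1\text{ or }a+1\}$ and $C_{a,n}=\prod_{d\in D_a,\,d\mid n}\Phi_d$. Then $\mathcal{S}_{r/n}(q)$ is the product of $C_{a,n}(q)$ and a polynomial which is irreducible over $\mathbb{Q}$, has no root of unity as a root, and takes the value $n/C_{a,n}(1)\ge2$ at $q=1$. In particular, for every $b\in\{2,3,4,6\}$, every prime $p>5b^2$ and every integer $r$ with $r\equiv\pm b$ or $br\equiv\pm1\pmod p$, the polynomial $\mathcal{S}_{r/p}(q)$ is irreducible over $\mathbb{Q}$.
   Context: $q$-deformed rationals: every irreducible fraction $r/s>1$ has a unique Hirzebruch--Jung expansion $r/s=[\![c_1,\dots,c_k]\!]=c_1-\cfrac{1}{c_2-\cfrac{1}{\ddots-\cfrac{1}{c_k}}}$ with all $c_i\ge 2$ integers. Put $R_q=\begin{pmatrix}q&1\\0&1\end{pmatrix}$, $S_q=\begin{pmatrix}0&-q^{-1}\\1&0\end{pmatrix}$ and $M_q(c_1,\dots,c_k)=R_q^{c_1}S_q\cdots R_q^{c_k}S_q$. For $r/s=[\![c_1,\dots,c_k]\!]>1$, the polynomials $\mathcal{R}_{r/s}(q),\mathcal{S}_{r/s}(q)\in\mathbb{Z}[q]$ are the upper and lower entries of the first column of $M_q(c_1,\dots,c_k)$, and $[r/s]_q=\mathcal{R}_{r/s}(q)/\mathcal{S}_{r/s}(q)$.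 This is extended to $\mathbb{Q}\cup\{\infty\}$ by $[\alpha+1]_q=q[\alpha]_q+1$, $[0/1]_q=0$, $[1/0]_q=1/0$. For an arbitrary irreducible fraction $r/s$ with $s>0$, $\mathcal{R}_{r/s}(q)$ and $\mathcal{S}_{r/s}(q)$ are the coprime Laurent polynomials with integer coefficients such that $[r/s]_q=\mathcal{R}_{r/s}(q)/\mathcal{S}_{r/s}(q)$, $\mathcal{S}_{r/s}(q)\in\mathbb{Z}[q]$ and $\mathcal{S}_{r/s}(0)=1$. $\Phi_d(q)$ is the $d$-th cyclotomic polynomial. *)

theory Defs
  imports
    "HOL-Analysis.Cartesian_Space"
    "HOL-Computational_Algebra.Polynomial_Factorial"
    "HOL-Number_Theory.Totient"
begin

section \<open>$q$-deformed rational numbers\<close>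

text \<open>The field of rational functions in \<open>q\<close> is the fraction field of \<open>\<int>[q]\<close>.\<close>

definition qvar :: "int poly fract" where
  "qvar = to_fract [:0, 1:]"

text \<open>Hirzebruch--Jung continued fractions; the empty list is a dummy case.\<close>

fun hj :: "nat list \<Rightarrow> rat" where
  "hj [] = 0"
| "hj [c] = of_nat c"
| "hj (c # cs) = of_nat c - 1 / hj cs"

definition hj_list :: "nat list \<Rightarrow> bool" where
  "hj_list cs \<longleftrightarrow> cs \<noteq> [] \<and> (\<forall>c\<in>set cs. 2 \<le> c)"

definition R_mat :: "int poly fract ^ 2 ^ 2" where
  "R_mat = vector [vector [qvar, 1], vector [0, 1]]"

definition S_mat :: "int poly fract ^ 2 ^ 2" where
  "S_mat = vector [vector [0, - inverse qvar], vector [1, 0]]"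

text \<open>The power \<open>R_mat\<close>\<open>\<^sup>c\<close> is an iterate of \<^term>\<open>(**) R_mat\<close>,
  because \<open>^\<close> is the entrywise power on the type of matrices.\<close>

fun M_mat :: "nat list \<Rightarrow> int poly fract ^ 2 ^ 2" where
  "M_mat [] = mat 1"
| "M_mat (c # cs) = ((**) R_mat ^^ c) (S_mat ** M_mat cs)"

definition is_q_deformation :: "(rat \<Rightarrow> int poly fract) \<Rightarrow> bool" where
  "is_q_deformation f \<longleftrightarrow>
     (\<forall>cs. hj_list cs \<longrightarrow> f (hj cs) = M_mat cs $ 1 $ 1 / M_mat cs $ 2 $ 1) \<and>
     (\<forall>x. f (x + 1) = qvar * f x + 1) \<and>
     f 0 = 0"

text \<open>\<open>q_rat x\<close> is \<open>[x]\<^sub>q\<close>; see \<open>ex1_q_deformation\<close> below.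
  The value at infinity is left out: it does not enter the definition of the numerator and
  denominator of a fraction \<open>r/s\<close> with \<open>s > 0\<close>.\<close>

definition q_rat :: "rat \<Rightarrow> int poly fract" where
  "q_rat = (THE f. is_q_deformation f)"

definition laurent :: "int poly fract set" where
  "laurent = {to_fract p / qvar ^ k | p k. True}"

definition laurent_dvd :: "int poly fract \<Rightarrow> int poly fract \<Rightarrow> bool" where
  "laurent_dvd f g \<longleftrightarrow> (\<exists>h\<in>laurent. g = f * h)"

definition laurent_coprime :: "int poly fract \<Rightarrow> int poly fract \<Rightarrow> bool" where
  "laurent_coprime f g \<longleftrightarrow>
     (\<forall>d\<in>laurent. laurent_dvd d f \<and> laurent_dvd d g \<longrightarrow> laurent_dvd d 1)"

definition is_q_fraction :: "rat \<Rightarrow> int poly fract \<times> int poly \<Rightarrow> bool" where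
  "is_q_fraction x = (\<lambda>(R, S). R \<in> laurent \<and> laurent_coprime R (to_fract S) \<and>
     poly S 0 = 1 \<and> q_rat x = R / to_fract S)"

text \<open>The pair of the Laurent polynomial $\mathcal{R}_x(q)$ and the polynomial
  $\mathcal{S}_x(q)$; see \<open>ex1_q_fraction\<close> and \<open>is_q_fraction_hj\<close> below.\<close>

definition q_fraction :: "rat \<Rightarrow> int poly fract \<times> int poly" where
  "q_fraction x = (THE RS. is_q_fraction x RS)"

definition q_num :: "rat \<Rightarrow> int poly fract" where
  "q_num x = fst (q_fraction x)"

definition q_den :: "rat \<Rightarrow> int poly" where
  "q_den x = snd (q_fraction x)"


section \<open>Cyclotomic polynomials\<close>

definition complex_cyclotomic :: "nat \<Rightarrow> complex poly" where
  "complex_cyclotomic d = (\<Prod>k\<in>totatives d. [:- cis (2 * pi * real k / real d), 1:])"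

text \<open>The polynomial has integer coefficients; see \<open>ex1_cyclotomic\<close> below.\<close>

definition cyclotomic :: "nat \<Rightarrow> int poly" where
  "cyclotomic d = (THE p. map_poly of_int p = complex_cyclotomic d)"

definition D_set :: "nat \<Rightarrow> nat set" where
  "D_set a = {d. 2 \<le> d \<and> (d dvd a - 1 \<or> d dvd a + 1)}"

definition C_poly :: "nat \<Rightarrow> nat \<Rightarrow> int poly" where
  "C_poly a n = (\<Prod>d\<in>{d\<in>D_set a. d dvd n}. cyclotomic d)"


section \<open>Well-definedness\<close>

subsection \<open>Hirzebruch--Jung expansions\<close>

lemma hj_list_Cons: "hj_list (c # cs) \<longleftrightarrow> 2 \<le> c \<and> (cs = [] \<or> hj_list cs)"
  by (auto simp: hj_list_def)

lemma hj_Cons: "cs \<noteq> [] \<Longrightarrow> hj (c # cs) = of_nat c - 1 / hj cs"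
  by (cases cs) auto

lemma hj_gt_1: "hj_list cs \<Longrightarrow> hj cs > 1"
proof (induction cs)
  case Nil
  then show ?case by (simp add: hj_list_def)
next
  case (Cons c cs)
  have c: "(of_nat c :: rat) \<ge> 2"
    using Cons.prems of_nat_mono[of 2 c] by (simp add: hj_list_Cons)
  show ?case
  proof (cases "cs = []")
    case False
    then have "hj cs > 1" using Cons by (simp add: hj_list_Cons)
    then have "1 / hj cs < 1" by (simp add: divide_simps)
    then show ?thesis using c False by (simp add: hj_Cons)
  qed (use c in simp)
qed

lemma ceiling_hj:
  assumes "hj_list (c # cs)"
  shows "\<lceil>hj (c # cs)\<rceil> = int c"
proof (cases "cs = []")
  case False
  then have "hj cs > 1" using assms hj_gt_1 by (simp add: hj_list_Cons)
  then have "0 < 1 / hj cs" "1 / hj cs < 1" by (simp_all add: divide_simps)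
  then show ?thesis using False by (simp add: hj_Cons ceiling_eq_iff)
qed simp

lemma hj_inj: "hj_list cs \<Longrightarrow> hj_list ds \<Longrightarrow> hj cs = hj ds \<Longrightarrow> cs = ds"
proof (induction cs arbitrary: ds)
  case Nil
  then show ?case by (simp add: hj_list_def)
next
  case (Cons c cs)
  obtain d ds' where ds: "ds = d # ds'"
    using Cons.prems(2) by (cases ds) (auto simp: hj_list_def)
  have cd: "c = d"
    using ceiling_hj[OF Cons.prems(1)] ceiling_hj[of d ds'] Cons.prems ds by simp
  have *: "hj (c # cs') \<noteq> hj [c]" if "hj_list cs'" for cs'
    using hj_gt_1[OF that] that by (subst hj_Cons) (auto simp: hj_list_def)
  show ?case
  proof (cases "cs = [] \<or> ds' = []")
    case True
    then show ?thesis
      using * Cons.prems ds cd by (metis hj_list_Cons)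
  next
    case False
    then have v: "hj_list cs" "hj_list ds'" using Cons.prems ds by (auto simp: hj_list_Cons)
    have "1 / hj cs = 1 / hj ds'"
      using Cons.prems(3) False ds cd by (simp add: hj_Cons)
    then have "hj cs = hj ds'" by simp
    then show ?thesis using Cons.IH[OF v] ds cd by simp
  qed
qed

lemma hj_ex_aux: "0 < s \<Longrightarrow> s < r \<Longrightarrow> \<exists>cs. hj_list cs \<and> hj cs = of_nat r / of_nat s"
proof (induction s arbitrary: r rule: less_induct)
  case (less s)
  define c where "c = (r + s - 1) div s"
  define t where "t = c * s - r"
  have mm: "(r + s - 1) div s * s + (r + s - 1) mod s = r + s - 1" by simp
  have "(r + s - 1) mod s < s" using less.prems by simp
  then have lo: "r \<le> c * s" and hi: "c * s < r + s"
    using mm less.prems unfolding c_def by linarith+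
  have c2: "c \<ge> 2"
  proof (rule ccontr)
    assume "\<not> c \<ge> 2"
    then have "c * s \<le> 1 * s" by (intro mult_right_mono) auto
    then show False using lo less.prems by linarith
  qed
  have t: "t < s" "r = c * s - t" "t \<le> c * s" using lo hi by (auto simp: t_def)
  have req: "(of_nat r :: rat) = of_nat c * of_nat s - of_nat t"
    using t by (simp add: of_nat_diff)
  show ?case
  proof (cases "t = 0")
    case True
    then have "hj_list [c] \<and> hj [c] = of_nat r / of_nat s"
      using c2 req less.prems by (simp add: hj_list_def)
    then show ?thesis by blast
  next
    case False
    then obtain cs where cs: "hj_list cs" "hj cs = of_nat s / of_nat t"
      using less.IH[of t s] t by auto
    then have "hj (c # cs) = of_nat c - of_nat t / of_nat s"
      by (subst hj_Cons) (auto simp: hj_list_def)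
    then have "hj (c # cs) = of_nat r / of_nat s"
      using req less.prems by (simp add: field_simps)
    then show ?thesis using cs c2 by (intro exI[of _ "c # cs"]) (auto simp: hj_list_Cons)
  qed
qed

lemma hj_ex:
  assumes "x > 1"
  shows "\<exists>cs. hj_list cs \<and> hj cs = x"
proof -
  obtain r s where x: "x = Rat.Fract r s" "s > 0" by (cases x) auto
  then have x': "x = of_int r / of_int s" by (simp add: Fract_of_int_quotient)
  have "of_int s < (of_int r :: rat)"
    using assms x(2) unfolding x' by (subst (asm) less_divide_eq_1_pos) auto
  then have "s < r" by simp
  then have "\<exists>cs. hj_list cs \<and> hj cs = of_nat (nat r) / of_nat (nat s)"
    using x(2) by (intro hj_ex_aux) auto
  then show ?thesis using x' x(2) \<open>s < r\<close> by simp
qed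

theorem ex1_hj: "x > 1 \<Longrightarrow> \<exists>!cs. hj_list cs \<and> hj cs = x"
  using hj_ex hj_inj by metis


subsection \<open>The matrices\<close>

lemma qvar_nz [simp]: "qvar \<noteq> 0"
  by (simp add: qvar_def)

lemma R_mat_mult:
  "(R_mat ** A) $ 1 $ j = qvar * A $ 1 $ j + A $ 2 $ j"
  "(R_mat ** A) $ 2 $ j = A $ 2 $ j"
  by (simp_all add: R_mat_def matrix_matrix_mult_def sum_2)

lemma S_mat_mult:
  "(S_mat ** A) $ 1 $ j = - inverse qvar * A $ 2 $ j"
  "(S_mat ** A) $ 2 $ j = A $ 1 $ j"
  by (simp_all add: S_mat_def matrix_matrix_mult_def sum_2)

lemma to_fract_pCons0: "to_fract (pCons 0 p) = qvar * to_fract p"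
  by (simp add: qvar_def flip: to_fract_mult)

lemma M_mat_step:
  fixes A :: "int poly fract ^ 2 ^ 2"
  assumes "A $ 1 $ 1 = to_fract P" "A $ 2 $ 1 = to_fract Q" "c \<ge> 1"
  shows "\<exists>P'. (((**) R_mat ^^ c) (S_mat ** A)) $ 1 $ 1 = to_fract P' \<and>
      (((**) R_mat ^^ c) (S_mat ** A)) $ 2 $ 1 = to_fract P \<and>
      coeff P' 0 = (if c = 1 then coeff P 0 - coeff Q 0 else coeff P 0)"
  using assms(3)
proof (induction c rule: dec_induct)
  case base
  show ?case
    by (rule exI[of _ "P - Q"]) (simp add: R_mat_mult S_mat_mult assms)
next
  case (step c)
  then obtain P' where P': "(((**) R_mat ^^ c) (S_mat ** A)) $ 1 $ 1 = to_fract P'"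
      "(((**) R_mat ^^ c) (S_mat ** A)) $ 2 $ 1 = to_fract P" by blast
  show ?case
    using P' step.hyps by (intro exI[of _ "pCons 0 P' + P"])
      (simp add: R_mat_mult to_fract_pCons0)
qed

lemma M_mat_col:
  assumes "\<forall>c\<in>set cs. 2 \<le> c"
  shows "\<exists>P Q. M_mat cs $ 1 $ 1 = to_fract P \<and> M_mat cs $ 2 $ 1 = to_fract Q \<and>
           coeff P 0 = 1 \<and> (cs \<noteq> [] \<longrightarrow> coeff Q 0 = 1)"
  using assms
proof (induction cs)
  case Nil
  show ?case by (intro exI[of _ 1] exI[of _ 0]) (simp add: mat_def)
next
  case (Cons c cs)
  then obtain P Q where PQ: "M_mat cs $ 1 $ 1 = to_fract P" "M_mat cs $ 2 $ 1 = to_fract Q"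
    "coeff P 0 = 1" by auto
  have "c \<ge> 1" "c \<noteq> 1" using Cons.prems by auto
  then show ?case using M_mat_step[OF PQ(1,2), of c] PQ(3) by auto
qed

lemma M_mat_21_nz: "hj_list cs \<Longrightarrow> M_mat cs $ 2 $ 1 \<noteq> 0"
  using M_mat_col[of cs] by (auto simp: hj_list_def)

lemma M_mat_Suc: "M_mat (Suc c # cs) = R_mat ** M_mat (c # cs)"
  by simp

lemma hj_Suc: "hj (Suc c # cs) = hj (c # cs) + 1"
  by (cases cs) auto


subsection \<open>Existence and uniqueness of the $q$-deformation\<close>

lemma q_deformation_shift:
  assumes "is_q_deformation f"
  shows "f x = ((\<lambda>y. (y - 1) / qvar) ^^ m) (f (x + of_nat m))"
proof (induction m)
  case (Suc m)
  have "f (x + of_nat m + 1) = qvar * f (x + of_nat m) + 1"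
    using assms by (simp add: is_q_deformation_def)
  then have "(f (x + of_nat (Suc m)) - 1) / qvar = f (x + of_nat m)"
    by (simp add: add.assoc add.commute[of 1])
  then show ?case using Suc by (simp add: funpow_Suc_right del: funpow.simps)
qed simp

theorem ex1_q_deformation: "\<exists>!f. is_q_deformation f"
proof (rule ex_ex1I)
  define ratio where "ratio cs = M_mat cs $ 1 $ 1 / M_mat cs $ 2 $ 1" for cs
  define h where "h x = ratio (THE cs. hj_list cs \<and> hj cs = x)" for x
  have h_hj: "h (hj cs) = ratio cs" if "hj_list cs" for cs
    unfolding h_def using that hj_inj by (intro arg_cong[of _ _ ratio] the_equality) auto
  have h_Suc: "h (x + 1) = qvar * h x + 1" if "x > 1" for x :: rat
  proof -
    obtain cs where cs: "hj_list cs" "hj cs = x" using hj_ex[OF \<open>x > 1\<close>] by blast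
    obtain c cs' where cs': "cs = c # cs'" using cs by (cases cs) (auto simp: hj_list_def)
    have v: "hj_list (Suc c # cs')" using cs cs' by (simp add: hj_list_Cons)
    have "h (x + 1) = ratio (Suc c # cs')"
      using h_hj[OF v] cs cs' by (simp add: hj_Suc)
    also have "\<dots> = qvar * ratio cs + 1"
      using M_mat_21_nz[OF cs(1)] unfolding ratio_def M_mat_Suc R_mat_mult cs'
      by (simp add: field_simps)
    finally show ?thesis using h_hj[OF cs(1)] cs(2) by simp
  qed
  define unshift where "unshift y = (y - 1) / qvar" for y
  have unshift_q: "unshift (qvar * y + 1) = y" "qvar * unshift y + 1 = y" for y
    by (simp_all add: unshift_def)
  have inv: "(unshift ^^ (m + k)) (h (x + of_nat (m + k))) = (unshift ^^ m) (h (x + of_nat m))"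
    if "x + of_nat m > 1" for x m k
  proof (induction k)
    case (Suc k)
    have "x + of_nat (m + k) > 1" using that by simp
    then have "h (x + of_nat (m + Suc k)) = qvar * h (x + of_nat (m + k)) + 1"
      using h_Suc[of "x + of_nat (m + k)"] by (simp add: algebra_simps)
    then show ?case using Suc by (simp add: funpow_Suc_right unshift_q del: funpow.simps)
  qed simp
  define N where "N x = nat \<lceil>2 - x\<rceil>" for x :: rat
  have N: "x + of_nat (N x) > 1" for x
  proof -
    have "2 - x \<le> of_int \<lceil>2 - x\<rceil>" by simp
    also have "\<dots> \<le> (of_nat (N x) :: rat)" unfolding N_def by simp
    finally show ?thesis by simp
  qed
  define f where "f x = (unshift ^^ N x) (h (x + of_nat (N x)))" for x
  have f: "f x = (unshift ^^ m) (h (x + of_nat m))" if "x + of_nat m > 1" for x m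
    using inv[OF that, of "N x"] inv[OF N, of x m] unfolding f_def by (simp add: add.commute)
  have f_Suc: "f (x + 1) = qvar * f x + 1" for x
  proof -
    have "f x = (unshift ^^ Suc (N x)) (h (x + of_nat (Suc (N x))))"
      using N[of x] by (intro f) simp
    also have "\<dots> = unshift ((unshift ^^ N x) (h (x + 1 + of_nat (N x))))"
      by (simp add: algebra_simps)
    also have "(unshift ^^ N x) (h (x + 1 + of_nat (N x))) = f (x + 1)"
      using N[of x] by (intro f[symmetric]) simp
    finally show ?thesis by (simp add: unshift_q)
  qed
  have f_hj: "f (hj cs) = ratio cs" if "hj_list cs" for cs
    using f[of "hj cs" 0] h_hj[OF that] hj_gt_1[OF that] by simp
  have "f 2 = ratio [2]" using f_hj[of "[2]"] by (simp add: hj_list_def)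
  also have "\<dots> = qvar + 1"
    by (simp add: ratio_def numeral_2_eq_2 R_mat_mult S_mat_mult mat_def)
  finally have "qvar * f 1 + 1 = qvar + 1" using f_Suc[of 1] by simp
  then have "f 1 = 1" by simp
  then have "f 0 = 0" using f_Suc[of 0] by simp
  then show "\<exists>f. is_q_deformation f"
    using f_Suc f_hj unfolding is_q_deformation_def ratio_def by blast
next
  fix f g assume fg: "is_q_deformation f" "is_q_deformation g"
  show "f = g"
  proof
    fix x :: rat
    obtain m :: nat where m: "of_nat m > 1 - x" using reals_Archimedean2 by blast
    then obtain cs where "hj_list cs" "hj cs = x + of_nat m"
      using hj_ex[of "x + of_nat m"] by auto
    then have "f (x + of_nat m) = g (x + of_nat m)"
      using fg unfolding is_q_deformation_def by metis
    then show "f x = g x"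
      using fg q_deformation_shift[of f x m] q_deformation_shift[of g x m] by simp
  qed
qed

lemma is_q_deformation_q_rat: "is_q_deformation q_rat"
  unfolding q_rat_def using ex1_q_deformation by (rule theI')

lemma q_rat_hj: "hj_list cs \<Longrightarrow> q_rat (hj cs) = M_mat cs $ 1 $ 1 / M_mat cs $ 2 $ 1"
  and q_rat_add_1: "q_rat (x + 1) = qvar * q_rat x + 1"
  and q_rat_0: "q_rat 0 = 0"
  using is_q_deformation_q_rat by (auto simp: is_q_deformation_def)


subsection \<open>Laurent polynomials\<close>

lemma laurent_to_fract [simp]: "to_fract p \<in> laurent"
  unfolding laurent_def by (auto intro!: exI[of _ p] exI[of _ "0::nat"])

lemma laurent_0 [simp]: "0 \<in> laurent" and laurent_1 [simp]: "1 \<in> laurent"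
  using laurent_to_fract[of 0] laurent_to_fract[of 1] by auto

lemma laurent_qvar [simp]: "qvar \<in> laurent"
  by (simp add: qvar_def)

lemma to_fract_power: "to_fract (p ^ n) = to_fract p ^ n"
  by (induction n) auto

lemma laurent_inverse_qvar [simp]: "inverse qvar \<in> laurent"
  unfolding laurent_def by (auto intro!: exI[of _ 1] exI[of _ "1::nat"] simp: field_simps)

lemma laurent_mult [intro]:
  assumes "f \<in> laurent" "g \<in> laurent"
  shows "f * g \<in> laurent"
proof -
  obtain p k p' k' where "f = to_fract p / qvar ^ k" "g = to_fract p' / qvar ^ k'"
    using assms unfolding laurent_def by blast
  then have "f * g = to_fract (p * p') / qvar ^ (k + k')" by (simp add: power_add)
  then show ?thesis unfolding laurent_def by blast
qed

lemma laurent_add [intro]: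
  assumes "f \<in> laurent" "g \<in> laurent"
  shows "f + g \<in> laurent"
proof -
  obtain p k p' k' where "f = to_fract p / qvar ^ k" "g = to_fract p' / qvar ^ k'"
    using assms unfolding laurent_def by blast
  then have "f + g = to_fract (p * [:0, 1:] ^ k' + p' * [:0, 1:] ^ k) / qvar ^ (k + k')"
    by (simp add: to_fract_power power_add add_divide_distrib flip: qvar_def)
  then show ?thesis unfolding laurent_def by blast
qed

lemma laurent_uminus [intro]: "f \<in> laurent \<Longrightarrow> - f \<in> laurent"
  using laurent_mult[of f "to_fract (-1)"] by (simp del: laurent_to_fract) (metis laurent_to_fract to_fract_1 to_fract_uminus)

lemma laurent_diff [intro]: "f \<in> laurent \<Longrightarrow> g \<in> laurent \<Longrightarrow> f - g \<in> laurent"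
  using laurent_add[of f "- g"] by auto

lemma laurent_power [intro]: "f \<in> laurent \<Longrightarrow> f ^ n \<in> laurent"
  by (induction n) auto

lemma coeff_0_split:
  fixes p :: "int poly"
  assumes "p \<noteq> 0"
  obtains a p0 where "p = [:0, 1:] ^ a * p0" "coeff p0 0 \<noteq> 0"
proof -
  obtain p0 where "p = [:- 0, 1:] ^ order 0 p * p0" "\<not> [:- 0, 1:] dvd p0"
    using order_decomp[OF assms, of 0] by blast
  moreover from this have "coeff p0 0 \<noteq> 0"
    by (simp add: poly_eq_0_iff_dvd flip: poly_0_coeff_0)
  ultimately show ?thesis using that by simp
qed

lemma X_power_cancel:
  fixes p p' :: "int poly"
  assumes "[:0, 1:] ^ a * p = [:0, 1:] ^ b * p'" "coeff p 0 \<noteq> 0" "coeff p' 0 \<noteq> 0"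
  shows "a = b \<and> p = p'"
  using assms
proof (induction a arbitrary: b)
  case 0
  then show ?case by (cases b) (auto simp: coeff_mult)
next
  case (Suc a)
  then show ?case by (cases b) (auto simp: mult.assoc)
qed

lemma laurent_unit_normalized:
  assumes u: "u \<in> laurent" "laurent_dvd u 1"
    and S: "to_fract S2 = to_fract S * u" "poly S 0 = 1" "poly S2 0 = 1"
  shows "u = 1"
proof -
  obtain e where e: "e \<in> laurent" "1 = u * e" using u(2) by (auto simp: laurent_dvd_def)
  obtain p i p' j where p: "u = to_fract p / qvar ^ i" "e = to_fract p' / qvar ^ j"
    using u(1) e(1) unfolding laurent_def by blast
  have "to_fract (p * p') = qvar ^ (i + j)"
    using e(2) p by (simp add: field_simps power_add)
  then have pp: "p * p' = [:0, 1:] ^ (i + j)"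
    by (simp add: qvar_def flip: to_fract_power to_fract_mult)
  then have "p \<noteq> 0" "p' \<noteq> 0" by auto
  then obtain a p0 b p0' where p0: "p = [:0, 1:] ^ a * p0" "coeff p0 0 \<noteq> 0"
      "p' = [:0, 1:] ^ b * p0'" "coeff p0' 0 \<noteq> 0"
    using coeff_0_split by metis
  have "[:0, 1:] ^ (a + b) * (p0 * p0') = [:0, 1:] ^ (i + j) * 1"
    using pp p0 by (simp add: power_add mult_ac)
  then have "p0 * p0' = 1"
    using X_power_cancel[of "a + b" "p0 * p0'" "i + j" 1] p0 by (simp add: coeff_mult)
  then have unit: "p0 dvd 1" by (metis dvd_triv_left)
  have "to_fract (S2 * [:0, 1:] ^ i) = to_fract (S * p)"
    using S(1) p(1) by (simp add: to_fract_power field_simps flip: qvar_def)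
  then have "[:0, 1:] ^ i * S2 = [:0, 1:] ^ a * (p0 * S)"
    by (simp only: to_fract_eq_iff p0(1) mult_ac)
  moreover have "coeff S 0 = 1" "coeff S2 0 = 1" using S by (simp_all add: poly_0_coeff_0)
  ultimately have *: "i = a" "S2 = p0 * S"
    using X_power_cancel[of i S2 a "p0 * S"] p0 by (simp_all add: coeff_mult)
  then have "coeff p0 0 = 1"
    using \<open>coeff S 0 = 1\<close> \<open>coeff S2 0 = 1\<close> by (simp add: coeff_mult)
  moreover obtain c where "p0 = [:c:]" using unit by (auto simp: is_unit_poly_iff)
  ultimately have "p0 = 1" by (simp add: one_pCons)
  then show ?thesis using p(1) p0(1) * by (simp add: to_fract_power flip: qvar_def)
qed


subsection \<open>Numerators and denominators\<close>

text \<open>Coprimality is carried along in the stronger form of a Bezout relation.\<close>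

definition laurent_bezout :: "int poly fract \<Rightarrow> int poly fract \<Rightarrow> bool" where
  "laurent_bezout R S \<longleftrightarrow> (\<exists>u\<in>laurent. \<exists>v\<in>laurent. R * u + S * v = 1)"

lemma laurent_bezout_coprime:
  assumes "laurent_bezout R S"
  shows "laurent_coprime R S"
  unfolding laurent_coprime_def
proof (intro ballI impI)
  fix d assume "d \<in> laurent" "laurent_dvd d R \<and> laurent_dvd d S"
  then obtain f g where fg: "f \<in> laurent" "g \<in> laurent" "R = d * f" "S = d * g"
    by (auto simp: laurent_dvd_def)
  obtain u v where "u \<in> laurent" "v \<in> laurent" "R * u + S * v = 1"
    using assms by (auto simp: laurent_bezout_def)
  then have "1 = d * (f * u + g * v)" "f * u + g * v \<in> laurent"
    using fg by (auto simp: algebra_simps)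
  then show "laurent_dvd d 1" by (auto simp: laurent_dvd_def)
qed

lemma M_mat_laurent: "M_mat cs $ i $ j \<in> laurent"
proof (induction cs arbitrary: i j)
  case Nil
  then show ?case by (simp add: mat_def)
next
  case (Cons c cs)
  have "(((**) R_mat ^^ c) (S_mat ** M_mat cs)) $ i $ j \<in> laurent" for i j
  proof (induction c arbitrary: i j)
    case 0
    show ?case using exhaust_2[of i] Cons by (auto simp: S_mat_mult intro!: laurent_uminus laurent_mult)
  next
    case (Suc c)
    then show ?case using exhaust_2[of i] by (auto simp: R_mat_mult intro!: laurent_add laurent_mult)
  qed
  then show ?case by simp
qed

lemma M_mat_det:
  "\<exists>w\<in>laurent. (M_mat cs $ 1 $ 1 * M_mat cs $ 2 $ 2 - M_mat cs $ 2 $ 1 * M_mat cs $ 1 $ 2) * w = 1"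
proof (induction cs)
  case Nil
  show ?case by (rule bexI[of _ 1]) (simp_all add: mat_def)
next
  case (Cons c cs)
  define dt where "dt A = A $ 1 $ 1 * A $ 2 $ 2 - A $ 2 $ 1 * A $ 1 $ 2"
    for A :: "int poly fract ^ 2 ^ 2"
  have dR: "dt (R_mat ** A) = qvar * dt A" for A
    by (simp add: dt_def R_mat_mult algebra_simps)
  have dS: "dt (S_mat ** A) = inverse qvar * dt A" for A
    by (simp add: dt_def S_mat_mult algebra_simps)
  have "dt (M_mat (c # cs)) = qvar ^ c * inverse qvar * dt (M_mat cs)"
  proof -
    have "dt (((**) R_mat ^^ c) A) = qvar ^ c * dt A" for A
      by (induction c) (simp_all add: dR)
    then show ?thesis by (simp add: dS)
  qed
  then have dM: "dt (M_mat (c # cs)) = qvar ^ c * inverse qvar * dt (M_mat cs)" .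
  obtain w where w: "w \<in> laurent" "dt (M_mat cs) * w = 1"
    using Cons by (auto simp: dt_def)
  have "inverse qvar ^ c * qvar * w \<in> laurent"
    using w(1) by (intro laurent_mult laurent_power) auto
  moreover have "dt (M_mat (c # cs)) * (inverse qvar ^ c * qvar * w) =
      (qvar * inverse qvar) ^ c * (qvar * inverse qvar) * (dt (M_mat cs) * w)"
    unfolding dM power_mult_distrib by (simp only: mult_ac)
  then have "dt (M_mat (c # cs)) * (inverse qvar ^ c * qvar * w) = 1"
    using w(2) by simp
  ultimately show ?case unfolding dt_def by blast
qed

lemma M_mat_bezout: "laurent_bezout (M_mat cs $ 1 $ 1) (M_mat cs $ 2 $ 1)"
proof -
  obtain w where w: "w \<in> laurent"
    "(M_mat cs $ 1 $ 1 * M_mat cs $ 2 $ 2 - M_mat cs $ 2 $ 1 * M_mat cs $ 1 $ 2) * w = 1"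
    using M_mat_det by blast
  have "M_mat cs $ 1 $ 1 * (M_mat cs $ 2 $ 2 * w) + M_mat cs $ 2 $ 1 * (- M_mat cs $ 1 $ 2 * w) = 1"
    using w(2) by (simp add: algebra_simps)
  moreover have "M_mat cs $ 2 $ 2 * w \<in> laurent" "- M_mat cs $ 1 $ 2 * w \<in> laurent"
    using w(1) M_mat_laurent by blast+
  ultimately show ?thesis unfolding laurent_bezout_def by blast
qed

text \<open>For \<open>x > 1\<close> both definitions of numerator and denominator agree.\<close>

theorem is_q_fraction_hj:
  assumes "hj_list cs"
  shows "\<exists>S. M_mat cs $ 2 $ 1 = to_fract S \<and> is_q_fraction (hj cs) (M_mat cs $ 1 $ 1, S)"
proof -
  obtain S where "M_mat cs $ 2 $ 1 = to_fract S" "coeff S 0 = 1"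
    using M_mat_col[of cs] assms by (auto simp: hj_list_def)
  then show ?thesis
    using M_mat_bezout[of cs] laurent_bezout_coprime[of "M_mat cs $ 1 $ 1" "M_mat cs $ 2 $ 1"]
      M_mat_laurent[of cs 1 1] q_rat_hj[OF assms]
    by (auto simp: is_q_fraction_def poly_0_coeff_0)
qed

lemma q_fraction_bezout_ex:
  "\<exists>R S. R \<in> laurent \<and> laurent_bezout R (to_fract S) \<and> poly S 0 = 1 \<and> q_rat x = R / to_fract S"
proof -
  obtain m :: nat where m: "of_nat m > 1 - x" using reals_Archimedean2 by blast
  then obtain cs where cs: "hj_list cs" "hj cs = x + of_nat m"
    using hj_ex[of "x + of_nat m"] by auto
  have "\<exists>R S. R \<in> laurent \<and> laurent_bezout R (to_fract S) \<and> poly S 0 = 1 \<and>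
          q_rat (x + of_nat m - of_nat k) = R / to_fract S" for k
  proof (induction k)
    case 0
    obtain S where "M_mat cs $ 2 $ 1 = to_fract S" "coeff S 0 = 1"
      using M_mat_col[of cs] cs by (auto simp: hj_list_def)
    then show ?case
      using M_mat_bezout[of cs] M_mat_laurent[of cs 1 1] q_rat_hj[OF cs(1)] cs
      by (auto simp: poly_0_coeff_0)
  next
    case (Suc k)
    then obtain R S where RS: "R \<in> laurent" "laurent_bezout R (to_fract S)" "poly S 0 = 1"
      "q_rat (x + of_nat m - of_nat k) = R / to_fract S" by blast
    define R' where "R' = (R - to_fract S) * inverse qvar"
    have R': "R' \<in> laurent" unfolding R'_def using RS by (intro laurent_mult laurent_diff) auto
    obtain u v where uv: "u \<in> laurent" "v \<in> laurent" "R * u + to_fract S * v = 1"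
      using RS(2) by (auto simp: laurent_bezout_def)
    have "R' * (qvar * u) + to_fract S * (u + v) = 1"
    proof -
      have *: "R' * qvar = R - to_fract S" by (simp add: R'_def)
      show ?thesis
        unfolding mult.assoc[of R' qvar u, symmetric] * using uv(3) by (simp add: algebra_simps)
    qed
    then have b: "laurent_bezout R' (to_fract S)"
      using uv unfolding laurent_bezout_def by (meson laurent_add laurent_mult laurent_qvar)
    have S0: "S \<noteq> 0" using RS(3) by auto
    have "qvar * q_rat (x + of_nat m - of_nat (Suc k)) + 1 = R / to_fract S"
      using q_rat_add_1[of "x + of_nat m - of_nat (Suc k)"] RS(4) by (simp add: algebra_simps)
    then have "q_rat (x + of_nat m - of_nat (Suc k)) = (R / to_fract S - 1) * inverse qvar"
      by (metis add_diff_cancel_right' mult.commute nonzero_mult_div_cancel_left qvar_nz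
          divide_inverse)
    also have "\<dots> = R' / to_fract S"
      using S0 by (simp add: R'_def field_simps)
    finally show ?case using R' b RS(3) by blast
  qed
  from this[of m] show ?thesis by simp
qed

theorem ex1_q_fraction: "\<exists>!RS. is_q_fraction x RS"
proof -
  obtain R S where RS: "R \<in> laurent" "laurent_bezout R (to_fract S)" "poly S 0 = 1"
    "q_rat x = R / to_fract S" using q_fraction_bezout_ex by blast
  have S0: "to_fract S \<noteq> 0" using RS(3) by auto
  obtain u v where uv: "u \<in> laurent" "v \<in> laurent" "R * u + to_fract S * v = 1"
    using RS(2) by (auto simp: laurent_bezout_def)
  show ?thesis
  proof (rule ex1I[of _ "(R, S)"])
    show "is_q_fraction x (R, S)"
      using RS laurent_bezout_coprime by (simp add: is_q_fraction_def)
  next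
    fix RS' assume "is_q_fraction x RS'"
    then obtain R2 S2 where 2: "RS' = (R2, S2)" "R2 \<in> laurent"
      "laurent_coprime R2 (to_fract S2)" "poly S2 0 = 1" "q_rat x = R2 / to_fract S2"
      by (cases RS') (auto simp: is_q_fraction_def)
    have S20: "to_fract S2 \<noteq> 0" using 2(4) by auto
    have cross: "R * to_fract S2 = R2 * to_fract S"
      using RS(4) 2(5) S0 S20 by (simp add: field_simps)
    define w where "w = R2 * u + to_fract S2 * v"
    have w: "w \<in> laurent" unfolding w_def using uv 2 by (intro laurent_add laurent_mult) auto
    have "to_fract S * w = (R2 * to_fract S) * u + to_fract S2 * to_fract S * v"
      by (simp add: w_def algebra_simps)
    also have "\<dots> = to_fract S2 * (R * u + to_fract S * v)"
      unfolding cross[symmetric] by (simp add: algebra_simps)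
    finally have S2: "to_fract S2 = to_fract S * w" using uv(3) by simp
    then have R2: "R2 = R * w"
      using cross S0 by (simp add: mult_ac)
    have "laurent_dvd w 1"
    proof -
      have "laurent_dvd w R2" "laurent_dvd w (to_fract S2)"
        unfolding laurent_dvd_def using R2 S2 RS(1) by (auto simp: mult_ac)
      then show ?thesis using 2(3) w by (auto simp: laurent_coprime_def)
    qed
    then have "w = 1" using laurent_unit_normalized[OF w _ S2 RS(3) 2(4)] by simp
    then show "RS' = (R, S)" using 2(1) S2 R2 by simp
  qed
qed


subsection \<open>Cyclotomic polynomials have integer coefficients\<close>

lemma map_poly_of_int_mult:
  "map_poly of_int (p * q) = map_poly of_int p * (map_poly of_int q :: complex poly)"
  by (rule poly_eqI) (simp add: coeff_map_poly coeff_mult)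

lemma map_poly_of_int_add:
  "map_poly of_int (p + q) = map_poly of_int p + (map_poly of_int q :: complex poly)"
  by (rule poly_eqI) (simp add: coeff_map_poly)

lemma map_poly_of_int_prod:
  "map_poly of_int (\<Prod>i\<in>A. f i) = (\<Prod>i\<in>A. map_poly of_int (f i) :: complex poly)"
  by (induction A rule: infinite_finite_induct) (simp_all add: map_poly_of_int_mult)

lemma map_poly_of_int_inj:
  "map_poly of_int p = (map_poly of_int q :: complex poly) \<Longrightarrow> p = q"
  by (auto simp: poly_eq_iff coeff_map_poly)

lemma monom_minus_1_eq_prod:
  assumes "n > 0"
  shows "monom 1 n - 1 = (\<Prod>k\<in>{0<..n}. [:- cis (2 * pi * real k / real n), 1:])"
proof -
  define z where "z k = cis (2 * pi * real k / real n)" for k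
  have z: "z k ^ n = 1" for k
  proof -
    have "z k ^ n = cis (2 * pi * real k)" using assms by (simp add: z_def DeMoivre)
    then show ?thesis by (simp add: cis_multiple_2pi)
  qed
  have bij: "bij_betw z {..<n} {z. z ^ n = 1}"
    unfolding z_def using bij_betw_roots_unity[OF assms] .
  have z_n: "z n = z 0" using assms by (simp add: z_def)
  have img: "z ` {0<..n} = {z. z ^ n = 1}"
  proof
    show "{z::complex. z ^ n = 1} \<subseteq> z ` {0<..n}"
    proof
      fix y assume "y \<in> {z::complex. z ^ n = 1}"
      then obtain k where "k < n" "y = z k" using bij by (auto simp: bij_betw_def)
      then show "y \<in> z ` {0<..n}"
        using z_n assms by (cases "k = 0") (auto intro!: image_eqI[of _ z n])
    qed
  qed (auto simp: z)
  have deg: "degree (\<Prod>k\<in>{0<..n}. [:- z k, 1:]) = n"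
    by (subst degree_prod_eq_sum_degree) auto
  have lc: "lead_coeff (\<Prod>k\<in>{0<..n}. [:- z k, 1:]) = 1"
    by (subst lead_coeff_prod) auto
  have "monom 1 n - 1 = (\<Prod>k\<in>{0<..n}. [:- z k, 1:])"
  proof (rule poly_eqI_degree_lead_coeff[where n = n and A = "{z::complex. z ^ n = 1}"])
    show "coeff (monom 1 n - 1) n = coeff (\<Prod>k\<in>{0<..n}. [:- z k, 1:]) n"
      using lc deg assms by simp
    show "n \<le> card {z::complex. z ^ n = 1}" using card_roots_unity_eq[OF assms] by simp
    show "degree (monom 1 n - 1 :: complex poly) \<le> n"
      by (intro degree_diff_le) (auto simp: degree_monom_le)
    show "degree (\<Prod>k\<in>{0<..n}. [:- z k, 1:]) \<le> n" using deg by simp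
    fix y :: complex assume y: "y \<in> {z. z ^ n = 1}"
    then obtain k where "k \<in> {0<..n}" "y = z k" using img by blast
    then have "poly (\<Prod>k\<in>{0<..n}. [:- z k, 1:]) y = 0"
      by (auto simp: poly_prod)
    then show "poly (monom 1 n - 1) y = poly (\<Prod>k\<in>{0<..n}. [:- z k, 1:]) y"
      using y by (simp add: poly_monom)
  qed
  then show ?thesis by (simp add: z_def)
qed

lemma prod_complex_cyclotomic:
  assumes "n > 0"
  shows "(\<Prod>d | d dvd n. complex_cyclotomic d) = monom 1 n - 1"
proof -
  define L where "L k = [:- cis (2 * pi * real k / real n), 1:]" for k
  have part: "(\<Prod>k\<in>{k\<in>{0<..n}. gcd k n = d}. L k) = complex_cyclotomic (n div d)"
    if "d dvd n" for d
  proof -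
    have d: "d > 0" using that assms by (auto intro: Nat.gr0I)
    have "(\<Prod>k\<in>{k\<in>{0<..n}. gcd k n = d}. L k) = (\<Prod>k\<in>totatives (n div d). L (k * d))"
      by (rule prod.reindex_bij_betw[symmetric])
         (use bij_betw_totatives_gcd_eq[of d n] that assms in simp)
    also have "\<dots> = complex_cyclotomic (n div d)"
      unfolding complex_cyclotomic_def L_def
      using that d assms by (intro prod.cong) (auto simp: real_of_nat_div field_simps)
    finally show ?thesis .
  qed
  have "monom 1 n - 1 = (\<Prod>k\<in>{0<..n}. L k)"
    using monom_minus_1_eq_prod[OF assms] by (simp add: L_def)
  also have "\<dots> = (\<Prod>d | d dvd n. \<Prod>k\<in>{k\<in>{0<..n}. gcd k n = d}. L k)"
    using assms by (intro prod.group[symmetric]) auto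
  also have "\<dots> = (\<Prod>d | d dvd n. complex_cyclotomic (n div d))"
    by (intro prod.cong refl part) simp
  also have "\<dots> = (\<Prod>d | d dvd n. complex_cyclotomic d)"
    by (rule prod.reindex_bij_witness[of _ "\<lambda>d. n div d" "\<lambda>d. n div d"])
       (use assms in auto)
  finally show ?thesis ..
qed

lemma lead_coeff_complex_cyclotomic: "lead_coeff (complex_cyclotomic d) = 1"
  unfolding complex_cyclotomic_def by (subst lead_coeff_prod) auto

lemma cyclotomic_ex: "\<exists>p :: int poly. map_poly of_int p = complex_cyclotomic n"
proof (induction n rule: less_induct)
  case (less n)
  show ?case
  proof (cases "n = 0")
    case True
    then show ?thesis by (intro exI[of _ 1]) (simp add: complex_cyclotomic_def)
  next
    case False
    define P where "P d = (SOME p :: int poly. map_poly of_int p = complex_cyclotomic d)" for d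
    have P: "map_poly of_int (P d) = complex_cyclotomic d" if "d < n" for d
      unfolding P_def using less.IH[OF that] by (rule someI_ex)
    define E where "E = {d. d dvd n} - {n}"
    have E: "d < n" if "d \<in> E" for d
      using that False dvd_imp_le[of d n] by (auto simp: E_def)
    define A where "A = (\<Prod>d\<in>E. P d)"
    define cA :: "complex poly" where "cA = map_poly of_int A"
    have cA: "cA = (\<Prod>d\<in>E. complex_cyclotomic d)"
      unfolding cA_def A_def map_poly_of_int_prod using E P by (intro prod.cong) auto
    have lcA: "lead_coeff cA = 1"
      unfolding cA by (subst lead_coeff_prod) (simp add: lead_coeff_complex_cyclotomic)
    have degA: "degree cA = degree A"
      unfolding cA_def by (rule degree_map_poly) auto
    have "of_int (lead_coeff A) = lead_coeff cA"
      unfolding degA by (simp add: cA_def coeff_map_poly)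
    then have lA: "lead_coeff A = 1" using lcA by simp
    then have A0: "A \<noteq> 0" by auto
    have "finite {d. d dvd n}" using False by simp
    then have prod: "complex_cyclotomic n * cA = monom 1 n - 1"
      using prod_complex_cyclotomic[of n] False
        prod.remove[of "{d. d dvd n}" n complex_cyclotomic]
      unfolding cA E_def by simp
    obtain B r where Br: "pseudo_divmod (monom 1 n - 1) A = (B, r)" by fastforce
    have div: "monom 1 n - 1 = A * B + r" and r: "r = 0 \<or> degree r < degree A"
      using pseudo_divmod[OF A0 Br] lA by auto
    have "monom 1 n - 1 = (map_poly of_int (monom 1 n - 1) :: complex poly)"
      by (rule poly_eqI) (simp add: coeff_map_poly)
    then have "monom 1 n - 1 = cA * map_poly of_int B + (map_poly of_int r :: complex poly)"
      unfolding div by (simp add: cA_def map_poly_of_int_mult map_poly_of_int_add)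
    then have req: "map_poly of_int r = cA * (complex_cyclotomic n - map_poly of_int B)"
      using prod by (simp add: algebra_simps)
    have "complex_cyclotomic n - map_poly of_int B = 0"
    proof (rule ccontr)
      assume nz: "complex_cyclotomic n - map_poly of_int B \<noteq> 0"
      have cA0: "cA \<noteq> 0" using lcA by auto
      have "degree (map_poly of_int r :: complex poly) = degree r"
        by (rule degree_map_poly) auto
      then have "degree r \<ge> degree A"
        unfolding req degree_mult_eq[OF cA0 nz] degA by simp
      moreover have "r \<noteq> 0" using req nz cA0 by auto
      ultimately show False using r by simp
    qed
    then show ?thesis by (intro exI[of _ B]) simp
  qed
qed

theorem ex1_cyclotomic: "\<exists>!p. map_poly of_int p = complex_cyclotomic d"
  using cyclotomic_ex map_poly_of_int_inj by metis

end

theory Submission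
  imports
    Defs
    "HOL-Computational_Algebra.Fundamental_Theorem_Algebra"
    "HOL-Library.Real_Mod"
begin

text \<open>Write \<open>[m]\<close> for \<open>1 + q + \<dots> + q\<^sup>m\<^sup>-\<^sup>1\<close>. Since \<open>a\<close> is in \<open>{2, 3, 4, 6}\<close> and prime to \<open>n\<close>, we have
  \<open>n = k a + 1\<close> or \<open>n = k a - 1\<close>, and the expansion of the fraction is explicit: up to reversal of
  coefficients the denominator is \<open>P = 1 + q [k] [a]\<close> or \<open>P = [k] [a] - q\<^sup>a\<^sup>-\<^sup>1\<close>.

  The polynomial \<open>F = (1 - q)\<^sup>2 P\<close> has six coefficients \<open>1, 1, 1, -1, -1, -1\<close>. Following Ljunggren, a
  factorization \<open>P = G H\<close> gives \<open>V = G H\<^sup>*\<close> (\<open>*\<close> is reversal) with \<open>V V\<^sup>* = P P\<^sup>*\<close>. Then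
  \<open>W = (1 - q)\<^sup>2 V\<close> has coefficients of square sum \<open>6\<close>, vanishing moments of order \<open>0\<close> and \<open>1\<close>, second
  moment \<open>\<plusminus>2 n\<close>, and the autocorrelations of \<open>F\<close>. A few of these force \<open>W\<close> to be \<open>\<plusminus>F\<close> or \<open>\<plusminus>F\<^sup>*\<close>, so
  \<open>G\<close> or \<open>H\<close> is self-reciprocal and its roots are common roots of \<open>P\<close> and \<open>P\<^sup>*\<close>. Eliminating \<open>q\<^sup>k\<close>, such a
  common root \<open>z\<close> satisfies \<open>z\<^sup>a = z\<close> or \<open>z\<^sup>a\<^sup>+\<^sup>1 = 1\<close>, and \<open>z\<^sup>n = 1\<close>; these are simple roots of \<open>P\<close>, and
  exactly the roots of \<open>C\<^sub>a\<^sub>,\<^sub>n\<close>.\<close>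

section \<open>Denominators from Hirzebruch--Jung expansions\<close>

definition qint :: "nat \<Rightarrow> int poly" where
  "qint n = (\<Sum>i<n. monom 1 i)"

lemma qint_0 [simp]: "qint 0 = 0" and qint_Suc: "qint (Suc n) = qint n + monom 1 n"
  by (simp_all add: qint_def)

lemma qint_1 [simp]: "qint (Suc 0) = 1"
  by (simp add: qint_Suc one_pCons)

lemma pCons_0_monom: "pCons 0 p = monom 1 1 * (p :: int poly)"
  by (simp add: monom_Suc)

lemma qint_Suc': "qint (Suc n) = 1 + pCons 0 (qint n)"
proof (induction n)
  case (Suc n)
  have "qint (Suc (Suc n)) = 1 + (pCons 0 (qint n) + pCons 0 (monom 1 n))"
    unfolding qint_Suc[of "Suc n"] Suc monom_Suc by simp
  then show ?case by (simp add: qint_Suc)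
qed simp

lemma poly_qint_1 [simp]: "poly (qint n) 1 = int n"
  by (simp add: qint_def poly_sum poly_monom)

lemma qint_mult: "(1 - monom 1 1) * qint n = 1 - monom 1 n"
proof (induction n)
  case (Suc n)
  have "(1 - monom 1 1) * monom 1 n = monom 1 n - (monom 1 (Suc n) :: int poly)"
    by (simp only: left_diff_distrib mult_monom mult_1 plus_1_eq_Suc)
  then show ?case by (simp only: qint_Suc distrib_left Suc)
qed simp

text \<open>The first column of \<open>M_mat\<close> inside Z[q]: for c at least 1 the matrix R_q^c
  S_q has the rows ([c], -q^(c-1)) and (1, 0). For c = 0 the exponent \<open>c - 1\<close> is
  truncated, so the agreement with \<open>M_mat\<close> starts at c = 1.\<close>

fun col :: "nat list \<Rightarrow> int poly \<times> int poly" where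
  "col [] = (1, 0)"
| "col (c # cs) = (qint c * fst (col cs) - monom 1 (c - 1) * snd (col cs), fst (col cs))"

text \<open>Each further factor R_q sends a column (X, Y) to (q X + Y, Y), which matches [c + 1] = 1
  + q [c]. Only the base case c = 1 meets the inverse of q coming from S_q, and there it
  cancels.\<close>

lemma M_mat_Cons_col:
  assumes "M_mat cs $ 1 $ 1 = to_fract P" "M_mat cs $ 2 $ 1 = to_fract Q" "c \<ge> 1"
  shows "M_mat (c # cs) $ 1 $ 1 = to_fract (qint c * P - monom 1 (c - 1) * Q) \<and>
         M_mat (c # cs) $ 2 $ 1 = to_fract P"
  using assms(3)
proof (induction c rule: dec_induct)
  case base
  show ?case using assms by (simp add: R_mat_mult S_mat_mult)
next
  case (step c)
  then obtain b where c: "c = Suc b" by (cases c) auto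
  have "qint (Suc c) * P - monom 1 c * Q = pCons 0 (qint c * P - monom 1 (c - 1) * Q) + P"
    unfolding qint_Suc' c by (simp add: algebra_simps monom_Suc)
  moreover have "M_mat (c # cs) $ 1 $ 1 = to_fract (qint c * P - monom 1 (c - 1) * Q)"
    "M_mat (c # cs) $ 2 $ 1 = to_fract P"
    using step.IH by auto
  ultimately show ?case
    by (simp only: M_mat_Suc R_mat_mult to_fract_add to_fract_pCons0 diff_Suc_1)
qed

lemma M_mat_col_eq:
  assumes "\<forall>c\<in>set cs. 2 \<le> c"
  shows "M_mat cs $ 1 $ 1 = to_fract (fst (col cs)) \<and> M_mat cs $ 2 $ 1 = to_fract (snd (col cs))"
  using assms
proof (induction cs)
  case Nil
  show ?case by (simp add: mat_def)
next
  case (Cons c cs)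
  then have "c \<ge> 1" by auto
  then show ?case using M_mat_Cons_col[of cs _ _ c] Cons by auto
qed

text \<open>At q = 1 the recursion of \<open>col\<close> acts on the quotient of the two entries as
  x -> c - 1/x.\<close>

lemma hj_col:
  "hj_list cs \<Longrightarrow> hj cs = of_int (poly (fst (col cs)) 1) / of_int (poly (snd (col cs)) 1)"
proof (induction cs)
  case Nil
  then show ?case by (simp add: hj_list_def)
next
  case (Cons c cs)
  show ?case
  proof (cases "cs = []")
    case False
    then have cs: "hj_list cs" using Cons.prems by (simp add: hj_list_Cons)
    have "hj cs \<noteq> 0" using hj_gt_1[OF cs] by linarith
    \<comment> \<open>Division by zero yields zero, so a nonzero quotient has nonzero numerator and
      denominator.\<close>
    then have "poly (fst (col cs)) 1 \<noteq> 0" "poly (snd (col cs)) 1 \<noteq> 0"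
      using Cons.IH[OF cs] by auto
    then have "of_nat c - 1 / hj cs =
        of_int (int c * poly (fst (col cs)) 1 - poly (snd (col cs)) 1) / of_int (poly (fst (col cs)) 1)"
      unfolding Cons.IH[OF cs] by (simp add: diff_divide_distrib)
    then show ?thesis unfolding hj_Cons[OF False] by (simp add: poly_monom)
  qed (simp add: poly_monom)
qed

section \<open>Denominators read off an expansion, modulo integer shifts\<close>

lemma q_fractionI:
  assumes "is_q_fraction x (R, S)"
  shows "q_fraction x = (R, S)"
  unfolding q_fraction_def by (rule the1_equality[OF ex1_q_fraction assms])

lemma q_den_hj:
  assumes "hj_list cs"
  shows "q_den (hj cs) = snd (col cs)"
proof -
  obtain S where S: "M_mat cs $ 2 $ 1 = to_fract S" "is_q_fraction (hj cs) (M_mat cs $ 1 $ 1, S)"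
    using is_q_fraction_hj[OF assms] by blast
  have "S = snd (col cs)" using M_mat_col_eq[of cs] S(1) assms by (simp add: hj_list_def)
  then show ?thesis using q_fractionI[OF S(2)] by (simp add: q_den_def)
qed

text \<open>From [x] = R/S one gets [x + 1] = (q R + S)/S. A common divisor of q R + S and S divides
  q R, hence R, because q is a unit among Laurent polynomials.\<close>

lemma q_den_add_1: "q_den (x + 1) = q_den x"
proof -
  obtain R S where RS: "is_q_fraction x (R, S)" using ex1_q_fraction by (metis surj_pair)
  then have S0: "S \<noteq> 0" by (auto simp: is_q_fraction_def)
  have "is_q_fraction (x + 1) (qvar * R + to_fract S, S)"
    unfolding is_q_fraction_def case_prod_conv
  proof (intro conjI)
    show "qvar * R + to_fract S \<in> laurent"
      using RS by (intro laurent_add laurent_mult) (auto simp: is_q_fraction_def)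
    show "poly S 0 = 1" using RS by (simp add: is_q_fraction_def)
    show "q_rat (x + 1) = (qvar * R + to_fract S) / to_fract S"
      using RS S0 by (simp add: q_rat_add_1 is_q_fraction_def add_divide_distrib)
    show "laurent_coprime (qvar * R + to_fract S) (to_fract S)"
      unfolding laurent_coprime_def
    proof (intro ballI impI)
      fix d assume d: "d \<in> laurent"
        "laurent_dvd d (qvar * R + to_fract S) \<and> laurent_dvd d (to_fract S)"
      then obtain f g where fg: "f \<in> laurent" "g \<in> laurent"
        "qvar * R + to_fract S = d * f" "to_fract S = d * g"
        by (auto simp: laurent_dvd_def)
      have "qvar * R = d * (f - g)"
        using fg(3) unfolding right_diff_distrib fg(4)[symmetric] by (simp add: algebra_simps)
      then have "R = d * (inverse qvar * (f - g))"
        by (metis (no_types) left_inverse mult.assoc mult.commute mult_1 qvar_nz)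
      moreover have "inverse qvar * (f - g) \<in> laurent"
        using fg by (intro laurent_mult laurent_diff) auto
      ultimately have "laurent_dvd d R" by (auto simp: laurent_dvd_def)
      then show "laurent_dvd d 1"
        using d RS by (auto simp: is_q_fraction_def laurent_coprime_def)
    qed
  qed
  from q_fractionI[OF this] q_fractionI[OF RS] show ?thesis by (simp add: q_den_def)
qed

lemma q_den_add_of_int: "q_den (x + of_int m) = q_den x"
proof (induction m rule: int_induct[of _ 0])
  case (step1 i)
  then show ?case using q_den_add_1[of "x + of_int i"] by (simp add: algebra_simps)
next
  case (step2 i)
  then show ?case using q_den_add_1[of "x + of_int (i - 1)"] by (simp add: algebra_simps)
qed simp

lemma q_den_cong:
  assumes "[r = s] (mod n)" "n > 0"
  shows "q_den (of_int r / of_int n) = q_den (of_int s / of_int n)"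
proof -
  obtain m where "r = s + n * m" using assms(1) by (metis cong_iff_lin cong_sym)
  then have "(of_int r / of_int n :: rat) = of_int s / of_int n + of_int m"
    using assms(2) by (simp add: field_simps)
  then show ?thesis by (simp add: q_den_add_of_int)
qed

text \<open>Prepending a 2 moves \<open>fst (col ds)\<close> into the denominator. With Q the value
  of \<open>snd (col ds)\<close> at 1, the new fraction is 2 - Q/n, which explains the sign in the
  congruence for r.\<close>

lemma q_den_col:
  assumes "hj_list ds" "poly (fst (col ds)) 1 = n" "[r = - poly (snd (col ds)) 1] (mod n)" "n > 0"
  shows "q_den (of_int r / of_int n) = fst (col ds)"
proof -
  have hj: "hj_list (2 # ds)" using assms(1) by (simp add: hj_list_Cons)
  have "hj (2 # ds) = of_int (2 * n - poly (snd (col ds)) 1) / of_int n"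
    using hj_col[OF hj] assms(2) by (simp add: poly_monom)
  moreover have "[r = 2 * n - poly (snd (col ds)) 1] (mod n)"
    using cong_add[OF assms(3), of 0 "2 * n"] by (simp add: cong_def)
  ultimately have "q_den (of_int r / of_int n) = q_den (hj (2 # ds))"
    using q_den_cong assms(4) by presburger
  then show ?thesis using q_den_hj[OF hj] by simp
qed

section \<open>Explicit expansions for n = k a + 1 and n = k a - 1\<close>

lemma col_replicate_2:
  assumes "fst (col ds) = u + v * qint (Suc m)" "snd (col ds) = u + v * qint m"
  shows "col (replicate j 2 @ ds) = (u + v * qint (Suc (j + m)), u + v * qint (j + m))"
proof (induction j)
  case 0
  show ?case using assms by (simp add: prod_eq_iff)
next
  case (Suc j)
  \<comment> \<open>A leading 2 acts by X -> (1 + q) X - q Y, a recursion with characteristic roots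
    1 and q. Its solutions are the combinations u + v [m], and each 2 raises m by one.\<close>
  have "qint 2 = 1 + monom 1 1" by (simp add: numeral_2_eq_2 qint_Suc)
  then show ?case
    using Suc by (simp add: qint_Suc algebra_simps mult_monom monom_Suc)
qed

text \<open>n/a has the expansion [k + 1, 2, ..., 2] with a - 1 twos. The entry [k + 1] [a] - q^k
  [a - 1] simplifies by [k + 1] = [k] + q^k and [a] - [a - 1] = q^(a-1).\<close>

lemma q_den_plus_neg:
  assumes "a \<ge> 1" "k \<ge> 1" "n = int (k * a + 1)" "[r = - int a] (mod n)"
  shows "q_den (of_int r / of_int n) = qint k * qint a + monom 1 (k + a - 1)"
proof -
  obtain b where b: "a = Suc b" using assms(1) by (cases a) auto
  have c: "col (replicate b 2) = (qint (Suc b), qint b)"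
    using col_replicate_2[of "[]" 0 1 0 b] by simp
  have "fst (col (Suc k # replicate b 2)) = qint k * qint a + monom 1 (k + a - 1)"
    by (simp add: c b qint_Suc algebra_simps mult_monom)
  moreover have "n > 0" using assms(3) by linarith
  ultimately show ?thesis
    using assms(2-4) c b q_den_col[of "Suc k # replicate b 2" n r]
    by (simp add: hj_list_def poly_monom del: of_nat_Suc) (simp add: algebra_simps)
qed

text \<open>Here r is matched with a - n = -((k - 1) a + 1), and n/(n - a) has the expansion
  [2, ..., 2, a + 1] with k - 1 twos.\<close>

lemma q_den_plus_pos:
  assumes "a \<ge> 1" "k \<ge> 1" "n = int (k * a + 1)" "[r = int a] (mod n)"
  shows "q_den (of_int r / of_int n) = 1 + monom 1 1 * qint k * qint a"
proof -
  obtain j where j: "k = Suc j" using assms(2) by (cases k) auto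
  \<comment> \<open>Seed of the recursion: [a + 1] = 1 + q [a] [1] and 1 = 1 + q [a] [0].\<close>
  have c: "col (replicate j 2 @ [Suc a]) =
      (1 + pCons 0 (qint a) * qint (Suc j), 1 + pCons 0 (qint a) * qint j)"
    using col_replicate_2[of "[Suc a]" 1 "pCons 0 (qint a)" 0 j] by (simp add: qint_Suc')
  have "[r = int a - n] (mod n)" using assms(4) by (simp add: cong_def)
  moreover have "int a - n = - int (j * a + 1)" using assms(3) by (simp add: j algebra_simps)
  ultimately have "[r = - int (j * a + 1)] (mod n)" by simp
  moreover have "poly (1 + pCons 0 (qint a) * qint (Suc j)) 1 = n"
    using assms(3) by (simp add: j algebra_simps)
  moreover have "hj_list (replicate j 2 @ [Suc a])" using assms(1) by (auto simp: hj_list_def)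
  moreover have "n > 0" using assms(3) by linarith
  ultimately have "q_den (of_int r / of_int n) = 1 + pCons 0 (qint a) * qint (Suc j)"
    using q_den_col[of "replicate j 2 @ [Suc a]" n r] unfolding c
    by (simp add: mult.commute)
  also have "pCons 0 (qint a) * qint (Suc j) = monom 1 1 * qint k * qint a"
    by (simp add: pCons_0_monom j mult_ac)
  finally show ?thesis .
qed

lemma q_den_minus_neg:
  assumes "a \<ge> 2" "k \<ge> 2" "n = int k * int a - 1" "[r = - int a] (mod n)"
  shows "q_den (of_int r / of_int n) = qint k * qint a - monom 1 (k - 1)"
proof -
  have "int k * int a \<ge> 2 * 2" using assms by (intro mult_mono) auto
  then show ?thesis
    using assms q_den_col[of "[k, a]" n r] by (simp add: hj_list_def poly_monom)
qed

text \<open>n/(n - a) has the expansion [2, ..., 2, 3, 2, ..., 2] with k - 2 twos before the 3 and a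
  - 2 twos after it.\<close>

lemma q_den_minus_pos:
  assumes "a \<ge> 2" "k \<ge> 2" "n = int k * int a - 1" "[r = int a] (mod n)"
  shows "q_den (of_int r / of_int n) = qint k * qint a - monom 1 (a - 1)"
proof -
  obtain j where j: "k = Suc (Suc j)" using assms(2) by (metis add_2_eq_Suc le_Suc_ex)
  obtain b where b: "a = Suc (Suc b)" using assms(1) by (metis add_2_eq_Suc le_Suc_ex)
  have 2: "col (replicate b 2) = (qint (Suc b), qint b)"
    using col_replicate_2[of "[]" 0 1 0 b] by simp
  have e: "qint 3 = 1 + monom 1 1 + monom 1 2" "qint 2 = 1 + monom 1 1"
    by (simp_all add: numeral_3_eq_3 numeral_2_eq_2 qint_Suc)
  \<comment> \<open>The seed fits u + v [m] with u = -q^(a-1), v = [a] and m = 1, since [a] -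
    q^(a-1) = [a - 1].\<close>
  have c: "col (replicate j 2 @ 3 # replicate b 2) =
      (- monom 1 (a - 1) + qint a * qint k, - monom 1 (a - 1) + qint a * qint (Suc j))"
    using col_replicate_2[of "3 # replicate b 2" "- monom 1 (a - 1)" "qint a" 1 j]
    by (simp add: 2 b j e qint_Suc algebra_simps mult_monom flip: numeral_2_eq_2)
  have "int k * int a \<ge> 2 * 2" using assms by (intro mult_mono) auto
  moreover have "[r = int a - n] (mod n)" using assms(4) by (simp add: cong_def)
  moreover have "int a - n = - (int (Suc j) * int a - 1)"
    using assms(3) by (simp add: j algebra_simps)
  moreover have "hj_list (replicate j 2 @ 3 # replicate b 2)" by (auto simp: hj_list_def)
  ultimately have "[r = - (int (Suc j) * int a - 1)] (mod n)" "n > 0"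
    "hj_list (replicate j 2 @ 3 # replicate b 2)"
    using assms(3) by (simp_all only:)
  then show ?thesis
    using c assms q_den_col[of "replicate j 2 @ 3 # replicate b 2" n r]
    by (simp add: poly_monom mult.commute)
qed

section \<open>Integer sequences with six nonzero terms\<close>

definition six :: "nat \<Rightarrow> nat \<Rightarrow> nat \<Rightarrow> nat \<Rightarrow> nat \<Rightarrow> nat \<Rightarrow> int" where
  "six N u i j l s = (if s = 0 \<or> s = N \<or> s = u then 1 else if s = i \<or> s = j \<or> s = l then - 1 else 0)"

text \<open>Autocorrelation at distance m. It is applied to sequences that vanish beyond N, so pairs
  leaving the range contribute nothing.\<close>

definition corr :: "nat \<Rightarrow> (nat \<Rightarrow> int) \<Rightarrow> nat \<Rightarrow> int" where
  "corr N w m = (\<Sum>s\<le>N. w s * w (s + m))"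

section \<open>Classification by square sum and moments\<close>

lemma six_swap: "six N u i j l = six N u j i l"
  and six_rotate: "six N u i j l = six N u j l i"
  by (auto simp: six_def fun_eq_iff)

lemma sum_six:
  assumes "distinct [0, N, u, i, j, l]" "\<forall>x\<in>{u, i, j, l}. x < N"
  shows "(\<Sum>s\<le>N. six N u i j l s * g s) = g 0 + g N + g u - g i - g j - (g l :: int)"
proof -
  have "(\<Sum>s\<le>N. six N u i j l s * g s) = (\<Sum>s\<in>{0, N, u, i, j, l}. six N u i j l s * g s)"
    using assms by (intro sum.mono_neutral_right) (auto simp: six_def)
  also have "\<dots> = g 0 + g N + g u - g i - g j - g l"
    using assms by (simp add: six_def)
  finally show ?thesis .
qed

text \<open>The interior has square sum 4 and sum -2. An entry of absolute value at least 2 exhausts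
  the squares and must be -2; otherwise the entries 1 and -1 number four in all with difference -2,
  hence one 1 and three entries -1.\<close>

lemma six_terms_or_double:
  fixes w :: "nat \<Rightarrow> int"
  assumes "N \<ge> 1" "w 0 = 1" "w N = 1" "(\<Sum>s\<le>N. (w s)\<^sup>2) = 6" "(\<Sum>s\<le>N. w s) = 0"
  shows "(\<exists>h\<in>{1..<N}. w h = - 2 \<and> (\<forall>s\<in>{1..<N} - {h}. w s = 0)) \<or>
    (\<exists>u i j l. distinct [0, N, u, i, j, l] \<and> (\<forall>x\<in>{u, i, j, l}. x < N) \<and>
       (\<forall>s\<le>N. w s = six N u i j l s))"
proof -
  define M where "M = {1..<N}"
  have fin: "finite M" by (simp add: M_def)
  have split: "(\<Sum>s\<le>N. f s) = f 0 + f N + (\<Sum>s\<in>M. f s)" for f :: "nat \<Rightarrow> int"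
  proof -
    have "{..N} = {0, N} \<union> M" using assms(1) by (auto simp: M_def)
    then have "(\<Sum>s\<le>N. f s) = (\<Sum>s\<in>{0, N}. f s) + (\<Sum>s\<in>M. f s)"
      using fin by (simp only:) (intro sum.union_disjoint, auto simp: M_def)
    then show ?thesis using assms(1) by simp
  qed
  have sq: "(\<Sum>s\<in>M. (w s)\<^sup>2) = 4" and sm: "(\<Sum>s\<in>M. w s) = - 2"
    using assms(2-5) by (simp_all add: split)
  show ?thesis
  proof (cases "\<exists>h\<in>M. \<bar>w h\<bar> \<ge> 2")
    case True
    then obtain h where h: "h \<in> M" "\<bar>w h\<bar> \<ge> 2" by blast
    have "(w h)\<^sup>2 \<ge> 2\<^sup>2" using h(2) by (intro abs_le_square_iff[THEN iffD1]) simp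
    then have "(\<Sum>s\<in>M - {h}. (w s)\<^sup>2) \<le> 0"
      using sq fin h(1) by (simp add: sum.remove)
    then have "(\<Sum>s\<in>M - {h}. (w s)\<^sup>2) = 0" by (meson antisym sum_nonneg zero_le_power2)
    then have z: "\<forall>s\<in>M - {h}. w s = 0" using fin by (subst (asm) sum_nonneg_eq_0_iff) auto
    then have "(\<Sum>s\<in>M - {h}. w s) = 0" by (intro sum.neutral) auto
    then have "w h = - 2" using sm fin h(1) by (simp add: sum.remove)
    then show ?thesis using z h(1) unfolding M_def by blast
  next
    case False
    define A where "A = {s\<in>M. w s = 1}"
    define B where "B = {s\<in>M. w s = - 1}"
    have w01: "w s = (if s \<in> A then 1 else 0) - (if s \<in> B then 1 else 0)"
      "(w s)\<^sup>2 = (if s \<in> A then 1 else 0) + (if s \<in> B then 1 else 0)" if "s \<in> M" for s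
    proof -
      have "\<not> \<bar>w s\<bar> \<ge> 2" using False that by blast
      then have "w s = 0 \<or> w s = 1 \<or> w s = - 1" by linarith
      then show "w s = (if s \<in> A then 1 else 0) - (if s \<in> B then 1 else 0)"
        "(w s)\<^sup>2 = (if s \<in> A then 1 else 0) + (if s \<in> B then 1 else 0)"
        using that by (auto simp: A_def B_def)
    qed
    have cd: "(\<Sum>s\<in>M. if s \<in> C then 1 else 0) = int (card C)" if "C \<subseteq> M" for C
    proof -
      have "(\<Sum>s\<in>M. if s \<in> C then 1 else (0::int)) = (\<Sum>s\<in>M \<inter> C. 1)"
        by (rule sum.inter_restrict[OF fin, symmetric])
      then show ?thesis using that by (simp add: inf.absorb2)
    qed
    have AB: "A \<subseteq> M" "B \<subseteq> M" by (auto simp: A_def B_def)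
    have "(\<Sum>s\<in>M. w s) = int (card A) - int (card B)"
      using w01(1) cd AB by (simp add: sum_subtractf cong: sum.cong)
    moreover have "(\<Sum>s\<in>M. (w s)\<^sup>2) = int (card A) + int (card B)"
      using w01(2) cd AB by (simp add: sum.distrib cong: sum.cong)
    ultimately have "card A = 1" "card B = 3" using sq sm by linarith+
    then obtain u i j l where S: "A = {u}" "B = {i, j, l}" "i \<noteq> j" "i \<noteq> l" "j \<noteq> l"
      by (metis card_1_singletonE card_3_iff)
    have mem: "u \<in> M" "i \<in> M" "j \<in> M" "l \<in> M" using AB S by auto
    have ne: "w u = 1" "w i = - 1" "w j = - 1" "w l = - 1" using S by (auto simp: A_def B_def)
    have "w s = six N u i j l s" if "s \<le> N" for s
    proof (cases "s \<in> M")
      case True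
      then show ?thesis using w01(1)[OF True] S ne by (auto simp: six_def M_def)
    next
      case False
      then have "s = 0 \<or> s = N" using that by (auto simp: M_def)
      then show ?thesis using assms by (auto simp: six_def)
    qed
    moreover have "distinct [0, N, u, i, j, l]" "\<forall>x\<in>{u, i, j, l}. x < N"
      using mem ne S by (auto simp: M_def)
    ultimately show ?thesis by blast
  qed
qed

text \<open>For the pattern 1, -2, 1 the first moment puts the -2 at N/2, and then no two nonzero
  entries are neighbours, against the nonzero correlation at distance 1. In the other pattern the
  first moment is the relation i + j + l = N + u.\<close>

lemma six_terms:
  fixes w :: "nat \<Rightarrow> int"
  assumes "N > 2" "w 0 = 1" "w N = 1" "\<And>s. s > N \<Longrightarrow> w s = 0" "(\<Sum>s\<le>N. (w s)\<^sup>2) = 6"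
    "(\<Sum>s\<le>N. w s) = 0" "(\<Sum>s\<le>N. w s * int s) = 0" "corr N w 1 \<noteq> 0"
  obtains u i j l where "distinct [0, N, u, i, j, l]" "\<forall>x\<in>{u, i, j, l}. x < N"
    "w = six N u i j l" "i + j + l = N + u"
proof -
  consider h where "h \<in> {1..<N}" "w h = - 2" "\<forall>s\<in>{1..<N} - {h}. w s = 0"
    | u i j l where "distinct [0, N, u, i, j, l]" "\<forall>x\<in>{u, i, j, l}. x < N"
       "\<forall>s\<le>N. w s = six N u i j l s"
    using six_terms_or_double[of N w] assms(1-3,5,6) by force
  then show ?thesis
  proof cases
    case 1
    have sm: "(\<Sum>s\<le>N. w s * g s) = g 0 + g N - 2 * g h" for g :: "nat \<Rightarrow> int"
    proof -
      have "(\<Sum>s\<le>N. w s * g s) = (\<Sum>s\<in>{0, N, h}. w s * g s)"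
      proof (intro sum.mono_neutral_right ballI)
        fix s assume s: "s \<in> {..N} - {0, N, h}"
        then have "s \<in> {1..<N} - {h}" by auto
        then show "w s * g s = 0" using 1 by simp
      qed (use 1 in auto)
      then show ?thesis using 1 assms by simp
    qed
    have "int N = 2 * int h" using sm[of int] assms(7) by simp
    then have N: "N = 2 * h" by simp
    have "w 1 = 0" using 1 assms(1) N by auto
    moreover have "w (h + 1) = 0" using 1 assms(1) N by auto
    ultimately have "corr N w 1 = 0"
      unfolding corr_def using sm[of "\<lambda>s. w (s + 1)"] assms(4)[of "N + 1"] by simp
    then show ?thesis using assms(8) by simp
  next
    case 2
    have w: "w = six N u i j l"
    proof
      fix s
      show "w s = six N u i j l s"
        using 2 assms(4)[of s] by (cases "s \<le> N") (auto simp: six_def)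
    qed
    have "int N + int u = int i + int j + int l"
      using sum_six[OF 2(1,2), of int] assms(7) unfolding w by simp
    then have "i + j + l = N + u" by linarith
    then show ?thesis using that 2 w by blast
  qed
qed

text \<open>At distance N - t only the pairs starting at s up to t fit. The first and the last one
  involve the ends 0 and N, the inner ones vanish by assumption. Decreasing distances thus peel the
  sequence off from both ends.\<close>

lemma top_corr:
  assumes "0 < t" "t < N" "w 0 = 1" "w N = 1" "\<And>s. s > N \<Longrightarrow> w s = 0"
    "\<And>s. 0 < s \<Longrightarrow> s < t \<Longrightarrow> w s = 0 \<or> w (s + (N - t)) = 0"
  shows "corr N w (N - t) = w t + w (N - t)"
proof -
  have "corr N w (N - t) = (\<Sum>s\<in>{0, t}. w s * w (s + (N - t)))"
    unfolding corr_def
  proof (intro sum.mono_neutral_right ballI)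
    fix s assume "s \<in> {..N} - {0, t}"
    then consider "0 < s" "s < t" | "s + (N - t) > N" using assms(2) by fastforce
    then show "w s * w (s + (N - t)) = 0"
      using assms(5,6) by cases auto
  qed (use assms in auto)
  then show ?thesis using assms by simp
qed

section \<open>Recovering the sequence from its correlations when n = k a + 1\<close>

lemma corr_six:
  assumes "distinct [0, N, u, i, j, l]" "\<forall>x\<in>{u, i, j, l}. x < N"
  shows "corr N (six N u i j l) m =
    six N u i j l m + six N u i j l (N + m) + six N u i j l (u + m)
    - six N u i j l (i + m) - six N u i j l (j + m) - six N u i j l (l + m)"
  unfolding corr_def sum_six[OF assms] by simp

text \<open>Given the entry -1 at 1, the correlation at N - 1 clears the position N - 1, the one at
  N - 2 restricts u, and the first two moments determine the two remaining negative
  positions.\<close>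

lemma six_plus:
  fixes w :: "nat \<Rightarrow> int"
  assumes a: "a \<ge> 2" "k \<ge> 5 * a" and N: "N = k + a + 1"
    and w: "w 0 = 1" "w N = 1" "\<And>s. s > N \<Longrightarrow> w s = 0" "(\<Sum>s\<le>N. (w s)\<^sup>2) = 6"
      "(\<Sum>s\<le>N. w s) = 0" "(\<Sum>s\<le>N. w s * int s) = 0"
      "\<bar>\<Sum>s\<le>N. w s * (int s)\<^sup>2\<bar> = 2 * (int k * int a + 1)"
    and c: "\<And>m. m > 0 \<Longrightarrow> m < N \<Longrightarrow> corr N w m = corr N (six N 2 1 (a + 1) (k + 1)) m"
    and w1: "w 1 = - 1"
  shows "w = six N 2 1 (a + 1) (k + 1)"
proof -
  have f: "distinct [0, N, 2, 1, a + 1, k + 1]" "\<forall>x\<in>{2, 1, a + 1, k + 1}. x < N"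
    using a by (auto simp: N)
  \<comment> \<open>This correlation serves twice: being nonzero it admits \<open>six_terms\<close>,
    and its value -3 for a = 2 settles the last case.\<close>
  have "corr N w 1 = corr N (six N 2 1 (a + 1) (k + 1)) 1" using a N by (intro c) auto
  also have "\<dots> = (if a = 2 then - 3 else - 2)"
    using a unfolding corr_six[OF f] by (auto simp: six_def N)
  finally have c1: "corr N w 1 = (if a = 2 then - 3 else - 2)" .
  have "w 1 + w (N - 1) = corr N w (N - 1)" using a N w by (intro top_corr[symmetric]) auto
  also have "\<dots> = corr N (six N 2 1 (a + 1) (k + 1)) (N - 1)" using a N by (intro c) auto
  also have "\<dots> = - 1" using a unfolding corr_six[OF f] by (auto simp: six_def N)
  finally have wN1: "w (N - 1) = 0" using w1 by simp
  have "w 2 + w (N - 2) = corr N w (N - 2)"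
  proof (intro top_corr[symmetric] w)
    fix s :: nat assume "0 < s" "s < 2"
    then have "s + (N - 2) = N - 1" using a N by auto
    then show "w s = 0 \<or> w (s + (N - 2)) = 0" using wN1 by simp
  qed (use a N in auto)
  also have "\<dots> = corr N (six N 2 1 (a + 1) (k + 1)) (N - 2)" using a N by (intro c) auto
  also have "\<dots> = (if a = 2 then 0 else 1)"
    using a unfolding corr_six[OF f] by (auto simp: six_def N)
  finally have w2: "w 2 + w (N - 2) = (if a = 2 then 0 else 1)" .
  have N2: "N > 2" and c1_nz: "corr N w 1 \<noteq> 0" using a N c1 by auto
  have "\<exists>u i j. distinct [0, N, u, i, j, 1] \<and> (\<forall>x\<in>{u, i, j}. x < N) \<and>
      w = six N u i j 1 \<and> i + j + 1 = N + u"
  proof -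
    obtain u i j l where W: "distinct [0, N, u, i, j, l]" "\<forall>x\<in>{u, i, j, l}. x < N"
      "w = six N u i j l" "i + j + l = N + u"
      by (rule six_terms[OF N2 w(1-6) c1_nz])
    consider "l = 1" | "i = 1" | "j = 1"
      using w1 unfolding W(3) six_def by (auto split: if_splits)
    then show ?thesis
    proof cases
      case 1
      then show ?thesis using W by blast
    next
      case 2
      then have "w = six N u l j 1" using W(3) six_swap six_rotate by metis
      moreover have "distinct [0, N, u, l, j, 1]" "\<forall>x\<in>{u, l, j}. x < N" "l + j + 1 = N + u"
        using W(1,2,4) unfolding 2 by simp_all
      ultimately show ?thesis by blast
    next
      case 3
      then have "w = six N u i l 1" using W(3) by (metis six_swap six_rotate)
      moreover have "distinct [0, N, u, i, l, 1]" "\<forall>x\<in>{u, i, l}. x < N" "i + l + 1 = N + u"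
        using W(1,2,4) unfolding 3 by simp_all
      ultimately show ?thesis by blast
    qed
  qed
  then obtain u i j where W: "distinct [0, N, u, i, j, 1]" "\<forall>x\<in>{u, i, j}. x < N"
    "w = six N u i j 1" "i + j + 1 = N + u" by blast
  have "N - 1 \<notin> {0, N, u, i, j, 1}"
    using wN1 W(1) unfolding W(3) six_def by (auto split: if_splits)
  then have le: "u \<le> N - 2" "i \<le> N - 2" "j \<le> N - 2" using W(2) by auto
  \<comment> \<open>In these coordinates the second moment becomes \<open>2 (N - 1 + x y)\<close>.\<close>
  define x where "x = int N - 1 - int i"
  define y where "y = int N - 1 - int j"
  have xy: "x \<ge> 1" "y \<ge> 1" "x + y = int N - 1 - int u"
    using le a N W(4) unfolding x_def y_def by auto
  have "(\<Sum>s\<le>N. w s * (int s)\<^sup>2) = (int N)\<^sup>2 + (int u)\<^sup>2 - (int i)\<^sup>2 - (int j)\<^sup>2 - 1"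
    unfolding W(3) using W(2) N2 by (subst sum_six[OF W(1)]) auto
  also have "\<dots> = 2 * (int N - 1 + x * y)"
  proof -
    have u: "int u = int N - 1 - x - y" using xy(3) by simp
    show ?thesis unfolding u by (simp add: x_def y_def power2_eq_square algebra_simps)
  qed
  finally have "\<bar>int N - 1 + x * y\<bar> = int k * int a + 1" using w(7) by (simp add: abs_mult)
  moreover have "x * y \<ge> 0" using xy by simp
  ultimately have prod: "x * y = (int k - 1) * (int a - 1)"
    using N by (simp add: algebra_simps)
  have "u \<noteq> N - 2" using xy a N by auto
  show ?thesis
  proof (cases "u = 2")
    case True
    \<comment> \<open>Sum and product of x and y are those of k - 1 and a - 1, so the pairs agree up
      to order.\<close>
    have "x + y = (int k - 1) + (int a - 1)" using xy(3) True N by simp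
    then have "(x - (int k - 1)) * (x - (int a - 1)) = 0"
      using prod by (simp add: algebra_simps) algebra
    then have "i = a + 1 \<and> j = k + 1 \<or> i = k + 1 \<and> j = a + 1"
      using W(4) True N unfolding x_def by auto
    then show ?thesis unfolding W(3) True
      using six_rotate[of N 2 1 "a + 1" "k + 1"] six_swap[of N 2 "a + 1" "k + 1" 1] by metis
  next
    case False
    \<comment> \<open>Neither 2 nor N - 2 is the positive position u, so the sum of their entries is
      at most 0, which leaves a = 2 only.\<close>
    have "w 2 \<in> {0, - 1}" "w (N - 2) \<in> {0, - 1}"
      unfolding W(3) six_def using a N False \<open>u \<noteq> N - 2\<close> by auto
    then have a2: "a = 2" "w 2 = 0" using w2 by (auto split: if_splits)
    have "corr N w 1 = w 1 + w (N + 1) + w (u + 1) - w (i + 1) - w (j + 1) - w (1 + 1)"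
      unfolding W(3) by (rule corr_six[OF W(1)]) (use W(2) N2 in auto)
    then have "w (u + 1) - w (i + 1) - w (j + 1) = - 2"
      using c1 a2 w1 w(3)[of "N + 1"] by (simp add: numeral_2_eq_2)
    moreover have "i \<noteq> j" "u \<noteq> 0" using W(1) by auto
    moreover have "w (u + 1) \<ge> - 1" by (simp add: W(3) six_def)
    moreover have "w (i + 1) \<le> (if i + 1 = u then 1 else 0)" "w (j + 1) \<le> (if j + 1 = u then 1 else 0)"
      using le a N by (auto simp: W(3) six_def)
    \<comment> \<open>The correlation -3 needs a negative entry on both sides of u. Then i + j = 2
      u, and the first moment would put u at N - 1.\<close>
    ultimately have *: "w (u + 1) = - 1 \<and> (i + 1 = u \<or> j + 1 = u)"
      using \<open>i \<noteq> j\<close> by (cases "i + 1 = u"; cases "j + 1 = u") auto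
    then have "u + 1 = i \<or> u + 1 = j"
      using \<open>u \<noteq> 0\<close> unfolding W(3) six_def by (simp split: if_splits)
    then have "i + j = 2 * u" using * by auto
    then show ?thesis using W(4) le N2 by linarith
  qed
qed

section \<open>Recovering the sequence from its correlations when n = k a - 1\<close>

lemma six_eq_1_D: "six N u i j l s = 1 \<Longrightarrow> s = 0 \<or> s = N \<or> s = u"
  and six_eq_minus_1_D: "six N u i j l s = - 1 \<Longrightarrow> s = i \<or> s = j \<or> s = l"
  by (auto simp: six_def split: if_splits)

text \<open>The reference sequence has zero correlation at distance N - t for 0 < t < a - 1, so w t
  and w (N - t) cancel. If they were nonzero, one would be the positive entry and the other a
  negative one, and the first moment would give the two remaining negatives the sum 2 t or 2 (N -
  t), although both lie strictly on one side of t or N - t. The second conclusion supplies the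
  position for normalizing up to reflection.\<close>

lemma six_minus_low:
  fixes w :: "nat \<Rightarrow> int"
  assumes a: "a \<ge> 3" "k \<ge> 5 * a" and N: "N = k + a"
    and w: "w 0 = 1" "w N = 1" "\<And>s. s > N \<Longrightarrow> w s = 0" "(\<Sum>s\<le>N. (w s)\<^sup>2) = 6"
      "(\<Sum>s\<le>N. w s) = 0" "(\<Sum>s\<le>N. w s * int s) = 0"
    and c: "\<And>m. m > 0 \<Longrightarrow> m < N \<Longrightarrow> corr N w m = corr N (six N a (a - 1) (a + 1) k) m"
  shows "\<forall>t. 0 < t \<and> t < a - 1 \<longrightarrow> w t = 0 \<and> w (N - t) = 0"
    and "w (a - 1) = - 1 \<or> w (N - (a - 1)) = - 1"
proof -
  have f: "distinct [0, N, a, a - 1, a + 1, k]" "\<forall>x\<in>{a, a - 1, a + 1, k}. x < N"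
    using a by (auto simp: N)
  note cf = corr_six[OF f]
  have "corr N w 1 = corr N (six N a (a - 1) (a + 1) k) 1" using a N by (intro c) auto
  also have "\<dots> = - 2" using a unfolding cf by (auto simp: six_def N)
  finally have c1: "corr N w 1 = - 2" .
  \<comment> \<open>Writing a = 3 + e and k = 1 + k' removes truncated subtraction from all
    positions.\<close>
  obtain e where e: "a = 3 + e" using a(1) le_Suc_ex by blast
  have "k \<ge> 1" using a by simp
  then obtain k' where k': "k = 1 + k'" using le_Suc_ex by blast
  have vals: "N - (a - 1) = k' + 2" "N - a = k' + 1" "N - (a + 1) = k'" "a - 1 = e + 2"
    "N = k' + e + 4"
    unfolding N e k' by auto
  have N2: "N > 2" and c1_nz: "corr N w 1 \<noteq> 0" using a N c1 by auto
  obtain u i j l where W0: "distinct [0, N, u, i, j, l]" "\<forall>x\<in>{u, i, j, l}. x < N"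
    "w = six N u i j l" "i + j + l = N + u"
    by (rule six_terms[OF N2 w(1-6) c1_nz])
  have w_vals: "w s \<in> {- 1, 0, 1}" for s unfolding W0(3) six_def by simp
  have pos0: "s = 0 \<or> s = N \<or> s = u" if "w s = 1" for s
    using that six_eq_1_D unfolding W0(3) by blast
  have neg0: "s = i \<or> s = j \<or> s = l" if "w s = - 1" for s
    using that six_eq_minus_1_D unfolding W0(3) by blast
  have low: "w t = 0 \<and> w (N - t) = 0" if "0 < t" "t < a - 1" for t
    using that
  proof (induction t rule: less_induct)
    case (less t)
    have "w t + w (N - t) = corr N w (N - t)"
    proof (intro top_corr[symmetric] w)
      fix s assume "0 < s" "s < t"
      then show "w s = 0 \<or> w (s + (N - t)) = 0" using less by simp
    qed (use less.prems a N in auto)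
    also have "\<dots> = corr N (six N a (a - 1) (a + 1) k) (N - t)"
      using less.prems a N by (intro c) auto
    also have "\<dots> = 0"
    proof -
      have "t + 2 \<le> a" using less.prems(2) by linarith
      then obtain e where "a = (t + 2) + e" using le_Suc_ex by blast
      then have e: "a = t + e + 2" by simp
      have *: "N - t = k + e + 2" "a - 1 = t + e + 1" "N = k + t + e + 2" unfolding N e by auto
      show ?thesis using a(2) less.prems(1) unfolding cf unfolding * unfolding e by (simp add: six_def)
    qed
    finally have s0: "w t + w (N - t) = 0" .
    \<comment> \<open>By the induction hypothesis, positions below t and above N - t are empty apart
      from 0 and N.\<close>
    have lo: "t \<le> x \<and> x \<le> N - t" if "0 < x" "x < N" "w x \<noteq> 0" for x
    proof (rule ccontr)
      assume "\<not> (t \<le> x \<and> x \<le> N - t)"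
      then have "x < t \<or> N - x < t" using less.prems(1) by arith
      then consider "x < t" | "N - x < t" "N - x > 0" using \<open>x < N\<close> by fastforce
      then show False
      proof cases
        case 1
        then show False using less that by simp
      next
        case 2
        then have "w (N - (N - x)) = 0" using less.IH[of "N - x"] less.prems by simp
        then show False using that by simp
      qed
    qed
    have ne: "u \<noteq> i" "u \<noteq> j" "u \<noteq> l" "i \<noteq> j" "i \<noteq> l" "j \<noteq> l" using W0(1) by auto
    have nz: "w u \<noteq> 0" "w i \<noteq> 0" "w j \<noteq> 0" "w l \<noteq> 0" by (simp_all add: W0(3) six_def)
    have b: "t \<le> u" "t \<le> i" "t \<le> j" "t \<le> l" "u \<le> N - t" "i \<le> N - t" "j \<le> N - t" "l \<le> N - t"
      using lo[of u] lo[of i] lo[of j] lo[of l] W0(1,2) nz by auto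
    have tN: "t < N - t" using less.prems a N by linarith
    show ?case
    proof (rule ccontr)
      assume "\<not> (w t = 0 \<and> w (N - t) = 0)"
      then consider "w t = 1" "w (N - t) = - 1" | "w t = - 1" "w (N - t) = 1"
        using s0 w_vals[of t] by auto
      then show False
      proof cases
        case 1
        then have "u = t" "N - t = i \<or> N - t = j \<or> N - t = l"
          using less.prems tN pos0[of t] neg0[of "N - t"] by auto
        then show False using W0(4) ne b tN by linarith
      next
        case 2
        then have "u = N - t" "t = i \<or> t = j \<or> t = l"
          using less.prems tN pos0[of "N - t"] neg0[of t] by auto
        then show False using W0(4) ne b tN by linarith
      qed
    qed
  qed
  then show "\<forall>t. 0 < t \<and> t < a - 1 \<longrightarrow> w t = 0 \<and> w (N - t) = 0" by blast
  have "w (a - 1) + w (N - (a - 1)) = corr N w (N - (a - 1))"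
    using low a N by (intro top_corr[symmetric] w) auto
  also have "\<dots> = corr N (six N a (a - 1) (a + 1) k) (N - (a - 1))" using a N by (intro c) auto
  also have "\<dots> = - 1"
    unfolding cf unfolding vals using a(2) unfolding e k' by (simp add: six_def)
  finally show "w (a - 1) = - 1 \<or> w (N - (a - 1)) = - 1"
    using w_vals[of "a - 1"] w_vals[of "N - (a - 1)"] by auto
qed

text \<open>Once w (N - (a - 1)) = 0 is known, the correlation at N - a leaves three cases for w a
  and w (N - a). For 1 and -1 the first moment places the last negative at a + 1. For -1 and 1 it
  would place one beyond N. For 0 and 0 the correlation at N - (a + 1) gives a negative at a + 1 or
  at N - (a + 1); the first moment refutes the former, the correlation at distance 1 the
  latter.\<close>

lemma six_minus:
  fixes w :: "nat \<Rightarrow> int"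
  assumes a: "a \<ge> 3" "k \<ge> 5 * a" and N: "N = k + a"
    and w: "w 0 = 1" "w N = 1" "\<And>s. s > N \<Longrightarrow> w s = 0" "(\<Sum>s\<le>N. (w s)\<^sup>2) = 6"
      "(\<Sum>s\<le>N. w s) = 0" "(\<Sum>s\<le>N. w s * int s) = 0"
    and c: "\<And>m. m > 0 \<Longrightarrow> m < N \<Longrightarrow> corr N w m = corr N (six N a (a - 1) (a + 1) k) m"
    and w1: "w (a - 1) = - 1"
  shows "w = six N a (a - 1) (a + 1) k"
proof -
  have f: "distinct [0, N, a, a - 1, a + 1, k]" "\<forall>x\<in>{a, a - 1, a + 1, k}. x < N"
    using a by (auto simp: N)
  note cf = corr_six[OF f]
  have "corr N w 1 = corr N (six N a (a - 1) (a + 1) k) 1" using a N by (intro c) auto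
  also have "\<dots> = - 2" using a unfolding cf by (auto simp: six_def N)
  finally have c1: "corr N w 1 = - 2" .
  obtain e where e: "a = 3 + e" using a(1) le_Suc_ex by blast
  have "k \<ge> 1" using a by simp
  then obtain k' where k': "k = 1 + k'" using le_Suc_ex by blast
  have vals: "N - (a - 1) = k' + 2" "N - a = k' + 1" "N - (a + 1) = k'" "a - 1 = e + 2"
    "N = k' + e + 4"
    unfolding N e k' by auto
  have N2: "N > 2" and c1_nz: "corr N w 1 \<noteq> 0" using a N c1 by auto
  obtain u i j l where W0: "distinct [0, N, u, i, j, l]" "\<forall>x\<in>{u, i, j, l}. x < N"
    "w = six N u i j l" "i + j + l = N + u"
    by (rule six_terms[OF N2 w(1-6) c1_nz])
  have w_vals: "w s \<in> {- 1, 0, 1}" for s unfolding W0(3) six_def by simp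
  have low: "w t = 0 \<and> w (N - t) = 0" if "0 < t" "t < a - 1" for t
    using six_minus_low(1)[OF a N w c] that by blast
  obtain i j where W: "distinct [0, N, u, i, j, a - 1]" "\<forall>x\<in>{u, i, j, a - 1}. x < N"
    "w = six N u i j (a - 1)" "i + j + (a - 1) = N + u"
  proof -
    have "l = a - 1 \<or> i = a - 1 \<or> j = a - 1"
      using w1 unfolding W0(3) six_def by (auto split: if_splits)
    then show ?thesis
    proof (elim disjE)
      assume l: "l = a - 1"
      show ?thesis using that[of i j] W0 unfolding l by blast
    next
      assume i: "i = a - 1"
      have "w = six N u l j (a - 1)" using W0(3) six_swap six_rotate i by metis
      then show ?thesis using that[of l j] W0(1,2,4) unfolding i by simp
    next
      assume j: "j = a - 1"
      have "w = six N u i l (a - 1)" using W0(3) six_swap six_rotate j by metis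
      then show ?thesis using that[of i l] W0(1,2,4) unfolding j by simp
    qed
  qed
  have ne: "u \<noteq> i" "u \<noteq> j" "i \<noteq> j" "u \<noteq> a - 1" "i \<noteq> a - 1" "j \<noteq> a - 1" "0 < u" "0 < i" "0 < j"
    "u < N" "i < N" "j < N"
    using W(1,2) by auto
  have "w (a - 1) + w (N - (a - 1)) = corr N w (N - (a - 1))"
    using low a N by (intro top_corr[symmetric] w) auto
  also have "\<dots> = corr N (six N a (a - 1) (a + 1) k) (N - (a - 1))" using a N by (intro c) auto
  also have "\<dots> = - 1"
    unfolding cf unfolding vals using a(2) unfolding e k' by (simp add: six_def)
  finally have wa1: "w (N - (a - 1)) = 0" using w1 by simp
  have lo: "a \<le> x \<and> x \<le> N - a" if "0 < x" "x < N" "w x \<noteq> 0" "x \<noteq> a - 1" for x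
  proof (rule ccontr)
    assume *: "\<not> (a \<le> x \<and> x \<le> N - a)"
    have "N - x \<noteq> a - 1"
    proof
      assume "N - x = a - 1"
      then have "x = N - (a - 1)" using that by simp
      then show False using wa1 that by simp
    qed
    then have "x < a - 1 \<or> N - x < a - 1"
      using * \<open>x \<noteq> a - 1\<close> a(1) by arith
    then consider "x < a - 1" | "N - x < a - 1" by blast
    then show False
    proof cases
      case 1
      then show False using low that by simp
    next
      case 2
      then have "w (N - (N - x)) = 0" using low[of "N - x"] that by simp
      then show False using that by simp
    qed
  qed
  have nz: "w u \<noteq> 0" "w i \<noteq> 0" "w j \<noteq> 0" by (simp_all add: W(3) six_def)
  have b: "a \<le> u" "a \<le> i" "a \<le> j" "u \<le> N - a" "i \<le> N - a" "j \<le> N - a"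
    using lo[of u] lo[of i] lo[of j] ne nz by blast+
  have "w a + w (N - a) = corr N w (N - a)"
  proof (intro top_corr[symmetric] w)
    fix s assume s: "0 < s" "s < a"
    have "s = 1 \<Longrightarrow> w s = 0" using low[of 1] a by simp
    moreover have "w (s + (N - a)) = 0" if "s \<noteq> 1"
    proof -
      have "w (N - (a - s)) = 0" using low[of "a - s"] s that by simp
      then show ?thesis using s a N by (simp add: add.commute)
    qed
    ultimately show "w s = 0 \<or> w (s + (N - a)) = 0" by blast
  qed (use a N in auto)
  also have "\<dots> = corr N (six N a (a - 1) (a + 1) k) (N - a)" using a N by (intro c) auto
  also have "\<dots> = 0"
    unfolding cf unfolding vals using a(2) unfolding e k' by (simp add: six_def)
  finally have wa: "w a + w (N - a) = 0" .
  have Na: "a + 1 < N - a - 1" using a N by simp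
  have neg: "s = i \<or> s = j" if "w s = - 1" "s \<noteq> a - 1" for s
    using that six_eq_minus_1_D unfolding W(3) by blast
  have pos: "s = u" if "w s = 1" "s \<noteq> 0" "s \<noteq> N" for s
    using that six_eq_1_D unfolding W(3) by blast
  consider "w a = 1" "w (N - a) = - 1" | "w a = - 1" "w (N - a) = 1" | "w a = 0" "w (N - a) = 0"
    using wa w_vals[of a] by auto
  then show ?thesis
  proof cases
    case 1
    then have u: "u = a" and ij: "N - a = i \<or> N - a = j"
      using Na a pos[of a] neg[of "N - a"] by auto
    have k: "N - a = k" using N by simp
    from ij have "i = k \<and> j = a + 1 \<or> i = a + 1 \<and> j = k" using W(4) a N unfolding u k by auto
    then show ?thesis unfolding W(3) u
      using six_rotate[of N a "a - 1" "a + 1" k] six_swap[of N a "a + 1" k "a - 1"] by metis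
  next
    case 2
    then have "u = N - a" "a = i \<or> a = j"
      using Na a pos[of "N - a"] neg[of a] by auto
    then show ?thesis using W(4) ne(11,12) a N by linarith
  next
    case 3
    have b': "a < u" "a < i" "a < j" "u < N - a" "i < N - a" "j < N - a"
      using b 3 nz by (metis le_neq_implies_less)+
    have wi: "w i = - 1" "w j = - 1" using W(1) by (auto simp: W(3) six_def)
    have "w (a + 1) + w (N - (a + 1)) = corr N w (N - (a + 1))"
    proof (intro top_corr[symmetric] w)
      fix s assume s: "0 < s" "s < a + 1"
      have "w s = 0" if "s < a - 1" using low s that by simp
      moreover have "w (s + (N - (a + 1))) = 0" if "s \<ge> a - 1"
      \<comment> \<open>For a = 3 and s = 2 the partner is N - 2 = N - (a - 1), which lies outside
        the range of \<open>low\<close> and is covered by \<open>wa1\<close>.\<close>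
      proof (cases "s = a - 1 \<and> a = 3")
        case True
        then have "s + (N - (a + 1)) = N - (a - 1)" using Na by auto
        then show ?thesis using wa1 by simp
      next
        case False
        then have "0 < a + 1 - s" "a + 1 - s < a - 1" using s a that by auto
        then have "w (N - (a + 1 - s)) = 0" using low by blast
        moreover have "N - (a + 1 - s) = s + (N - (a + 1))" using s Na by auto
        ultimately show ?thesis by metis
      qed
      ultimately show "w s = 0 \<or> w (s + (N - (a + 1))) = 0" by (metis not_le)
    qed (use a N in auto)
    also have "\<dots> = corr N (six N a (a - 1) (a + 1) k) (N - (a + 1))" using a N by (intro c) auto
    also have "\<dots> = - 1"
      unfolding cf unfolding vals using a(2) unfolding e k' by (simp add: six_def)
    finally have "w (a + 1) + w (N - (a + 1)) = - 1" .
    then consider "w (a + 1) = - 1" "w (N - (a + 1)) = 0" | "w (N - (a + 1)) = - 1"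
      using w_vals[of "a + 1"] w_vals[of "N - (a + 1)"] by auto
    then show ?thesis
    proof cases
      case 1
      then have "a + 1 = i \<or> a + 1 = j" "N - (a + 1) \<noteq> i" "N - (a + 1) \<noteq> j"
        using neg[of "a + 1"] wi a by auto
      then show ?thesis using W(4) b' ne(1,2) Na by linarith
    next
      case 2
      \<comment> \<open>Stated for arbitrary i and j because it is applied with both orders. The
        first moment gives j = u + 2, and then the correlation at distance 1 is nonnegative, against
        -2.\<close>
      have *: False if ij: "N - (a + 1) = i" and W': "distinct [0, N, u, i, j, a - 1]"
        "w = six N u i j (a - 1)" "i + j + (a - 1) = N + u"
        "a < u" "a < i" "a < j" "u < N - a" "i < N - a" "j < N - a" for i j
      proof -
        have u: "u = j - 2" "j \<ge> 2" using W'(3) ij Na a by linarith+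
        have "corr N w 1 = w 1 + w (N + 1) + w (u + 1) - w (i + 1) - w (j + 1) - w (a - 1 + 1)"
          unfolding W'(2) using Na W'(4-9) by (intro corr_six[OF W'(1)]) auto
        moreover have "w 1 = 0" using low[of 1] a Na by simp
        moreover have "w (N + 1) = 0" using w(3) by simp
        moreover have "i + 1 = N - a" using ij Na by linarith
        then have "w (i + 1) = 0" using 3 by metis
        moreover have "w (a - 1 + 1) = 0" using 3 a by simp
        moreover have "w (j + 1) \<le> 0" using W'(4-9) u a(1) unfolding W'(2) six_def by auto
        moreover have "w (u + 1) \<ge> 0" using W'(4-9) u ij a(1) unfolding W'(2) six_def by auto
        ultimately show False using c1 by linarith
      qed
      have "N - (a + 1) = i \<or> N - (a + 1) = j" using neg[of "N - (a + 1)"] 2 Na by auto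
      then show ?thesis
      proof
        assume "N - (a + 1) = i"
        then show ?thesis using *[of i j] W b' by blast
      next
        assume ij: "N - (a + 1) = j"
        have "w = six N u j i (a - 1)" using W(3) six_swap by metis
        moreover have "distinct [0, N, u, j, i, a - 1]" using W(1) by auto
        moreover have "j + i + (a - 1) = N + u" using W(4) by simp
        ultimately show ?thesis using *[of j i] ij b' by blast
      qed
    qed
  qed
qed

section \<open>Ljunggren's method\<close>

lemma coeff_mult_reflect_poly:
  fixes p :: "int poly"
  assumes "m \<le> degree p"
  shows "coeff (p * reflect_poly p) (degree p - m) = corr (degree p) (coeff p) m"
proof -
  have "coeff (p * reflect_poly p) (degree p - m) =
      (\<Sum>i\<le>degree p - m. coeff p i * coeff p (i + m))"
    unfolding coeff_mult using assms
    by (intro sum.cong refl) (auto simp: coeff_reflect_poly intro!: arg_cong[of _ _ "coeff p"])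
  also have "\<dots> = corr (degree p) (coeff p) m"
    unfolding corr_def using assms
    by (intro sum.mono_neutral_left) (auto intro!: coeff_eq_0)
  finally show ?thesis .
qed

lemma pderiv_sum: "pderiv (\<Sum>i\<in>A. f i) = (\<Sum>i\<in>A. pderiv (f i))"
  by (induction A rule: infinite_finite_induct) (simp_all add: pderiv_add)

lemma sum_coeff_mult_index:
  fixes p :: "int poly"
  assumes "degree p \<le> n"
  shows "(\<Sum>s\<le>n. coeff p s * int s) = poly (pderiv p) 1"
proof -
  have "poly (pderiv p) 1 = poly (pderiv (\<Sum>s\<le>n. monom (coeff p s) s)) 1"
    by (simp only: poly_as_sum_of_monoms'[OF assms])
  also have "\<dots> = (\<Sum>s\<le>n. coeff p s * int s)"
    by (simp add: pderiv_sum pderiv_monom poly_sum poly_monom mult.commute)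
  finally show ?thesis ..
qed

lemma poly_reflect_poly_at_1: "poly (reflect_poly p) 1 = poly (p :: int poly) 1"
proof -
  have "poly (reflect_poly p) 1 = (\<Sum>i\<le>degree p. coeff p (degree p - i))"
  proof -
    have "poly (reflect_poly p) 1 = (\<Sum>i\<le>degree p. coeff (reflect_poly p) i)"
      unfolding poly_altdef using degree_reflect_poly_le[of p]
      by (simp, intro sum.mono_neutral_left) (auto intro: coeff_eq_0)
    then show ?thesis by (simp add: coeff_reflect_poly)
  qed
  also have "\<dots> = (\<Sum>i\<le>degree p. coeff p i)"
    by (rule sum.reindex_bij_witness[of _ "\<lambda>i. degree p - i" "\<lambda>i. degree p - i"]) auto
  finally show ?thesis by (simp add: poly_altdef)
qed

text \<open>The self-reciprocal factor (1 - q)^2; multiplied by it, the denominators become six-term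
  polynomials.\<close>

definition sq1 :: "int poly" where "sq1 = [:1, -2, 1:]"

lemma reflect_sq1: "reflect_poly sq1 = sq1"
  by (simp add: sq1_def reflect_poly_def)

lemma sq1_simps [simp]: "sq1 \<noteq> 0" "coeff sq1 0 = 1" "lead_coeff sq1 = 1" "poly sq1 1 = 0"
  "poly (pderiv sq1) 1 = 0" "poly (pderiv (pderiv sq1)) 1 = 2"
  by (simp_all add: sq1_def pderiv_pCons)

text \<open>W has a double zero at 1, so W(1) = W'(1) = 0. The second moment is the derivative of q
  W' at 1, which reduces to W''(1) = 2 V(1).\<close>

lemma sq1_coeffs:
  fixes V :: "int poly"
  defines "W \<equiv> sq1 * V"
  assumes "degree W \<le> N"
  shows "(\<Sum>s\<le>N. coeff W s) = 0" "(\<Sum>s\<le>N. coeff W s * int s) = 0"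
    "(\<Sum>s\<le>N. coeff W s * (int s)\<^sup>2) = 2 * poly V 1"
proof -
  have "(\<Sum>s\<le>N. coeff W s) = poly (\<Sum>s\<le>N. monom (coeff W s) s) 1"
    by (simp add: poly_sum poly_monom)
  then show "(\<Sum>s\<le>N. coeff W s) = 0"
    unfolding poly_as_sum_of_monoms'[OF assms(2)] by (simp add: W_def)
  show "(\<Sum>s\<le>N. coeff W s * int s) = 0"
    unfolding sum_coeff_mult_index[OF assms(2)] unfolding W_def pderiv_mult by simp
  have "degree (pCons 0 (pderiv W)) \<le> N"
    using assms(2) by (auto simp: degree_pderiv degree_pCons_eq_if pderiv_eq_0_iff)
  from sum_coeff_mult_index[OF this]
  have "(\<Sum>s\<le>N. coeff (pCons 0 (pderiv W)) s * int s) = poly (pderiv (pCons 0 (pderiv W))) 1" .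
  moreover have "coeff (pCons 0 (pderiv W)) s = coeff W s * int s" for s
    by (cases s) (simp_all add: coeff_pderiv)
  ultimately have "(\<Sum>s\<le>N. coeff W s * (int s)\<^sup>2) = poly (pderiv (pCons 0 (pderiv W))) 1"
    by (simp add: power2_eq_square mult.assoc)
  also have "\<dots> = 2 * poly V 1"
    unfolding W_def pderiv_mult by (simp add: pderiv_pCons pderiv_mult pderiv_add)
  finally show "(\<Sum>s\<le>N. coeff W s * (int s)\<^sup>2) = 2 * poly V 1" .
qed

text \<open>Multiplying the hypothesis by (1 - q)^4 equates all correlations of (1 - q)^2 V and (1 -
  q)^2 P; the one at distance 0 is the square sum. The second moment is known up to sign because
  V(1)^2 = P(1)^2.\<close>

lemma ljunggren_step:
  fixes P V :: "int poly"
  assumes F: "coeff (sq1 * P) = six N u i j l" "distinct [0, N, u, i, j, l]"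
      "\<forall>x\<in>{u, i, j, l}. x < N"
    and V: "V * reflect_poly V = P * reflect_poly P" "coeff V 0 > 0"
  defines "w \<equiv> coeff (sq1 * V)"
  shows "w 0 = 1" "w N = 1" "\<And>s. s > N \<Longrightarrow> w s = 0" "(\<Sum>s\<le>N. (w s)\<^sup>2) = 6" "(\<Sum>s\<le>N. w s) = 0"
    "(\<Sum>s\<le>N. w s * int s) = 0" "\<bar>\<Sum>s\<le>N. w s * (int s)\<^sup>2\<bar> = 2 * \<bar>poly P 1\<bar>"
    "\<And>m. m > 0 \<Longrightarrow> m < N \<Longrightarrow> corr N w m = corr N (six N u i j l) m"
    "degree (sq1 * V) = N"
proof -
  have P0: "coeff P 0 = 1"
    using fun_cong[OF F(1), of 0] by (simp add: six_def coeff_mult_0)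
  then have Pnz: "P \<noteq> 0" "sq1 * P \<noteq> 0" by auto
  have dF: "degree (sq1 * P) = N"
  proof (rule antisym)
    show "degree (sq1 * P) \<le> N" using F by (intro degree_le) (auto simp: six_def)
    show "N \<le> degree (sq1 * P)" by (intro le_degree) (simp add: F(1) six_def)
  qed
  have "coeff V 0 \<noteq> 0" using V(2) by simp
  then have Vnz: "V \<noteq> 0" "sq1 * V \<noteq> 0" by auto
  have "2 * degree V = degree (V * reflect_poly V)"
    using Vnz \<open>coeff V 0 \<noteq> 0\<close> by (subst degree_mult_eq) auto
  also have "\<dots> = 2 * degree P"
    unfolding V(1) using Pnz P0 by (subst degree_mult_eq) auto
  finally have dV: "degree V = degree P" by simp
  have dW: "degree (sq1 * V) = N"
    unfolding dF[symmetric] degree_mult_eq[OF sq1_simps(1) Vnz(1)]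
      degree_mult_eq[OF sq1_simps(1) Pnz(1)] dV ..
  show "degree (sq1 * V) = N" by (fact dW)
  have lF: "lead_coeff (sq1 * P) = 1" unfolding dF F(1) by (simp add: six_def)
  then have "lead_coeff P = 1" by (simp only: lead_coeff_mult) simp
  then have "coeff (V * reflect_poly V) 0 = 1"
    unfolding V(1) by (simp add: coeff_mult_0 P0)
  \<comment> \<open>Two integers with product 1, one of them positive, are both 1.\<close>
  then have "coeff V 0 * lead_coeff V = 1" by (simp add: coeff_mult_0)
  then have lV: "coeff V 0 = 1" "lead_coeff V = 1"
    using V(2) by (auto simp: pos_zmult_eq_1_iff)
  show "w 0 = 1" using lV by (simp add: w_def coeff_mult_0)
  have "lead_coeff (sq1 * V) = 1" by (simp only: lead_coeff_mult lV) simp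
  then show "w N = 1" by (simp only: dW w_def)
  show "w s = 0" if "s > N" for s unfolding w_def using that dW by (intro coeff_eq_0) simp
  have WF: "(sq1 * V) * reflect_poly (sq1 * V) = (sq1 * P) * reflect_poly (sq1 * P)"
    unfolding reflect_poly_mult reflect_sq1 using V(1) by (metis mult.assoc mult.left_commute)
  have corr: "corr N w m = corr N (six N u i j l) m" if "m \<le> N" for m
    using coeff_mult_reflect_poly[of m "sq1 * V"] coeff_mult_reflect_poly[of m "sq1 * P"] that
    unfolding dW dF WF w_def F(1) by simp
  then show "corr N w m = corr N (six N u i j l) m" if "m > 0" "m < N" for m using that by simp
  have "(\<Sum>s\<le>N. (w s)\<^sup>2) = corr N w 0" by (simp add: corr_def power2_eq_square)
  also have "\<dots> = corr N (six N u i j l) 0" by (rule corr) simp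
  also have "\<dots> = 6" using F(2,3) by (subst corr_six) (auto simp: six_def)
  finally show "(\<Sum>s\<le>N. (w s)\<^sup>2) = 6" .
  have le: "degree (sq1 * V) \<le> N" using dW by simp
  show "(\<Sum>s\<le>N. w s) = 0" "(\<Sum>s\<le>N. w s * int s) = 0"
    using sq1_coeffs[OF le] by (simp_all add: w_def)
  have "(poly V 1)\<^sup>2 = (poly P 1)\<^sup>2"
    using arg_cong[OF V(1), of "\<lambda>p. poly p 1"] by (simp add: poly_reflect_poly_at_1 power2_eq_square)
  then have "\<bar>poly V 1\<bar> = \<bar>poly P 1\<bar>" by (simp add: power2_eq_iff abs_eq_iff)
  then show "\<bar>\<Sum>s\<le>N. w s * (int s)\<^sup>2\<bar> = 2 * \<bar>poly P 1\<bar>"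
    unfolding w_def sq1_coeffs(3)[OF le] by (simp add: abs_mult)
qed

lemma sq1_cancel: "coeff (sq1 * V) = coeff (sq1 * P) \<Longrightarrow> V = P"
  by (metis coeff_inject mult_cancel_left sq1_simps(1))

lemma reflect_poly_minus: "reflect_poly (- p) = - reflect_poly (p :: int poly)"
  using reflect_poly_smult[of "-1" p] by simp

text \<open>Passing to -V makes the constant coefficient positive and keeps the product with the
  reflection. Reflection is an involution on V because that coefficient is nonzero.\<close>

lemma ljunggren_sign:
  fixes P V :: "int poly"
  assumes "V * reflect_poly V = P * reflect_poly P" "coeff P 0 \<noteq> 0" "lead_coeff P \<noteq> 0"
    and pos: "\<And>V. V * reflect_poly V = P * reflect_poly P \<Longrightarrow> coeff V 0 > 0 \<Longrightarrow>
      V = P \<or> reflect_poly V = P"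
  shows "V \<in> {P, - P, reflect_poly P, - reflect_poly P}"
proof -
  have "coeff (V * reflect_poly V) 0 \<noteq> 0" unfolding assms(1) using assms(2,3) by (simp add: coeff_mult_0)
  then have V0: "coeff V 0 \<noteq> 0" by (auto simp: coeff_mult_0)
  have rr: "V = reflect_poly (reflect_poly V)" using V0 by simp
  show ?thesis
  proof (cases "coeff V 0 > 0")
    case True
    then show ?thesis using pos[OF assms(1)] rr by auto
  next
    case False
    then have "- V = P \<or> reflect_poly (- V) = P"
      using assms(1) V0 by (intro pos) (simp_all add: reflect_poly_minus)
    then have "V = - P \<or> reflect_poly V = - P" by (auto simp: reflect_poly_minus)
    then have "V = - P \<or> V = - reflect_poly P" using rr by (auto simp: reflect_poly_minus)
    then show ?thesis by blast
  qed
qed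

section \<open>The two families of denominators\<close>

lemma sq1_monom: "sq1 = 1 - monom 2 1 + monom 1 2"
  by (rule poly_eqI) (auto simp: sq1_def coeff_pCons split: nat.split)

lemma sq1_qint_qint: "sq1 * (qint k * qint a) = 1 - monom 1 k - monom 1 a + monom 1 (k + a)"
proof -
  have "sq1 = (1 - monom 1 1) * (1 - monom 1 1)"
    by (simp add: sq1_def one_pCons monom_Suc)
  then have "sq1 * (qint k * qint a) = ((1 - monom 1 1) * qint k) * ((1 - monom 1 1) * qint a)"
    by (simp only: mult_ac)
  also have "\<dots> = 1 - monom 1 k - monom 1 a + monom 1 (k + a)"
    unfolding qint_mult by (simp add: algebra_simps mult_monom)
  finally show ?thesis .
qed

lemma sq1_mult_monom: "sq1 * monom 1 e = monom 1 e - monom 2 (e + 1) + monom 1 (e + 2)"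
  by (simp add: sq1_monom algebra_simps mult_monom)

text \<open>\<open>P_plus k a\<close> and \<open>P_minus k a\<close> are the denominators for r
  congruent to a, with n = k a + 1 and n = k a - 1; their reflections belong to r congruent to
  -a.\<close>

definition P_plus :: "nat \<Rightarrow> nat \<Rightarrow> int poly" where
  "P_plus k a = 1 + monom 1 1 * qint k * qint a"

definition P_minus :: "nat \<Rightarrow> nat \<Rightarrow> int poly" where
  "P_minus k a = qint k * qint a - monom 1 (a - 1)"

lemma coeff_sq1_P_plus:
  assumes "a \<ge> 2" "k > a"
  shows "coeff (sq1 * P_plus k a) = six (k + a + 1) 2 1 (a + 1) (k + 1)"
proof -
  have "sq1 * P_plus k a = sq1 + monom 1 1 * (sq1 * (qint k * qint a))"
    by (simp add: P_plus_def algebra_simps)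
  also have "\<dots> = 1 - monom 1 1 + monom 1 2 - monom 1 (k + 1) - monom 1 (a + 1) + monom 1 (k + a + 1)"
    unfolding sq1_qint_qint
    by (rule poly_eqI) (auto simp: sq1_monom algebra_simps mult_monom)
  finally show ?thesis using assms by (auto simp: six_def fun_eq_iff)
qed

lemma coeff_sq1_P_minus:
  assumes "a \<ge> 2" "k > a + 1"
  shows "coeff (sq1 * P_minus k a) = six (k + a) a (a - 1) (a + 1) k"
proof -
  have "sq1 * P_minus k a = sq1 * (qint k * qint a) - sq1 * monom 1 (a - 1)"
    by (simp only: P_minus_def right_diff_distrib)
  also have "\<dots> = 1 - monom 1 k + monom 1 a + monom 1 (k + a) - monom 1 (a - 1) - monom 1 (a + 1)"
    unfolding sq1_qint_qint sq1_mult_monom using assms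
    by (intro poly_eqI) (auto simp: algebra_simps)
  finally show ?thesis using assms by (auto simp: six_def fun_eq_iff)
qed

text \<open>If the entry -1 sits at N - t instead of t, the reflection of V has it at t. Its
  constant coefficient is the leading coefficient of V, which is 1, so \<open>core\<close> applies
  to it.\<close>

lemma ljunggren_reflect:
  fixes P V :: "int poly"
  assumes F: "coeff (sq1 * P) = six N u i j l" "distinct [0, N, u, i, j, l]"
      "\<forall>x\<in>{u, i, j, l}. x < N"
    and V: "V * reflect_poly V = P * reflect_poly P" "coeff V 0 > 0"
    and t: "t \<le> N" "coeff (sq1 * V) t = - 1 \<or> coeff (sq1 * V) (N - t) = - 1"
    and core: "\<And>V. V * reflect_poly V = P * reflect_poly P \<Longrightarrow> coeff V 0 > 0 \<Longrightarrow>
      coeff (sq1 * V) t = - 1 \<Longrightarrow> coeff (sq1 * V) = six N u i j l"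
  shows "V = P \<or> reflect_poly V = P"
proof -
  have eq: "V = P" if "V * reflect_poly V = P * reflect_poly P" "coeff V 0 > 0"
    "coeff (sq1 * V) t = - 1" for V
    using core[OF that] F(1) sq1_cancel by simp
  note S = ljunggren_step[OF F V]
  from t(2) show ?thesis
  proof
    assume *: "coeff (sq1 * V) (N - t) = - 1"
    have "coeff (sq1 * reflect_poly V) t = coeff (reflect_poly (sq1 * V)) t"
      by (simp only: reflect_poly_mult reflect_sq1)
    also have "\<dots> = - 1" unfolding coeff_reflect_poly S(9) using t(1) * by simp
    finally have 1: "coeff (sq1 * reflect_poly V) t = - 1" .
    have "lead_coeff (sq1 * V) = 1" using S(2,9) by simp
    then have 2: "coeff (reflect_poly V) 0 > 0" unfolding lead_coeff_mult by simp
    have "reflect_poly V * reflect_poly (reflect_poly V) = P * reflect_poly P"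
      using V by (simp add: mult.commute)
    then show ?thesis using eq[OF _ 2 1] by simp
  qed (use eq[OF V] in simp)
qed

lemma coeff_0_P_plus: "a \<ge> 2 \<Longrightarrow> k > a \<Longrightarrow> coeff (P_plus k a) 0 = 1"
  using fun_cong[OF coeff_sq1_P_plus, of a k 0] by (simp add: six_def coeff_mult_0)

lemma coeff_0_P_minus: "a \<ge> 2 \<Longrightarrow> k > a + 1 \<Longrightarrow> coeff (P_minus k a) 0 = 1"
  using fun_cong[OF coeff_sq1_P_minus, of a k 0] by (simp add: six_def coeff_mult_0)

lemma ljunggren_plus:
  assumes a: "a \<ge> 2" "k \<ge> 5 * a"
    and V: "V * reflect_poly V = P_plus k a * reflect_poly (P_plus k a)"
  shows "V \<in> {P_plus k a, - P_plus k a, reflect_poly (P_plus k a), - reflect_poly (P_plus k a)}"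
proof (rule ljunggren_sign[OF V])
  define N where "N = k + a + 1"
  have ak: "k > a" using a by simp
  have P0: "coeff (P_plus k a) 0 = 1" using coeff_0_P_plus a ak by simp
  then show "coeff (P_plus k a) 0 \<noteq> 0" "lead_coeff (P_plus k a) \<noteq> 0" by auto
  have F: "coeff (sq1 * P_plus k a) = six N 2 1 (a + 1) (k + 1)"
    unfolding N_def by (rule coeff_sq1_P_plus[OF a(1) ak])
  have D: "distinct [0, N, 2, 1, a + 1, k + 1]" "\<forall>x\<in>{2, 1, a + 1, k + 1}. x < N"
    using a by (auto simp: N_def)
  have P1: "\<bar>poly (P_plus k a) 1\<bar> = int k * int a + 1"
    by (simp add: P_plus_def poly_monom)
  fix V
  assume V: "V * reflect_poly V = P_plus k a * reflect_poly (P_plus k a)" "coeff V 0 > 0"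
  define w where "w = coeff (sq1 * V)"
  note S = ljunggren_step[OF F D V, folded w_def]
  have "w 1 + w (N - 1) = corr N w (N - 1)"
    using a S(1-3) by (intro top_corr[symmetric]) (auto simp: N_def)
  also have "\<dots> = corr N (six N 2 1 (a + 1) (k + 1)) (N - 1)"
    using a by (intro S(8)) (auto simp: N_def)
  also have "\<dots> = - 1" using a unfolding corr_six[OF D] by (auto simp: six_def N_def)
  finally have sm: "w 1 = - 1 - w (N - 1)" by simp
  \<comment> \<open>The ends use 2 of the square sum 6, and two integers with sum -1 and square sum
    at most 4 are 0 and -1.\<close>
  have "(\<Sum>s\<in>{0, N, 1, N - 1}. (w s)\<^sup>2) \<le> (\<Sum>s\<le>N. (w s)\<^sup>2)"
    using a by (intro sum_mono2) (auto simp: N_def)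
  then have "(w 1)\<^sup>2 + (w (N - 1))\<^sup>2 \<le> 4"
    using S(1,2,4) a by (auto simp: N_def)
  then have le: "w (N - 1) * (w (N - 1) + 1) < 2"
    unfolding sm by (simp add: power2_eq_square algebra_simps)
  have "w (N - 1) = 0 \<or> w (N - 1) = - 1"
  proof (rule ccontr)
    assume "\<not> ?thesis"
    then consider "w (N - 1) \<ge> 1" | "- w (N - 1) \<ge> 2" by linarith
    then show False
    proof cases
      case 1
      then have "1 * 2 \<le> w (N - 1) * (w (N - 1) + 1)" by (intro mult_mono) auto
      then show False using le by simp
    next
      case 2
      then have "2 * 1 \<le> (- w (N - 1)) * (- w (N - 1) - 1)" by (intro mult_mono) auto
      then show False using le by (simp add: algebra_simps)
    qed
  qed
  then have t: "coeff (sq1 * V) 1 = - 1 \<or> coeff (sq1 * V) (N - 1) = - 1"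
    using sm unfolding w_def by auto
  show "V = P_plus k a \<or> reflect_poly V = P_plus k a"
  proof (rule ljunggren_reflect[OF F D V _ t])
    fix V
    assume V: "V * reflect_poly V = P_plus k a * reflect_poly (P_plus k a)" "coeff V 0 > 0"
      "coeff (sq1 * V) 1 = - 1"
    note S = ljunggren_step[OF F D V(1,2)]
    show "coeff (sq1 * V) = six N 2 1 (a + 1) (k + 1)"
      using S(7) unfolding P1 by (intro six_plus[OF a N_def S(1-6) _ S(8) V(3)]) simp_all
  qed (simp add: N_def)
qed

lemma ljunggren_minus:
  assumes a: "a \<ge> 3" "k \<ge> 5 * a"
    and V: "V * reflect_poly V = P_minus k a * reflect_poly (P_minus k a)"
  shows "V \<in> {P_minus k a, - P_minus k a, reflect_poly (P_minus k a), - reflect_poly (P_minus k a)}"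
proof (rule ljunggren_sign[OF V])
  define N where "N = k + a"
  have ak: "a \<ge> 2" "k > a + 1" using a by simp_all
  have P0: "coeff (P_minus k a) 0 = 1" using coeff_0_P_minus ak by simp
  then show "coeff (P_minus k a) 0 \<noteq> 0" "lead_coeff (P_minus k a) \<noteq> 0" by auto
  have F: "coeff (sq1 * P_minus k a) = six N a (a - 1) (a + 1) k"
    unfolding N_def by (rule coeff_sq1_P_minus[OF ak])
  have D: "distinct [0, N, a, a - 1, a + 1, k]" "\<forall>x\<in>{a, a - 1, a + 1, k}. x < N"
    using a by (auto simp: N_def)
  fix V
  assume V: "V * reflect_poly V = P_minus k a * reflect_poly (P_minus k a)" "coeff V 0 > 0"
  note S = ljunggren_step[OF F D V]
  have t: "coeff (sq1 * V) (a - 1) = - 1 \<or> coeff (sq1 * V) (N - (a - 1)) = - 1"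
    by (rule six_minus_low(2)[OF a N_def S(1-6,8)])
  show "V = P_minus k a \<or> reflect_poly V = P_minus k a"
  proof (rule ljunggren_reflect[OF F D V _ t])
    fix V
    assume V: "V * reflect_poly V = P_minus k a * reflect_poly (P_minus k a)" "coeff V 0 > 0"
      "coeff (sq1 * V) (a - 1) = - 1"
    note S = ljunggren_step[OF F D V(1,2)]
    show "coeff (sq1 * V) = six N a (a - 1) (a + 1) k"
      by (rule six_minus[OF a N_def S(1-6,8) V(3)])
  qed (simp add: N_def)
qed

section \<open>Roots of unity\<close>

abbreviation cpoly :: "int poly \<Rightarrow> complex poly" where
  "cpoly p \<equiv> map_poly of_int p"

lemma cpoly_diff: "cpoly (p - q) = cpoly p - cpoly q"
  by (rule poly_eqI) (simp add: coeff_map_poly)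

lemma cpoly_monom: "cpoly (monom c n) = monom (of_int c) n"
  by (simp add: map_poly_monom)

lemmas cpoly_simps = map_poly_of_int_add map_poly_of_int_mult cpoly_diff cpoly_monom

lemma degree_cpoly [simp]: "degree (cpoly p) = degree p"
  by (rule degree_map_poly) auto

lemma poly_cpoly_1: "poly (cpoly p) 1 = of_int (poly p 1)"
  by (simp add: poly_altdef coeff_map_poly)

lemma poly_cpoly_0: "poly (cpoly p) 0 = of_int (coeff p 0)"
  by (simp add: poly_0_coeff_0 coeff_map_poly)

lemma cpoly_reflect_poly: "cpoly (reflect_poly p) = reflect_poly (cpoly p)"
  by (rule poly_eqI) (simp add: coeff_map_poly coeff_reflect_poly)

lemma poly_cpoly_inverse_eq_0:
  assumes "poly (cpoly (reflect_poly p)) z = 0" "z \<noteq> 0"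
  shows "poly (cpoly p) (inverse z) = 0"
  using assms by (simp add: cpoly_reflect_poly poly_reflect_poly_nz)

lemma poly_cpoly_cnj: "poly (cpoly p) (cnj z) = cnj (poly (cpoly p) z)"
  by (simp add: poly_altdef coeff_map_poly)

lemma poly_cpoly_qint: "(1 - z) * poly (cpoly (qint n)) z = 1 - z ^ n"
  using arg_cong[OF qint_mult[of n], of "\<lambda>p. poly (cpoly p) z"]
  by (simp add: cpoly_simps poly_monom)

text \<open>These turn out to be the roots of \<open>C_poly a n\<close>, see
  \<open>cpoly_C_poly\<close>.\<close>

definition cyclotomic_part_roots :: "nat \<Rightarrow> nat \<Rightarrow> complex set" where
  "cyclotomic_part_roots a n = {z. z \<noteq> 1 \<and> z ^ n = 1 \<and> (z ^ (a - 1) = 1 \<or> z ^ (a + 1) = 1)}"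

text \<open>For nonzero B and z the hypothesis says B + 1/B = z + 1/z; the difference of its two
  sides is (B - z) (B z - 1).\<close>

lemma symmetric_equation:
  fixes z B :: complex
  assumes "z * (B - 1)\<^sup>2 = B * (1 - z)\<^sup>2"
  shows "B = z \<or> B * z = 1"
proof -
  have "(B - z) * (1 - B * z) = 0"
    using assms by (simp add: power2_eq_square algebra_simps)
  then show ?thesis by auto
qed

section \<open>Common roots of a denominator and its reflection\<close>

lemma poly_P_plus_sq:
  "(1 - z)\<^sup>2 * poly (cpoly (P_plus k a)) z = (1 - z)\<^sup>2 + z * (1 - z ^ k) * (1 - z ^ a)"
proof -
  have "(1 - z)\<^sup>2 * poly (cpoly (P_plus k a)) z = (1 - z)\<^sup>2 +
      z * ((1 - z) * poly (cpoly (qint k)) z) * ((1 - z) * poly (cpoly (qint a)) z)"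
    by (simp add: P_plus_def cpoly_simps poly_monom power2_eq_square algebra_simps)
  then show ?thesis by (simp only: poly_cpoly_qint)
qed

lemma poly_P_minus_sq:
  assumes "a \<ge> 1"
  shows "z * ((1 - z)\<^sup>2 * poly (cpoly (P_minus k a)) z) =
    z * (1 - z ^ k) * (1 - z ^ a) - z ^ a * (1 - z)\<^sup>2"
proof -
  have za: "z ^ a = z * z ^ (a - 1)" using assms by (simp flip: power_Suc)
  have "z * ((1 - z)\<^sup>2 * poly (cpoly (P_minus k a)) z) =
      z * ((1 - z) * poly (cpoly (qint k)) z) * ((1 - z) * poly (cpoly (qint a)) z)
      - z * z ^ (a - 1) * (1 - z)\<^sup>2"
    by (simp add: P_minus_def cpoly_simps poly_monom power2_eq_square algebra_simps)
  then show ?thesis by (simp only: poly_cpoly_qint za)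
qed

text \<open>With A = z^k and B = z^a, the equations at z and 1/z differ by the factor A B in front
  of (1 - z)^2, so A B = 1. Eliminating A leaves the symmetric equation for B and z.\<close>

lemma common_roots_plus:
  assumes "a \<ge> 1" "z \<noteq> 0" "poly (cpoly (P_plus k a)) z = 0"
    "poly (cpoly (P_plus k a)) (inverse z) = 0"
  shows "z \<in> cyclotomic_part_roots a (k * a + 1)"
proof -
  define A where "A = z ^ k"
  define B where "B = z ^ a"
  have nz: "A \<noteq> 0" "B \<noteq> 0" using assms(2) by (auto simp: A_def B_def)
  have z1: "z \<noteq> 1"
  proof
    assume "z = 1"
    then have "poly (P_plus k a) 1 = 0" using assms(3) by (simp add: poly_cpoly_1)
    then have "1 + int (k * a) = 0" by (simp add: P_plus_def poly_monom)
    then show False by linarith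
  qed
  have 1: "(1 - z)\<^sup>2 + z * (1 - A) * (1 - B) = 0"
    using poly_P_plus_sq[of z k a] assms(3) by (simp add: A_def B_def)
  have "(1 - inverse z)\<^sup>2 + inverse z * (1 - inverse A) * (1 - inverse B) = 0"
    using poly_P_plus_sq[of "inverse z" k a] assms(4) by (simp add: A_def B_def power_inverse)
  moreover have "(1 - z)\<^sup>2 * (A * B) + z * (1 - A) * (1 - B) = z\<^sup>2 * (A * B) *
      ((1 - inverse z)\<^sup>2 + inverse z * (1 - inverse A) * (1 - inverse B))"
    using assms(2) nz by (simp add: field_simps power2_eq_square)
  ultimately have 2: "(1 - z)\<^sup>2 * (A * B) + z * (1 - A) * (1 - B) = 0" by simp
  have "(1 - z)\<^sup>2 * (A * B) = (1 - z)\<^sup>2" using 1 2 by (metis add_right_cancel add.assoc)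
  then have AB: "A * B = 1" using z1 by simp
  have "((1 - z)\<^sup>2 + z * (1 - A) * (1 - B)) * B = (1 - z)\<^sup>2 * B + z * (B - A * B) * (1 - B)"
    by (simp add: algebra_simps)
  then have "z * (B - 1)\<^sup>2 = B * (1 - z)\<^sup>2"
    unfolding 1 AB by (simp add: power2_eq_square algebra_simps)
  then consider "B = z" | "B * z = 1" using symmetric_equation by blast
  then show ?thesis
  proof cases
    case 1
    then have "z ^ (a - 1) = 1"
      using assms(1,2) by (simp add: B_def power_diff)
    moreover have "z ^ (k * a + 1) = B ^ k * z" by (simp add: B_def mult.commute flip: power_mult)
    then have "z ^ (k * a + 1) = A * B" by (simp only: 1 A_def)
    then have "z ^ (k * a + 1) = 1" using AB by simp
    ultimately show ?thesis using z1 by (simp add: cyclotomic_part_roots_def)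
  next
    case 2
    then have "z ^ (a + 1) = 1" by (simp add: B_def mult.commute)
    moreover have "A = z" using AB 2 nz by (metis mult.commute mult_cancel_right)
    then have "z ^ (k * a + 1) = B * z" by (simp add: A_def B_def power_mult)
    then have "z ^ (k * a + 1) = 1" using 2 by simp
    ultimately show ?thesis using z1 by (simp add: cyclotomic_part_roots_def)
  qed
qed

text \<open>The equations at z and 1/z now carry B and A in front of (1 - z)^2, so A = B, and the
  same symmetric equation results.\<close>

lemma common_roots_minus:
  assumes "a \<ge> 1" "k * a \<ge> 2" "z \<noteq> 0" "poly (cpoly (P_minus k a)) z = 0"
    "poly (cpoly (P_minus k a)) (inverse z) = 0"
  shows "z \<in> cyclotomic_part_roots a (k * a - 1)"
proof -
  define A where "A = z ^ k"
  define B where "B = z ^ a"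
  have nz: "A \<noteq> 0" "B \<noteq> 0" using assms(3) by (auto simp: A_def B_def)
  have z1: "z \<noteq> 1"
  proof
    assume "z = 1"
    then have "poly (P_minus k a) 1 = 0" using assms(4) by (simp add: poly_cpoly_1)
    then have "int (k * a) = 1" by (simp add: P_minus_def poly_monom)
    then show False using assms(2) by linarith
  qed
  have 1: "z * (1 - A) * (1 - B) - B * (1 - z)\<^sup>2 = 0"
    using poly_P_minus_sq[OF assms(1), of z k] assms(4) by (simp add: A_def B_def)
  have "inverse z * (1 - inverse A) * (1 - inverse B) - inverse B * (1 - inverse z)\<^sup>2 = 0"
    using poly_P_minus_sq[OF assms(1), of "inverse z" k] assms(5)
    by (simp add: A_def B_def power_inverse)
  moreover have "z * (1 - A) * (1 - B) - A * (1 - z)\<^sup>2 = z\<^sup>2 * (A * B) *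
      (inverse z * (1 - inverse A) * (1 - inverse B) - inverse B * (1 - inverse z)\<^sup>2)"
    using assms(3) nz by (simp add: field_simps power2_eq_square)
  ultimately have 2: "z * (1 - A) * (1 - B) - A * (1 - z)\<^sup>2 = 0" by simp
  have "A * (1 - z)\<^sup>2 = B * (1 - z)\<^sup>2" using 1 2 by (metis eq_iff_diff_eq_0)
  then have AB: "A = B" using z1 by (metis mult_cancel_right power_eq_0_iff right_minus_eq)
  have "z * (B - 1)\<^sup>2 = B * (1 - z)\<^sup>2"
    using 1 unfolding AB by (simp add: power2_eq_square algebra_simps)
  then consider "B = z" | "B * z = 1" using symmetric_equation by blast
  then have "z ^ (k * a) = z \<and> (z ^ (a - 1) = 1 \<or> z ^ (a + 1) = 1)"
  proof cases
    case 1
    then have "z ^ (a - 1) = 1"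
      using assms(1,3) by (simp add: B_def power_diff)
    moreover have "z ^ (k * a) = B ^ k" by (simp add: B_def mult.commute flip: power_mult)
    then have "z ^ (k * a) = z" using 1 AB by (simp add: A_def)
    ultimately show ?thesis by simp
  next
    case 2
    then have "z ^ (a + 1) = 1" by (simp add: B_def mult.commute)
    moreover have "z ^ (k * a) * B = (A * z) ^ a"
      by (simp add: A_def B_def power_mult power_mult_distrib)
    then have "z ^ (k * a) * B = z * B" using 2 AB by (simp add: mult.commute)
    then have "z ^ (k * a) = z" using nz by simp
    ultimately show ?thesis by simp
  qed
  moreover have "k * a = Suc (k * a - 1)" using assms(2) by linarith
  then have "z ^ (k * a) = z * z ^ (k * a - 1)" by (metis power_Suc)
  ultimately show ?thesis using z1 assms(3) by (simp add: cyclotomic_part_roots_def)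
qed

section \<open>Simplicity of the common roots\<close>

lemma norm_cyclotomic_part_roots: "z \<in> cyclotomic_part_roots a n \<Longrightarrow> n > 0 \<Longrightarrow> norm z = 1"
  using power_eq_1_iff[of z n] by (auto simp: cyclotomic_part_roots_def)

lemma pderiv_sq1_mult_root:
  assumes "poly (cpoly P) z = 0" "poly (pderiv (cpoly P)) z = 0"
  shows "poly (pderiv (cpoly (sq1 * P))) z = 0"
  using assms by (simp add: map_poly_of_int_mult pderiv_mult)

lemma linear_root_norm:
  fixes z :: complex and x y :: int
  assumes "of_int x * z = of_int y" "norm z = 1"
  shows "\<bar>x\<bar> = \<bar>y\<bar>"
proof -
  have "norm (of_int x * z) = norm (of_int y :: complex)" using assms(1) by simp
  then show ?thesis using assms(2) by (simp add: norm_mult flip: of_int_abs)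
qed

lemma six_poly:
  assumes "coeff p = six N u i j l" "distinct [0, N, u, i, j, l]"
  shows "p = 1 + monom 1 N + monom 1 u - monom 1 i - monom 1 j - monom 1 l"
  using assms by (intro poly_eqI) (auto simp: six_def)

text \<open>The factor z turns each term of the derivative into n z^n and avoids the exponents n -
  1.\<close>

lemma poly_pderiv_six:
  assumes "coeff p = six N u i j l" "distinct [0, N, u, i, j, l]"
  shows "z * poly (pderiv (cpoly p)) z =
    of_nat N * z ^ N + of_nat u * z ^ u - of_nat i * z ^ i - of_nat j * z ^ j - of_nat l * z ^ l"
proof -
  have *: "z * (of_nat n * z ^ (n - 1)) = of_nat n * z ^ n" for n
    by (cases n) auto
  show ?thesis
    unfolding six_poly[OF assms]
    by (simp add: cpoly_simps pderiv_add pderiv_diff pderiv_monom poly_monom algebra_simps)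
      (simp add: * flip: One_nat_def)
qed

text \<open>Since z^a is z or 1/z, the power z^(k a) is z^k or its inverse, and z^(k a + 1) = 1 then
  determines z^k.\<close>

lemma cyclotomic_part_roots_plus:
  assumes "z \<in> cyclotomic_part_roots a (k * a + 1)" "a \<ge> 1"
  shows "z ^ a = z \<and> z ^ k * z = 1 \<or> z ^ a * z = 1 \<and> z ^ k = z"
proof -
  have z: "z ^ (k * a) * z = 1" and z0: "z \<noteq> 0" using assms by (auto simp: cyclotomic_part_roots_def mult.commute)
  from assms(1) consider "z ^ (a - 1) = 1" | "z ^ (a + 1) = 1" by (auto simp: cyclotomic_part_roots_def)
  then show ?thesis
  proof cases
    case 1
    have "z ^ a = z ^ (a - 1) * z" using assms(2) by (simp flip: power_Suc2)
    then have za: "z ^ a = z" using 1 by simp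
    have "z ^ (k * a) = (z ^ a) ^ k" by (simp add: mult.commute flip: power_mult)
    then show ?thesis using z za by simp
  next
    case 2
    then have za: "z ^ a * z = 1" by (simp add: mult.commute)
    have "z ^ (k * a) * z ^ k = (z ^ a * z) ^ k"
      by (simp add: power_mult_distrib mult.commute flip: power_mult)
    then have "z ^ (k * a) * z ^ k = z ^ (k * a) * z" using z za by simp
    then show ?thesis using za z0 by simp
  qed
qed

lemma cyclotomic_part_roots_minus:
  assumes "z \<in> cyclotomic_part_roots a (k * a - 1)" "a \<ge> 1" "k \<ge> 2"
  shows "z ^ a = z \<and> z ^ k = z \<or> z ^ a * z = 1 \<and> z ^ k * z = 1"
proof -
  have "k * a \<ge> 2 * 1" using assms by (intro mult_le_mono) auto
  then have ka: "k * a - 1 > 0" "k * a = Suc (k * a - 1)" by linarith+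
  have zn: "z ^ (k * a - 1) = 1" using assms(1) by (simp add: cyclotomic_part_roots_def)
  then have z: "z ^ (k * a) = z" by (subst ka(2)) simp
  have z0: "z \<noteq> 0"
  proof
    assume "z = 0"
    then show False using zn ka(1) by (simp add: power_0_left)
  qed
  from assms(1) consider "z ^ (a - 1) = 1" | "z ^ (a + 1) = 1" by (auto simp: cyclotomic_part_roots_def)
  then show ?thesis
  proof cases
    case 1
    have "z ^ a = z ^ (a - 1) * z" using assms(2) by (simp flip: power_Suc2)
    then have za: "z ^ a = z" using 1 by simp
    have "z ^ (k * a) = (z ^ a) ^ k" by (simp add: mult.commute flip: power_mult)
    then show ?thesis using z za by simp
  next
    case 2
    then have za: "z ^ a * z = 1" by (simp add: mult.commute)
    have "z ^ (k * a) * z ^ k = (z ^ a * z) ^ k"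
      by (simp add: power_mult_distrib mult.commute flip: power_mult)
    then show ?thesis using z za by (simp add: mult.commute)
  qed
qed

text \<open>At a double root the derivative of (1 - q)^2 P vanishes too. Inserting the values of z^a
  and z^k turns it, up to sign, into z - 1 times a linear factor with coefficients a - 1, k + 1 or k
  - 1, a + 1. Their absolute values differ because k > a + 2, so the linear factor has no root on
  the unit circle.\<close>

lemma cyclotomic_part_simple_plus:
  assumes a: "a \<ge> 2" "k > a + 2" and z: "z \<in> cyclotomic_part_roots a (k * a + 1)"
  shows "poly (cpoly (P_plus k a)) z = 0" "poly (pderiv (cpoly (P_plus k a))) z \<noteq> 0"
proof -
  have z1: "z \<noteq> 1" using z by (simp add: cyclotomic_part_roots_def)
  have n: "norm z = 1" using norm_cyclotomic_part_roots[OF z] by simp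
  have cs: "z ^ a = z \<and> z ^ k * z = 1 \<or> z ^ a * z = 1 \<and> z ^ k = z"
    using cyclotomic_part_roots_plus[OF z] a by simp
  then have "(1 - z)\<^sup>2 + z * (1 - z ^ k) * (1 - z ^ a) = 0"
  proof
    assume *: "z ^ a = z \<and> z ^ k * z = 1"
    have "z * (1 - z ^ k) * (1 - z ^ a) = (z - z ^ k * z) * (1 - z ^ a)"
      by (simp add: algebra_simps)
    then show ?thesis using * by (simp add: power2_eq_square algebra_simps)
  next
    assume *: "z ^ a * z = 1 \<and> z ^ k = z"
    have "z * (1 - z ^ k) * (1 - z ^ a) = (1 - z ^ k) * (z - z ^ a * z)"
      by (simp add: algebra_simps)
    then show ?thesis using * by (simp add: power2_eq_square algebra_simps)
  qed
  then show root: "poly (cpoly (P_plus k a)) z = 0"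
    using poly_P_plus_sq[of z k a] z1 by simp
  have F: "coeff (sq1 * P_plus k a) = six (k + a + 1) 2 1 (a + 1) (k + 1)"
    "distinct [0, k + a + 1, 2, 1, a + 1, k + 1]"
    using a coeff_sq1_P_plus[of a k] by auto
  show "poly (pderiv (cpoly (P_plus k a))) z \<noteq> 0"
  proof
    assume "poly (pderiv (cpoly (P_plus k a))) z = 0"
    then have "of_nat (k + a + 1) * z ^ (k + a + 1) + of_nat 2 * z\<^sup>2 - of_nat 1 * z ^ 1
        - of_nat (a + 1) * z ^ (a + 1) - of_nat (k + 1) * z ^ (k + 1) = 0"
      using poly_pderiv_six[OF F, of z] pderiv_sq1_mult_root[OF root] by simp
    then have 0: "of_nat (k + a + 1) * (z ^ k * z ^ a * z) + 2 * z\<^sup>2 - z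
        - of_nat (a + 1) * (z ^ a * z) - of_nat (k + 1) * (z ^ k * z) = 0"
      by (simp add: power_add mult_ac)
    from cs show False
    proof
      assume *: "z ^ a = z \<and> z ^ k * z = 1"
      have "z ^ k * z ^ a * z = (z ^ k * z) * z ^ a" by (simp only: mult_ac)
      also have "\<dots> = z" using * by simp
      finally have e: "z ^ k * z ^ a * z = z" .
      have e': "z ^ a * z = z * z" "z ^ k * z = 1" using * by simp_all
      have "(z - 1) * (of_int (int a - 1) * z - of_int (int k + 1)) = 0"
        using 0 unfolding e e' by (simp add: power2_eq_square algebra_simps)
      then have "of_int (int a - 1) * z = of_int (int k + 1)" using z1 by simp
      from linear_root_norm[OF this n] show False using a by simp
    next
      assume *: "z ^ a * z = 1 \<and> z ^ k = z"
      have "z ^ k * z ^ a * z = z ^ k * (z ^ a * z)" by (simp only: mult_ac)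
      also have "\<dots> = z" using * by simp
      finally have e: "z ^ k * z ^ a * z = z" .
      have e': "z ^ a * z = 1" "z ^ k * z = z * z" using * by simp_all
      have "(z - 1) * (of_int (int k - 1) * z - of_int (int a + 1)) = 0"
        using 0 unfolding e e' by (simp add: power2_eq_square algebra_simps)
      then have "of_int (int k - 1) * z = of_int (int a + 1)" using z1 by simp
      from linear_root_norm[OF this n] show False using a by simp
    qed
  qed
qed

text \<open>Same argument; the linear factors now have coefficients of absolute values k - 1, a - 1
  or a + 1, k + 1.\<close>

lemma cyclotomic_part_simple_minus:
  assumes a: "a \<ge> 2" "k > a + 2" and z: "z \<in> cyclotomic_part_roots a (k * a - 1)"
  shows "poly (cpoly (P_minus k a)) z = 0" "poly (pderiv (cpoly (P_minus k a))) z \<noteq> 0"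
proof -
  have z1: "z \<noteq> 1" using z by (simp add: cyclotomic_part_roots_def)
  have "k * a \<ge> 2 * 1" using a by (intro mult_le_mono) auto
  then have n: "norm z = 1" using norm_cyclotomic_part_roots[OF z] by linarith
  then have z0: "z \<noteq> 0" by auto
  have cs: "z ^ a = z \<and> z ^ k = z \<or> z ^ a * z = 1 \<and> z ^ k * z = 1"
    using cyclotomic_part_roots_minus[OF z] a by simp
  then have eq: "z ^ k = z ^ a" using z0 by (metis mult_cancel_right)
  from cs have "z * (1 - z ^ a)\<^sup>2 = z ^ a * (1 - z)\<^sup>2"
  proof
    assume *: "z ^ a * z = 1 \<and> z ^ k * z = 1"
    have "z * (1 - z ^ a)\<^sup>2 = z - 2 * (z ^ a * z) + z ^ a * (z ^ a * z)"
      "z ^ a * (1 - z)\<^sup>2 = z ^ a - 2 * (z ^ a * z) + (z ^ a * z) * z"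
      by (simp_all add: power2_eq_square algebra_simps)
    then show ?thesis using * by simp
  qed simp
  then show root: "poly (cpoly (P_minus k a)) z = 0"
  proof -
    assume "z * (1 - z ^ a)\<^sup>2 = z ^ a * (1 - z)\<^sup>2"
    then have "z * (1 - z ^ k) * (1 - z ^ a) - z ^ a * (1 - z)\<^sup>2 = 0"
      unfolding eq by (simp add: power2_eq_square mult.assoc)
    then have "z * ((1 - z)\<^sup>2 * poly (cpoly (P_minus k a)) z) = 0"
      using poly_P_minus_sq[of a z k] a by simp
    then show ?thesis using z0 z1 by simp
  qed
  have F: "coeff (sq1 * P_minus k a) = six (k + a) a (a - 1) (a + 1) k"
    "distinct [0, k + a, a, a - 1, a + 1, k]"
    using a coeff_sq1_P_minus[of a k] by auto
  show "poly (pderiv (cpoly (P_minus k a))) z \<noteq> 0"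
  proof
    assume "poly (pderiv (cpoly (P_minus k a))) z = 0"
    then have "of_nat (k + a) * z ^ (k + a) + of_nat a * z ^ a - of_nat (a - 1) * z ^ (a - 1)
        - of_nat (a + 1) * z ^ (a + 1) - of_nat k * z ^ k = 0"
      using poly_pderiv_six[OF F, of z] pderiv_sq1_mult_root[OF root] by simp
    then have 0: "of_nat (k + a) * (z ^ a * z ^ a) + of_nat a * z ^ a
        - of_nat (a - 1) * z ^ (a - 1) - of_nat (a + 1) * (z ^ a * z) - of_nat k * z ^ a = 0"
      by (simp add: power_add eq mult_ac)
    have za: "z ^ (a - 1) * z = z ^ a" using a by (simp flip: power_Suc2)
    have na: "of_nat (a - 1) = (of_nat a - 1 :: complex)" using a by (simp add: of_nat_diff)
    from cs show False
    proof
      assume *: "z ^ a = z \<and> z ^ k = z"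
      then have "z ^ (a - 1) = 1" using za z0 by simp
      then have "(z - 1) * (of_int (int k - 1) * z - of_int (1 - int a)) = 0"
        using 0 * na by (simp add: power2_eq_square algebra_simps)
      then have "of_int (int k - 1) * z = of_int (1 - int a)" using z1 by simp
      from linear_root_norm[OF this n] show False using a by simp
    next
      assume *: "z ^ a * z = 1 \<and> z ^ k * z = 1"
      \<comment> \<open>Multiplying by z^2 lets every power be expressed through z^a z = 1.\<close>
      have "0 = z * z * (of_nat (k + a) * (z ^ a * z ^ a) + of_nat a * z ^ a
        - of_nat (a - 1) * z ^ (a - 1) - of_nat (a + 1) * (z ^ a * z) - of_nat k * z ^ a)"
        by (simp only: 0 mult_zero_right)
      also have "\<dots> = of_nat (k + a) * ((z ^ a * z) * (z ^ a * z)) + of_nat a * (z ^ a * z) * z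
        - of_nat (a - 1) * ((z ^ (a - 1) * z) * z) - of_nat (a + 1) * (z ^ a * z) * (z * z)
        - of_nat k * (z ^ a * z) * z"
        by (simp only: ring_distribs mult_ac)
      finally have "0 = of_nat (k + a) * (1 * 1) + of_nat a * 1 * z - of_nat (a - 1) * 1
          - of_nat (a + 1) * 1 * (z * z) - of_nat k * 1 * z"
        by (simp only: za conjunct1[OF *])
      then have "(z - 1) * (of_int (int a + 1) * z - of_int (- int k - 1)) = 0"
        unfolding na by (simp add: power2_eq_square algebra_simps)
      then have "of_int (int a + 1) * z = of_int (- int k - 1)" using z1 by simp
      from linear_root_norm[OF this n] show False using a by simp
    qed
  qed
qed

section \<open>Factorization over the integers and the rationals\<close>

lemma map_poly_cyclotomic: "cpoly (cyclotomic d) = complex_cyclotomic d"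
  unfolding cyclotomic_def by (rule theI'[OF ex1_cyclotomic])

lemma cis_frac_eq_1_iff:
  assumes "d > 0"
  shows "cis (2 * pi * real k / real d) = 1 \<longleftrightarrow> d dvd k"
proof
  assume "cis (2 * pi * real k / real d) = 1"
  then obtain n where "2 * pi * real k / real d = of_int n * (2 * pi)"
    unfolding cis_eq_1_iff by blast
  then have "real k = of_int n * real d" using assms by (simp add: field_simps)
  then have "real_of_int (int k) = real_of_int (n * int d)" by simp
  then have "int k = n * int d" by (simp only: of_int_eq_iff)
  then show "d dvd k" by (metis dvd_triv_right int_dvd_int_iff)
next
  assume "d dvd k"
  then obtain m where "k = d * m" by blast
  then have "2 * pi * real k / real d = 2 * pi * real m" using assms by simp
  then have "cis (2 * pi * real k / real d) = cis (2 * pi * real m)" by (simp only:)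
  also have "\<dots> = 1" by (rule cis_multiple_2pi) simp
  finally show "cis (2 * pi * real k / real d) = 1" .
qed

text \<open>The primitive d-th roots of unity; for d = 0 the numbers that are no roots of
  unity.\<close>

definition unity_roots :: "nat \<Rightarrow> complex set" where
  "unity_roots d = {z. \<forall>m. z ^ m = 1 \<longleftrightarrow> d dvd m}"

lemma disjoint_unity_roots: "i \<noteq> j \<Longrightarrow> unity_roots i \<inter> unity_roots j = {}"
  unfolding unity_roots_def by (metis (mono_tags, lifting) disjoint_iff dvd_antisym dvd_refl mem_Collect_eq)

lemma complex_cyclotomic_root_imp:
  assumes "d > 0" "poly (complex_cyclotomic d) z = 0"
  shows "z \<in> unity_roots d"
proof -
  obtain k where k: "k \<in> totatives d" "z = cis (2 * pi * real k / real d)"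
    using assms(2) by (auto simp: complex_cyclotomic_def poly_prod)
  have "z ^ m = 1 \<longleftrightarrow> d dvd m" for m
  proof -
    have "z ^ m = cis (2 * pi * real (k * m) / real d)"
      by (simp add: k(2) DeMoivre mult_ac)
    then have "z ^ m = 1 \<longleftrightarrow> d dvd k * m" using cis_frac_eq_1_iff[OF assms(1)] by metis
    then show ?thesis
      using k(1) by (simp add: in_totatives_iff coprime_commute coprime_dvd_mult_right_iff)
  qed
  then show ?thesis by (simp add: unity_roots_def)
qed

text \<open>Conversely, z is a root of q^d - 1, hence of the cyclotomic polynomial of some divisor e
  of d. Then z has exact order e, and d = e.\<close>

lemma complex_cyclotomic_root_iff:
  assumes "d > 0"
  shows "poly (complex_cyclotomic d) z = 0 \<longleftrightarrow> z \<in> unity_roots d"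
proof
  assume z: "z \<in> unity_roots d"
  then have "z ^ d = 1" by (simp add: unity_roots_def)
  then have "poly (\<Prod>e | e dvd d. complex_cyclotomic e) z = 0"
    unfolding prod_complex_cyclotomic[OF assms] by (simp add: poly_monom)
  then obtain e where e: "e dvd d" "poly (complex_cyclotomic e) z = 0"
    using assms by (auto simp: poly_prod)
  then have "e > 0" using assms by (auto intro: Nat.gr0I)
  then have "z \<in> unity_roots e" using complex_cyclotomic_root_imp e by blast
  then have "d dvd e" using z by (auto simp: unity_roots_def)
  then have "d = e" using e by (simp add: dvd_antisym)
  then show "poly (complex_cyclotomic d) z = 0" using e by simp
qed (use complex_cyclotomic_root_imp assms in blast)

lemma complex_cyclotomic_eq_prod_roots:
  assumes "d \<ge> 2"
  shows "finite (unity_roots d)" "complex_cyclotomic d = (\<Prod>z\<in>unity_roots d. [:- z, 1:])"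
proof -
  define f where "f k = cis (2 * pi * real k / real d)" for k
  have "inj_on f {..<d}"
    using bij_betw_roots_unity[of d] assms unfolding f_def by (auto simp: bij_betw_def)
  moreover have "totatives d \<subseteq> {..<d}" using totatives_less[of _ d] assms by auto
  ultimately have inj: "inj_on f (totatives d)" by (rule inj_on_subset)
  have img: "f ` totatives d = unity_roots d"
    using complex_cyclotomic_root_iff[of d] assms
    by (auto simp: complex_cyclotomic_def poly_prod f_def)
  then show "finite (unity_roots d)" by (metis finite_imageI finite_totatives)
  have "(\<Prod>z\<in>unity_roots d. [:- z, 1:]) = (\<Prod>k\<in>totatives d. [:- f k, 1:])"
    unfolding img[symmetric] by (subst prod.reindex[OF inj]) simp
  then show "complex_cyclotomic d = (\<Prod>z\<in>unity_roots d. [:- z, 1:])"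
    by (simp add: complex_cyclotomic_def f_def)
qed

lemma ex_unity_roots:
  assumes "z ^ m = 1" "m > 0"
  shows "\<exists>d>0. z \<in> unity_roots d"
proof -
  have "poly (\<Prod>e | e dvd m. complex_cyclotomic e) z = 0"
    unfolding prod_complex_cyclotomic[OF assms(2)] using assms(1) by (simp add: poly_monom)
  then obtain e where e: "e dvd m" "poly (complex_cyclotomic e) z = 0"
    using assms(2) by (auto simp: poly_prod)
  then have "e > 0" using assms by (auto intro: Nat.gr0I)
  then show ?thesis using complex_cyclotomic_root_imp e by blast
qed

lemma finite_D_set:
  assumes "a \<ge> 2"
  shows "finite (D_set a)"
proof -
  have "D_set a \<subseteq> {..a + 1}"
    using assms by (auto simp: D_set_def dest!: dvd_imp_le)
  then show ?thesis by (rule finite_subset) simp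
qed

text \<open>In terms of the exact order d of z, the defining conditions become d at least 2, d
  dividing n, and d dividing a - 1 or a + 1. Different orders give disjoint sets of roots, so the
  product over d merges into one over distinct roots.\<close>

lemma cpoly_C_poly:
  assumes "a \<ge> 2" "n > 0"
  shows "finite (cyclotomic_part_roots a n)" "cpoly (C_poly a n) = (\<Prod>z\<in>cyclotomic_part_roots a n. [:- z, 1:])"
proof -
  define E where "E = {d \<in> D_set a. d dvd n}"
  have E: "finite E" "\<And>d. d \<in> E \<Longrightarrow> d \<ge> 2"
    unfolding E_def using finite_D_set[OF assms(1)] by simp (simp add: D_set_def)
  have U: "cyclotomic_part_roots a n = (\<Union>d\<in>E. unity_roots d)"
  proof (intro equalityI subsetI)
    fix z assume z: "z \<in> cyclotomic_part_roots a n"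
    then obtain d where d: "d > 0" "z \<in> unity_roots d"
      using ex_unity_roots[of z n] assms by (auto simp: cyclotomic_part_roots_def)
    have iff: "z ^ m = 1 \<longleftrightarrow> d dvd m" for m using d by (simp add: unity_roots_def)
    have "z ^ 1 \<noteq> 1" using z by (simp add: cyclotomic_part_roots_def)
    then have "d \<noteq> 1" unfolding iff by auto
    moreover have "d dvd n" "d dvd a - 1 \<or> d dvd a + 1"
      using z iff[of n] iff[of "a - 1"] iff[of "a + 1"] by (auto simp: cyclotomic_part_roots_def)
    ultimately have "d \<in> E" using d(1) by (auto simp: E_def D_set_def)
    then show "z \<in> (\<Union>d\<in>E. unity_roots d)" using d by blast
  next
    fix z assume "z \<in> (\<Union>d\<in>E. unity_roots d)"
    then obtain d where d: "d \<in> E" "z \<in> unity_roots d" by blast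
    have iff: "z ^ m = 1 \<longleftrightarrow> d dvd m" for m using d by (simp add: unity_roots_def)
    have "z ^ 1 \<noteq> 1" unfolding iff using E(2)[OF d(1)] by auto
    moreover have "z ^ n = 1" "z ^ (a - 1) = 1 \<or> z ^ (a + 1) = 1"
      using d(1) iff[of n] iff[of "a - 1"] iff[of "a + 1"] by (auto simp: E_def D_set_def)
    ultimately show "z \<in> cyclotomic_part_roots a n" unfolding cyclotomic_part_roots_def by simp
  qed
  then show "finite (cyclotomic_part_roots a n)" using E complex_cyclotomic_eq_prod_roots(1) by simp
  have "cpoly (C_poly a n) = (\<Prod>d\<in>E. complex_cyclotomic d)"
    by (simp add: C_poly_def map_poly_of_int_prod map_poly_cyclotomic E_def)
  also have "\<dots> = (\<Prod>d\<in>E. \<Prod>z\<in>unity_roots d. [:- z, 1:])"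
    using E(2) complex_cyclotomic_eq_prod_roots(2) by (intro prod.cong) auto
  also have "\<dots> = (\<Prod>z\<in>cyclotomic_part_roots a n. [:- z, 1:])"
    unfolding U using E complex_cyclotomic_eq_prod_roots(1)
    by (intro prod.UNION_disjoint[symmetric]) (simp_all add: disjoint_unity_roots)
  finally show "cpoly (C_poly a n) = (\<Prod>z\<in>cyclotomic_part_roots a n. [:- z, 1:])" .
qed

section \<open>Divisibility over the integers and Gauss's lemma\<close>

lemma prod_linear_dvd:
  fixes p :: "complex poly"
  assumes "finite U" "\<And>z. z \<in> U \<Longrightarrow> poly p z = 0"
  shows "(\<Prod>z\<in>U. [:- z, 1:]) dvd p"
  using assms
proof (induction U)
  case (insert x U)
  then obtain q where q: "p = (\<Prod>z\<in>U. [:- z, 1:]) * q" by (auto elim: dvdE)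
  have "poly (\<Prod>z\<in>U. [:- z, 1:]) x \<noteq> 0" using insert.hyps by (auto simp: poly_prod)
  then have "poly q x = 0" using insert.prems[of x] q by simp
  then have "[:- x, 1:] dvd q" by (simp add: poly_eq_0_iff_dvd)
  then show ?case
    unfolding prod.insert[OF insert.hyps] q by (metis dvd_refl mult.commute mult_dvd_mono)
qed simp

text \<open>Pseudo-division by a monic polynomial is ordinary division over the integers, and the
  remainder has too small a degree to be a nonzero complex multiple of C.\<close>

lemma cpoly_dvd_monic:
  assumes "lead_coeff C = 1" "cpoly C dvd cpoly P"
  shows "C dvd P"
proof -
  have C0: "C \<noteq> 0" using assms(1) by auto
  obtain B r where Br: "pseudo_divmod P C = (B, r)" by fastforce
  have div: "P = C * B + r" and r: "r = 0 \<or> degree r < degree C"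
    using pseudo_divmod[OF C0 Br] assms(1) by auto
  have "cpoly C dvd cpoly r"
    using assms(2) unfolding div by (simp add: map_poly_of_int_add map_poly_of_int_mult dvd_add_right_iff)
  have "r = 0"
  proof (rule ccontr)
    assume "r \<noteq> 0"
    then have "cpoly r \<noteq> 0" using map_poly_of_int_inj[of r 0] by auto
    then have "degree C \<le> degree r" using dvd_imp_degree_le[OF \<open>cpoly C dvd cpoly r\<close>] by simp
    then show False using r \<open>r \<noteq> 0\<close> by simp
  qed
  then show ?thesis using div by simp
qed

lemma clear_denominators:
  fixes u :: "rat poly"
  shows "\<exists>c U. c \<noteq> 0 \<and> smult (of_int c) u = map_poly of_int U"
proof (induction u)
  case 0
  show ?case by (intro exI[of _ 1] exI[of _ 0]) simp
next
  case (pCons x u)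
  then obtain c U where cU: "c \<noteq> 0" "smult (of_int c) u = map_poly of_int U" by blast
  obtain p q where x: "x = of_int p / of_int q" "q \<noteq> 0"
    by (cases x) (auto simp: Fract_of_int_quotient)
  have "smult (of_int (c * q)) (pCons x u) = map_poly of_int (pCons (c * p) (smult q U))"
  proof (rule poly_eqI)
    fix n
    have "of_int c * coeff u m = of_int (coeff U m)" for m
      using arg_cong[OF cU(2), of "\<lambda>p. coeff p m"] by (simp add: coeff_map_poly)
    then have *: "of_int q * (of_int c * coeff u m) = of_int (q * coeff U m)" for m by simp
    show "coeff (smult (of_int (c * q)) (pCons x u)) n =
        coeff (map_poly of_int (pCons (c * p) (smult q U))) n"
      using x *[of "n - 1"] by (cases n) (simp_all add: coeff_map_poly mult_ac)
  qed
  then show ?case using cU(1) x(2) by (metis mult_eq_0_iff)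
qed

lemma map_poly_of_int_rat_mult:
  "map_poly of_int (p * q) = map_poly of_int p * (map_poly of_int q :: rat poly)"
  by (rule poly_eqI) (simp add: coeff_map_poly coeff_mult)

lemma map_poly_of_int_rat_inj:
  "map_poly of_int p = (map_poly of_int q :: rat poly) \<Longrightarrow> p = q"
  by (auto simp: poly_eq_iff coeff_map_poly)

text \<open>Gauss's lemma: after clearing denominators, multiplicativity of contents shows that g
  is, up to sign, the product of the primitive parts of U and V.\<close>

lemma irreducible_rat_if_no_int_factorization:
  fixes g :: "int poly"
  assumes "degree g > 0" "content g = 1"
    and fac: "\<And>g1 g2. g = g1 * g2 \<Longrightarrow> degree g1 = 0 \<or> degree g2 = 0"
  shows "irreducible (map_poly of_int g :: rat poly)"
proof (rule irreducibleI)
  have dG: "degree (map_poly of_int p :: rat poly) = degree p" for p :: "int poly"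
    by (rule degree_map_poly) auto
  show "map_poly of_int g \<noteq> (0 :: rat poly)" using assms(1) dG[of g] by auto
  show "\<not> (map_poly of_int g :: rat poly) dvd 1"
    using assms(1) dG[of g] by (auto simp: is_unit_poly_iff)
  fix u v :: "rat poly" assume uv: "map_poly of_int g = u * v"
  obtain c U d V where cU: "c \<noteq> 0" "smult (of_int c) u = map_poly of_int U"
    and dV: "d \<noteq> 0" "smult (of_int d) v = map_poly of_int V"
    using clear_denominators[of u] clear_denominators[of v] by blast
  have "map_poly of_int (smult (c * d) g) = (smult (of_int (c * d)) (map_poly of_int g) :: rat poly)"
    by (rule poly_eqI) (simp add: coeff_map_poly)
  also have "\<dots> = smult (of_int c) u * smult (of_int d) v"
    unfolding uv by (simp add: mult.commute)
  also have "\<dots> = map_poly of_int (U * V)"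
    unfolding cU(2) dV(2) map_poly_of_int_rat_mult ..
  finally have UV: "smult (c * d) g = U * V"
    by (rule map_poly_of_int_rat_inj)
  define e where "e = content U * content V"
  have "content (smult (c * d) g) = \<bar>c * d\<bar>"
    using assms(2) by (simp add: content_smult)
  then have e: "e = \<bar>c * d\<bar>" unfolding UV e_def by (simp add: content_mult)
  have "smult e (primitive_part U * primitive_part V) =
      smult (content U) (primitive_part U) * smult (content V) (primitive_part V)"
    unfolding e_def by (simp only: mult_smult_left mult_smult_right smult_smult mult.commute)
  also have "\<dots> = smult (c * d) g" unfolding UV by (simp only: content_times_primitive_part)
  finally have eq: "smult e (primitive_part U * primitive_part V) = smult (c * d) g" .
  have "g = smult (sgn (c * d)) (primitive_part U) * primitive_part V"
  proof -
    have "smult (c * d) g = smult (c * d) (smult (sgn (c * d)) (primitive_part U) * primitive_part V)"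
      unfolding eq[symmetric] e mult_smult_left smult_smult abs_sgn ..
    moreover have "c * d \<noteq> 0" using cU dV by simp
    ultimately show ?thesis by (metis smult_cancel)
  qed
  then have "degree (smult (sgn (c * d)) (primitive_part U)) = 0 \<or> degree (primitive_part V) = 0"
    by (rule fac)
  moreover have "degree U = degree u" "degree V = degree v"
    using cU dV by (metis dG degree_smult_eq of_int_eq_0_iff)+
  moreover have "u \<noteq> 0" "v \<noteq> 0" using uv assms(1) dG[of g] by auto
  moreover have "sgn (c * d) \<noteq> 0" using cU(1) dV(1) by (simp add: sgn_eq_0_iff)
  ultimately have "degree u = 0 \<or> degree v = 0" by simp
  then show "u dvd 1 \<or> v dvd 1" using \<open>u \<noteq> 0\<close> \<open>v \<noteq> 0\<close> by (auto simp: is_unit_iff_degree)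
qed

section \<open>Irreducibility of the cofactor\<close>

lemma complex_root_ex:
  assumes "degree (g :: int poly) > 0"
  obtains z where "poly (cpoly g) z = 0"
proof -
  have "\<not> constant (poly (cpoly g))" using assms by (simp add: constant_degree)
  then show ?thesis using fundamental_theorem_of_algebra that by blast
qed

lemma self_reciprocal_root:
  assumes "reflect_poly p = p \<or> reflect_poly p = - p" "poly (cpoly p) z = 0" "z \<noteq> 0"
  shows "poly (cpoly p) (inverse z) = 0"
proof (rule poly_cpoly_inverse_eq_0)
  have "cpoly (- p) = - cpoly p" using cpoly_diff[of 0 p] by simp
  then show "poly (cpoly (reflect_poly p)) z = 0" using assms(1,2) by auto
qed (fact assms(3))

text \<open>If \<open>P = C g\<^sub>1 g\<^sub>2\<close> then \<open>V = g\<^sub>1 (C g\<^sub>2)\<close>, with the second factor reflected, satisfies the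
  hypothesis \<open>lj\<close>; its conclusion makes \<open>g\<^sub>1\<close> or \<open>C g\<^sub>2\<close> self-reciprocal, and the roots of a
  self-reciprocal factor are common roots of \<open>P\<close> and its reflection.\<close>

lemma irreducible_cofactor:
  fixes P C :: "int poly" and U :: "complex set"
  assumes P0: "coeff P 0 = 1"
    and lj: "\<And>V. V * reflect_poly V = P * reflect_poly P \<Longrightarrow>
      V \<in> {P, - P, reflect_poly P, - reflect_poly P}"
    and U: "finite U" "cpoly C = (\<Prod>z\<in>U. [:- z, 1:])"
    and common: "\<And>z. z \<noteq> 0 \<Longrightarrow> poly (cpoly P) z = 0 \<Longrightarrow> poly (cpoly P) (inverse z) = 0 \<Longrightarrow> z \<in> U"
    and roots: "\<And>z. z \<in> U \<Longrightarrow> poly (cpoly P) z = 0"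
    and simple: "\<And>z. z \<in> U \<Longrightarrow> poly (pderiv (cpoly P)) z \<noteq> 0"
  obtains g where "P = C * g"
    "\<And>z m. m > 0 \<Longrightarrow> z ^ m = 1 \<Longrightarrow> poly (cpoly g) z \<noteq> 0"
    "degree g > 0 \<Longrightarrow> irreducible (map_poly of_int g :: rat poly)"
proof -
  have "lead_coeff (cpoly C) = 1" unfolding U(2) by (subst lead_coeff_prod) auto
  then have "lead_coeff C = 1" by (simp add: coeff_map_poly)
  moreover have "cpoly C dvd cpoly P" unfolding U(2) using prod_linear_dvd U(1) roots by blast
  ultimately obtain g where g: "P = C * g" using cpoly_dvd_monic by blast
  have "coeff C 0 * coeff g 0 = 1" using P0 unfolding g by (simp add: coeff_mult_0)
  then have g0: "coeff g 0 dvd 1" by (metis dvd_triv_right)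
  have Pz: "z \<noteq> 0" if "poly (cpoly P) z = 0" for z
    using that P0 by (auto simp: poly_cpoly_0)
  \<comment> \<open>Such a z lies in U, so it is a root of both C and g, hence a double root of
    P.\<close>
  have no_common: False if "poly (cpoly g) z = 0" "poly (cpoly P) (inverse z) = 0" for z
  proof -
    have Pr: "poly (cpoly P) z = 0" using that(1) by (simp add: g map_poly_of_int_mult)
    then have z: "z \<in> U" using common Pz that by blast
    then have "poly (cpoly C) z = 0" unfolding U(2) using U(1) by (auto simp: poly_prod)
    then have "poly (pderiv (cpoly P)) z = 0"
      using that(1) by (simp add: g map_poly_of_int_mult pderiv_mult)
    then show False using simple[OF z] by simp
  qed
  \<comment> \<open>On the unit circle the inverse is the conjugate, which is again a root of P
    since P has real coefficients.\<close>
  have unity: "poly (cpoly g) z \<noteq> 0" if "m > 0" "z ^ m = 1" for z m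
  proof
    assume gz: "poly (cpoly g) z = 0"
    then have "poly (cpoly P) z = 0" by (simp add: g map_poly_of_int_mult)
    then have "poly (cpoly P) (cnj z) = 0" by (simp add: poly_cpoly_cnj)
    moreover have "norm z = 1" using power_eq_1_iff[of z m] that by simp
    then have "inverse z = cnj z"
      by (metis complex_norm_square inverse_unique of_real_1 one_power2)
    ultimately show False using no_common gz by metis
  qed
  have factor: "degree g1 = 0 \<or> degree g2 = 0" if g12: "g = g1 * g2" for g1 g2
  proof (rule ccontr)
    assume "\<not> ?thesis"
    then have "degree g1 > 0" "degree g2 > 0" by auto
    then obtain z1 z2 where z12: "poly (cpoly g1) z1 = 0" "poly (cpoly g2) z2 = 0"
      using complex_root_ex by metis
    define h where "h = C * g2"
    have Ph: "P = g1 * h" by (simp add: g g12 h_def)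
    have "coeff g1 0 * coeff h 0 = 1" using P0 unfolding Ph by (simp add: coeff_mult_0)
    then have h0: "coeff h 0 \<noteq> 0" "coeff g1 0 \<noteq> 0" by auto
    have Proots: "poly (cpoly P) z1 = 0" "poly (cpoly P) z2 = 0" "poly (cpoly g) z1 = 0"
      "poly (cpoly g) z2 = 0" "poly (cpoly h) z2 = 0"
      using z12 by (simp_all add: g g12 h_def map_poly_of_int_mult)
    have gh_nz: "g1 \<noteq> 0" "reflect_poly h \<noteq> 0" using h0 by auto
    have "(g1 * reflect_poly h) * reflect_poly (g1 * reflect_poly h) = P * reflect_poly P"
      unfolding Ph reflect_poly_mult using h0 by (simp add: mult_ac)
    then have "g1 * reflect_poly h \<in> {P, - P, reflect_poly P, - reflect_poly P}" by (rule lj)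
    then consider "g1 * reflect_poly h = g1 * h" | "g1 * reflect_poly h = g1 * (- h)" |
      "reflect_poly h * g1 = reflect_poly h * reflect_poly g1" |
      "reflect_poly h * g1 = reflect_poly h * (- reflect_poly g1)"
      unfolding Ph reflect_poly_mult mult_minus_right by (auto simp only: insert_iff empty_iff mult.commute)
    then consider "reflect_poly h = h \<or> reflect_poly h = - h" |
      "reflect_poly g1 = g1 \<or> reflect_poly g1 = - g1"
    proof cases
      case 1
      then show ?thesis using that(1) gh_nz(1) mult_cancel_left by blast
    next
      case 2
      then show ?thesis using that(1) gh_nz(1) mult_cancel_left by blast
    next
      case 3
      then have "g1 = reflect_poly g1" using gh_nz(2) mult_cancel_left by blast
      then show ?thesis using that(2) by simp
    next
      case 4
      then have "g1 = - reflect_poly g1" using gh_nz(2) mult_cancel_left by blast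
      then have "reflect_poly g1 = - g1" by (metis minus_minus)
      then show ?thesis using that(2) by simp
    qed
    then show False
    proof cases
      case 1
      then have "poly (cpoly h) (inverse z2) = 0"
        using self_reciprocal_root Proots Pz by blast
      then have "poly (cpoly P) (inverse z2) = 0" by (simp add: Ph map_poly_of_int_mult)
      then show False using no_common Proots by blast
    next
      case 2
      then have "poly (cpoly g1) (inverse z1) = 0"
        using self_reciprocal_root z12 Proots Pz by blast
      then have "poly (cpoly P) (inverse z1) = 0" by (simp add: Ph map_poly_of_int_mult)
      then show False using no_common Proots by blast
    qed
  qed
  \<comment> \<open>The constant coefficient of g is a unit, so g is primitive.\<close>
  have "content g dvd coeff g 0" by (rule content_dvd_coeff)
  then have "content g dvd 1" using g0 dvd_trans by blast
  then have "content g = 1" by (metis is_unit_normalize normalize_content)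
  then have irr: "irreducible (map_poly of_int g :: rat poly)" if "degree g > 0"
    using irreducible_rat_if_no_int_factorization[OF that _ factor] by blast
  show ?thesis
  proof (rule that)
    show "P = C * g" by (fact g)
    show "poly (cpoly g) z \<noteq> 0" if "m > 0" "z ^ m = 1" for z m
      using unity that by blast
    show "irreducible (map_poly of_int g :: rat poly)" if "degree g > 0"
      using irr that by blast
  qed
qed

section \<open>The cofactor of the cyclotomic part\<close>

lemma double_root:
  fixes p :: "complex poly"
  shows "poly p z = 0 \<and> poly (pderiv p) z = 0 \<longleftrightarrow> [:- z, 1:]\<^sup>2 dvd p"
proof
  assume *: "poly p z = 0 \<and> poly (pderiv p) z = 0"
  then obtain q where q: "p = [:- z, 1:] * q" by (metis dvdE poly_eq_0_iff_dvd)
  have "poly q z = 0" using * unfolding q pderiv_mult by (simp add: pderiv_pCons)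
  then obtain h where "q = [:- z, 1:] * h" by (metis dvdE poly_eq_0_iff_dvd)
  then have "p = [:- z, 1:]\<^sup>2 * h" using q by (simp only: power2_eq_square mult.assoc)
  then show "[:- z, 1:]\<^sup>2 dvd p" by (rule dvdI)
next
  assume "[:- z, 1:]\<^sup>2 dvd p"
  then obtain h where "p = [:- z, 1:]\<^sup>2 * h" by blast
  then have "p = [:- z, 1:] * ([:- z, 1:] * h)" by (simp only: power2_eq_square mult.assoc)
  then show "poly p z = 0 \<and> poly (pderiv p) z = 0"
    by (simp only: pderiv_mult) (simp add: pderiv_pCons)
qed

text \<open>Reflection turns q - z into -z (q - 1/z). This transfers simplicity of roots from P to
  its reflection.\<close>

lemma double_root_reflect:
  fixes p :: "complex poly"
  assumes "z \<noteq> 0" "coeff p 0 \<noteq> 0" "[:- z, 1:]\<^sup>2 dvd reflect_poly p"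
  shows "[:- inverse z, 1:]\<^sup>2 dvd p"
proof -
  obtain h where h: "reflect_poly p = [:- z, 1:]\<^sup>2 * h" using assms(3) by blast
  have "p = reflect_poly (reflect_poly p)" using assms(2) by simp
  also have "\<dots> = (reflect_poly [:- z, 1:])\<^sup>2 * reflect_poly h"
    unfolding h by (simp only: reflect_poly_mult reflect_poly_power)
  also have "reflect_poly [:- z, 1:] = smult (- z) [:- inverse z, 1:]"
    using assms(1) by (simp add: reflect_poly_def)
  finally have "p = [:- inverse z, 1:]\<^sup>2 * smult (z\<^sup>2) (reflect_poly h)"
    by (simp only: smult_power mult_smult_left mult_smult_right power2_minus)
  then show ?thesis by (rule dvdI)
qed

lemma inverse_cyclotomic_part_roots: "z \<in> cyclotomic_part_roots a n \<Longrightarrow> inverse z \<in> cyclotomic_part_roots a n"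
  by (auto simp: cyclotomic_part_roots_def power_inverse simp del: power_Suc)

text \<open>C has simple roots, all of them roots of [a - 1] [a + 1], so it divides this product,
  whose value at 1 is a^2 - 1.\<close>

lemma C_poly_at_1:
  assumes "a \<ge> 2" "n > 0"
  shows "lead_coeff (C_poly a n) = 1" "0 < poly (C_poly a n) 1" "poly (C_poly a n) 1 < int (a\<^sup>2)"
proof -
  define C where "C = C_poly a n"
  note U = cpoly_C_poly[OF assms, folded C_def]
  have "lead_coeff (cpoly C) = 1" unfolding U(2) by (subst lead_coeff_prod) auto
  then show lead: "lead_coeff (C_poly a n) = 1" by (simp add: coeff_map_poly C_def)
  have "poly (cpoly (qint (a - 1) * qint (a + 1))) z = 0" if "z \<in> cyclotomic_part_roots a n" for z
    using that poly_cpoly_qint[of z "a - 1"] poly_cpoly_qint[of z "a + 1"]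
    by (auto simp: cyclotomic_part_roots_def map_poly_of_int_mult)
  then have "cpoly C dvd cpoly (qint (a - 1) * qint (a + 1))"
    unfolding U(2) using U(1) prod_linear_dvd by blast
  then have "C dvd qint (a - 1) * qint (a + 1)"
    using cpoly_dvd_monic lead unfolding C_def by blast
  then obtain B where "qint (a - 1) * qint (a + 1) = C * B" by blast
  from arg_cong[OF this, of "\<lambda>p. poly p 1"]
  have "int ((a - 1) * (a + 1)) = poly C 1 * poly B 1"
    by (simp only: poly_mult poly_qint_1 of_nat_mult)
  moreover obtain b where b: "a = 2 + b" using assms(1) le_Suc_ex by blast
  have "(a - 1) * (a + 1) < a\<^sup>2" "0 < (a - 1) * (a + 1)"
    unfolding b by (simp_all add: power2_eq_square)
  ultimately have dvd: "poly C 1 dvd int ((a - 1) * (a + 1))" "int ((a - 1) * (a + 1)) > 0"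
    "int ((a - 1) * (a + 1)) < int (a\<^sup>2)"
    by (simp_all only: of_nat_less_iff of_nat_0_less_iff dvd_triv_left)
  from zdvd_imp_le[OF dvd(1,2)] show "poly (C_poly a n) 1 < int (a\<^sup>2)" using dvd(3) by (simp add: C_def)
  have "poly C 1 \<noteq> 0" using dvd by auto
  \<comment> \<open>By the intermediate value theorem, a monic polynomial negative at 1 has a real
    root beyond 1, but the roots of C lie on the unit circle.\<close>
  moreover have "\<not> poly C 1 < 0"
  proof
    assume neg: "poly C 1 < 0"
    define R where "R = (map_poly of_int C :: real poly)"
    have dR: "degree R = degree C" unfolding R_def by (rule degree_map_poly) auto
    have "lead_coeff R = 1" unfolding dR using lead by (simp add: R_def coeff_map_poly C_def)
    then obtain m where m: "\<And>x. x \<ge> m \<Longrightarrow> poly R x \<ge> 1"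
      using poly_pinfty_gt_lc[of R] by auto
    have "poly R 1 = of_int (poly C 1)"
      by (simp add: poly_altdef dR) (simp add: R_def coeff_map_poly)
    then have "poly R 1 < 0" using neg by simp
    moreover have "poly R (max 2 m) > 0" using m[of "max 2 m"] by simp
    ultimately obtain x where x: "x > 1" "poly R x = 0"
      using poly_IVT_pos[of 1 "max 2 m" R] by (auto simp: less_max_iff_disj)
    have "poly (cpoly C) (of_real x) = of_real (poly R x)"
      by (simp add: poly_altdef dR) (simp add: R_def coeff_map_poly)
    then have "poly (cpoly C) (of_real x) = 0" using x by simp
    then have "of_real x \<in> cyclotomic_part_roots a n" unfolding U(2) using U(1) by (auto simp: poly_prod)
    then have "norm (of_real x :: complex) = 1" using norm_cyclotomic_part_roots assms(2) by blast
    then show False using x(1) by simp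
  qed
  ultimately show "0 < poly (C_poly a n) 1" by (simp add: C_def)
qed

text \<open>The hypotheses about P carry over to its reflection because the set of roots of C is
  closed under inversion. The value of the cofactor at 1 is n/C(1) with C(1) < a^2 < n.\<close>

lemma irreducible_cofactor_C_poly:
  assumes a: "a \<ge> 2" "n > 5 * a\<^sup>2"
    and P: "coeff P 0 = 1" "lead_coeff P = 1" "poly P 1 = int n"
    and lj: "\<And>V. V * reflect_poly V = P * reflect_poly P \<Longrightarrow>
      V \<in> {P, - P, reflect_poly P, - reflect_poly P}"
    and common: "\<And>z. z \<noteq> 0 \<Longrightarrow> poly (cpoly P) z = 0 \<Longrightarrow> poly (cpoly P) (inverse z) = 0 \<Longrightarrow>
      z \<in> cyclotomic_part_roots a n"
    and roots: "\<And>z. z \<in> cyclotomic_part_roots a n \<Longrightarrow> poly (cpoly P) z = 0"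
    and simple: "\<And>z. z \<in> cyclotomic_part_roots a n \<Longrightarrow> poly (pderiv (cpoly P)) z \<noteq> 0"
    and T: "T = P \<or> T = reflect_poly P"
  shows "\<exists>g. T = C_poly a n * g \<and> irreducible (map_poly of_int g :: rat poly) \<and>
    (\<forall>(z::complex) (m::nat). m > 0 \<and> z ^ m = 1 \<longrightarrow> poly (map_poly of_int g) z \<noteq> 0) \<and>
    rat_of_int (poly g 1) = of_nat n / of_int (poly (C_poly a n) 1) \<and>
    rat_of_nat n / of_int (poly (C_poly a n) 1) \<ge> 2"
proof -
  have n: "n > 0" using a by simp
  note U = cpoly_C_poly[OF a(1) n]
  have rr: "reflect_poly (reflect_poly P) = P" using P(1) by simp
  have T0: "coeff T 0 = 1" and T1: "poly T 1 = int n"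
    using T P by (auto simp: poly_reflect_poly_at_1)
  have nz: "z \<noteq> 0" if "z \<in> cyclotomic_part_roots a n" for z
    using that n by (auto simp: cyclotomic_part_roots_def power_0_left)
  have refl_root: "poly (cpoly (reflect_poly P)) z = 0" if "poly (cpoly P) (inverse z) = 0" "z \<noteq> 0" for z
    using that by (simp add: cpoly_reflect_poly poly_reflect_poly_nz)
  obtain g where g: "T = C_poly a n * g"
    "\<And>z m. m > 0 \<Longrightarrow> z ^ m = 1 \<Longrightarrow> poly (cpoly g) z \<noteq> 0"
    "degree g > 0 \<Longrightarrow> irreducible (map_poly of_int g :: rat poly)"
  proof (rule irreducible_cofactor[of T, OF T0 _ U])
    show "V \<in> {T, - T, reflect_poly T, - reflect_poly T}"
      if "V * reflect_poly V = T * reflect_poly T" for V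
    proof -
      have "V * reflect_poly V = P * reflect_poly P"
        using that T by (auto simp: rr mult.commute)
      then have "V \<in> {P, - P, reflect_poly P, - reflect_poly P}" by (rule lj)
      then show ?thesis using T by (auto simp: rr)
    qed
    show "z \<in> cyclotomic_part_roots a n"
      if z: "z \<noteq> 0" "poly (cpoly T) z = 0" "poly (cpoly T) (inverse z) = 0" for z
    proof (cases "T = P")
      case True
      then show ?thesis using common z by blast
    next
      case False
      then have "T = reflect_poly P" using T by blast
      then have "poly (cpoly P) (inverse z) = 0" "poly (cpoly P) z = 0"
        using z poly_cpoly_inverse_eq_0[of P z] poly_cpoly_inverse_eq_0[of P "inverse z"] by simp_all
      then show ?thesis using common z(1) by blast
    qed
    show "poly (cpoly T) z = 0" if "z \<in> cyclotomic_part_roots a n" for z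
      using T roots[OF that] refl_root[OF roots[OF inverse_cyclotomic_part_roots[OF that]] nz[OF that]] by auto
    show "poly (pderiv (cpoly T)) z \<noteq> 0" if z: "z \<in> cyclotomic_part_roots a n" for z
    proof (cases "T = P")
      case True
      then show ?thesis using simple z by simp
    next
      case False
      then have TP: "cpoly T = reflect_poly (cpoly P)" using T by (simp add: cpoly_reflect_poly)
      have Tz: "poly (cpoly T) z = 0"
        using T roots[OF z] refl_root[OF roots[OF inverse_cyclotomic_part_roots[OF z]] nz[OF z]] by auto
      show ?thesis
      proof
        assume "poly (pderiv (cpoly T)) z = 0"
        then have "[:- z, 1:]\<^sup>2 dvd reflect_poly (cpoly P)" using Tz double_root TP by metis
        then have "[:- inverse z, 1:]\<^sup>2 dvd cpoly P"
          using double_root_reflect[OF nz[OF z]] P(1) by (simp add: coeff_map_poly)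
        then have "poly (pderiv (cpoly P)) (inverse z) = 0" using double_root by blast
        then show False using simple[OF inverse_cyclotomic_part_roots[OF z]] by simp
      qed
    qed
  next
    fix g
    assume *: "T = C_poly a n * g"
      "\<And>z m. m > 0 \<Longrightarrow> z ^ m = 1 \<Longrightarrow> poly (cpoly g) z \<noteq> 0"
      "degree g > 0 \<Longrightarrow> irreducible (map_poly of_int g :: rat poly)"
    show thesis by (rule that) (fact *)+
  qed
  define c where "c = poly (C_poly a n) 1"
  have c: "0 < c" "c < int (a\<^sup>2)" using C_poly_at_1[OF a(1) n] by (simp_all add: c_def)
  have cg: "c * poly g 1 = int n" using arg_cong[OF g(1), of "\<lambda>p. poly p 1"] T1 by (simp add: c_def)
  have val: "rat_of_int (poly g 1) = of_nat n / of_int c"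
  proof -
    have "rat_of_int (c * poly g 1) = rat_of_int (int n)" by (simp only: cg)
    then show ?thesis using c by (simp add: field_simps)
  qed
  have g2: "poly g 1 \<ge> 2"
  proof (rule ccontr)
    assume "\<not> poly g 1 \<ge> 2"
    then have "c * poly g 1 \<le> c * 1" using c by (intro mult_left_mono) auto
    then have "int n < int (a\<^sup>2)" using cg c by linarith
    then show False using a(2) by simp
  qed
  \<comment> \<open>A constant cofactor would be a unit because T(0) = 1, against the value at least
    2 at q = 1.\<close>
  have "degree g > 0"
  proof (rule ccontr)
    assume "\<not> degree g > 0"
    then obtain x where x: "g = [:x:]" by (auto elim: degree_eq_zeroE)
    have "coeff (C_poly a n) 0 * x = 1" using T0 unfolding g(1) x by (simp add: coeff_mult_0 mult.commute)
    then have "x dvd 1" by (metis dvd_triv_right)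
    then show False using g2 x by auto
  qed
  then have "irreducible (map_poly of_int g :: rat poly)" by (rule g(3))
  moreover have "rat_of_nat n / of_int c \<ge> 2"
    unfolding val[symmetric] using g2 by (metis of_int_le_iff of_int_numeral)
  ultimately show ?thesis using g val unfolding c_def by blast
qed

section \<open>Reflected denominators and the four residue classes\<close>

lemma coeff_0_qint: "coeff (qint n) 0 = (if n = 0 then 0 else 1)"
  by (cases n) (simp_all add: qint_Suc')

text \<open>Reflection commutes with multiplication by (1 - q)^2, so it suffices to reverse the six
  exponents.\<close>

lemma reflect_sq1_mult:
  assumes "coeff (sq1 * P) = six N u i j l" "distinct [0, N, u, i, j, l]"
    "\<forall>x\<in>{u, i, j, l}. x < N"
    and "coeff (sq1 * Q) = six N (N - u) (N - i) (N - j) (N - l)"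
  shows "reflect_poly P = Q"
proof -
  have "coeff P 0 = 1" using fun_cong[OF assms(1), of 0] by (simp add: six_def coeff_mult_0)
  then have deg: "degree (sq1 * P) = N" using ljunggren_step(9)[OF assms(1-3), of P] by simp
  have "coeff (sq1 * reflect_poly P) = coeff (sq1 * Q)"
  proof
    fix s
    have "coeff (sq1 * reflect_poly P) s = coeff (reflect_poly (sq1 * P)) s"
      by (simp only: reflect_poly_mult reflect_sq1)
    also have "\<dots> = (if s > N then 0 else six N u i j l (N - s))"
      unfolding coeff_reflect_poly deg assms(1) ..
    also have "\<dots> = six N (N - u) (N - i) (N - j) (N - l) s"
    proof (cases "s > N")
      case True
      then show ?thesis using assms(3) by (auto simp: six_def)
    next
      case False
      have "N - s = x \<longleftrightarrow> s = N - x" if "x \<le> N" for x using that False by auto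
      moreover have "u \<le> N" "i \<le> N" "j \<le> N" "l \<le> N" using assms(3) by auto
      ultimately show ?thesis unfolding six_def using False by simp
    qed
    finally show "coeff (sq1 * reflect_poly P) s = coeff (sq1 * Q) s" using assms(4) by simp
  qed
  then show ?thesis by (rule sq1_cancel)
qed

lemma reflect_P_plus:
  assumes "a \<ge> 2" "k > a + 1"
  shows "reflect_poly (P_plus k a) = qint k * qint a + monom 1 (k + a - 1)"
proof (rule reflect_sq1_mult)
  have "sq1 * (qint k * qint a + monom 1 (k + a - 1)) =
      1 - monom 1 k - monom 1 a + monom 1 (k + a - 1) - monom 1 (k + a) + monom 1 (k + a + 1)"
    unfolding distrib_left sq1_qint_qint sq1_mult_monom using assms
    by (intro poly_eqI) (auto simp: algebra_simps)
  then show "coeff (sq1 * (qint k * qint a + monom 1 (k + a - 1))) =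
      six (k + a + 1) (k + a + 1 - 2) (k + a + 1 - 1) (k + a + 1 - (a + 1)) (k + a + 1 - (k + 1))"
    using assms by (auto simp: six_def fun_eq_iff)
  show "coeff (sq1 * P_plus k a) = six (k + a + 1) 2 1 (a + 1) (k + 1)"
    using assms by (intro coeff_sq1_P_plus) auto
qed (use assms in auto)

lemma reflect_P_minus:
  assumes "a \<ge> 2" "k > a + 1"
  shows "reflect_poly (P_minus k a) = qint k * qint a - monom 1 (k - 1)"
proof (rule reflect_sq1_mult)
  have "sq1 * (qint k * qint a - monom 1 (k - 1)) =
      1 + monom 1 k - monom 1 a - monom 1 (k - 1) - monom 1 (k + 1) + monom 1 (k + a)"
    unfolding right_diff_distrib sq1_qint_qint sq1_mult_monom using assms
    by (intro poly_eqI) (auto simp: algebra_simps)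
  then show "coeff (sq1 * (qint k * qint a - monom 1 (k - 1))) =
      six (k + a) (k + a - a) (k + a - (a - 1)) (k + a - (a + 1)) (k + a - k)"
    using assms by (auto simp: six_def fun_eq_iff)
  show "coeff (sq1 * P_minus k a) = six (k + a) a (a - 1) (a + 1) k"
    using assms by (intro coeff_sq1_P_minus) auto
qed (use assms in auto)

text \<open>As k a is -1 modulo n, the classes with a r = 1 or -1 are those of -k and k. Since n is
  symmetric in a and k, the formulas apply with a and k exchanged.\<close>

lemma q_den_plus_cases:
  assumes "a \<ge> 2" "k > a + 1" "n = k * a + 1"
    and r: "[r = int a] (mod int n) \<or> [r = - int a] (mod int n) \<or>
        [int a * r = 1] (mod int n) \<or> [int a * r = - 1] (mod int n)"
  shows "q_den (of_int r / of_nat n) = P_plus k a \<or>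
    q_den (of_int r / of_nat n) = reflect_poly (P_plus k a)"
proof -
  have "int k * int a - (- 1) = int n" using assms(3) by simp
  then have ka: "[int k * int a = - 1] (mod int n)" by (metis cong_iff_dvd_diff dvd_refl)
  have kr: "[r = - int k * (int a * r)] (mod int n)"
    using cong_scalar_right[OF ka, of "- r"] by (simp add: cong_sym mult_ac)
  have n: "int n = int (k * a + 1)" "int n = int (a * k + 1)" using assms(3) by simp_all
  have "a \<ge> 1" "k \<ge> 1" using assms by auto
  from r consider "[r = int a] (mod int n)" | "[r = - int a] (mod int n)"
    | "[r = - int k] (mod int n)" | "[r = int k] (mod int n)"
    using cong_trans[OF kr cong_scalar_left[of "int a * r" 1 "int n" "- int k"]]
      cong_trans[OF kr cong_scalar_left[of "int a * r" "- 1" "int n" "- int k"]] by auto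
  then show ?thesis
    using q_den_plus_pos[OF \<open>a \<ge> 1\<close> \<open>k \<ge> 1\<close> n(1), of r] q_den_plus_neg[OF \<open>a \<ge> 1\<close> \<open>k \<ge> 1\<close> n(1), of r]
      q_den_plus_pos[OF \<open>k \<ge> 1\<close> \<open>a \<ge> 1\<close> n(2), of r] q_den_plus_neg[OF \<open>k \<ge> 1\<close> \<open>a \<ge> 1\<close> n(2), of r]
    unfolding reflect_P_plus[OF assms(1,2)] unfolding P_plus_def
    by cases (simp_all add: mult_ac add.commute)
qed

text \<open>Now k a is 1 modulo n, so the last two classes are those of k and -k. Exchanging a and k
  swaps \<open>P_minus k a\<close> with its reflection.\<close>

lemma q_den_minus_cases:
  assumes "a \<ge> 2" "k > a + 1" "n = k * a - 1"
    and r: "[r = int a] (mod int n) \<or> [r = - int a] (mod int n) \<or>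
        [int a * r = 1] (mod int n) \<or> [int a * r = - 1] (mod int n)"
  shows "q_den (of_int r / of_nat n) = P_minus k a \<or>
    q_den (of_int r / of_nat n) = reflect_poly (P_minus k a)"
proof -
  have "k * a \<ge> 1" using assms by simp
  then have n: "int n = int k * int a - 1" "int n = int a * int k - 1"
    using assms(3) by (simp_all add: of_nat_diff)
  have ka: "[int k * int a = 1] (mod int n)" using n(1) by (simp add: cong_iff_dvd_diff)
  have kr: "[r = int k * (int a * r)] (mod int n)"
    using cong_scalar_right[OF ka, of r] by (simp add: cong_sym mult_ac)
  have "k \<ge> 2" using assms by auto
  from r consider "[r = int a] (mod int n)" | "[r = - int a] (mod int n)"
    | "[r = int k] (mod int n)" | "[r = - int k] (mod int n)"
    using cong_trans[OF kr cong_scalar_left[of "int a * r" 1 "int n" "int k"]]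
      cong_trans[OF kr cong_scalar_left[of "int a * r" "- 1" "int n" "int k"]] by auto
  then show ?thesis
    using q_den_minus_pos[OF assms(1) \<open>k \<ge> 2\<close> n(1), of r] q_den_minus_neg[OF assms(1) \<open>k \<ge> 2\<close> n(1), of r]
      q_den_minus_pos[OF \<open>k \<ge> 2\<close> assms(1) n(2), of r] q_den_minus_neg[OF \<open>k \<ge> 2\<close> assms(1) n(2), of r]
    unfolding reflect_P_minus[OF assms(1,2)] unfolding P_minus_def
    by cases (simp_all add: mult_ac)
qed

text \<open>The only units modulo 2, 3, 4 and 6 are 1 and -1.\<close>

lemma mod_cases:
  assumes "a \<in> {2, 3, 4, 6 :: nat}" "coprime n a"
  shows "n mod a = 1 \<or> n mod a = a - 1"
proof -
  have ndvd: "\<not> d dvd n" if "d dvd a" "d > 1" for d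
    using coprime_common_divisor[OF assms(2) _ that(1)] that(2) by auto
  consider "a = 2" | "a = 3" | "a = 4" | "a = 6" using assms(1) by auto
  then show ?thesis
  proof cases
    case 1
    then show ?thesis using ndvd[of 2] by simp presburger
  next
    case 2
    then show ?thesis using ndvd[of 3] by simp presburger
  next
    case 3
    then show ?thesis using ndvd[of 2] by simp presburger
  next
    case 4
    then show ?thesis using ndvd[of 2] ndvd[of 3] by simp presburger
  qed
qed

section \<open>Assembly of the cases n = k a + 1 and n = k a - 1\<close>

lemma cofactor:
  fixes a n :: nat and r :: int
  assumes a: "a \<in> {2, 3, 4, 6}" "n > 5 * a\<^sup>2" "coprime n a"
    and r: "[r = int a] (mod int n) \<or> [r = - int a] (mod int n) \<or>
        [int a * r = 1] (mod int n) \<or> [int a * r = - 1] (mod int n)"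
  shows "\<exists>g. q_den (of_int r / of_nat n) = C_poly a n * g \<and>
    irreducible (map_poly of_int g :: rat poly) \<and>
    (\<forall>(z::complex) (m::nat). m > 0 \<and> z ^ m = 1 \<longrightarrow> poly (map_poly of_int g) z \<noteq> 0) \<and>
    rat_of_int (poly g 1) = of_nat n / of_int (poly (C_poly a n) 1) \<and>
    rat_of_nat n / of_int (poly (C_poly a n) 1) \<ge> 2"
proof -
  have a2: "a \<ge> 2" using a(1) by auto
  have n: "n = n div a * a + n mod a" by simp
  \<comment> \<open>For a = 2 both residues coincide and the first case takes them all, so the
    second may assume a at least 3, as \<open>ljunggren_minus\<close> requires.\<close>
  consider k where "n = k * a + 1" | k where "a \<ge> 3" "n = k * a - 1"
  proof (cases "n mod a = 1")
    case True
    then show ?thesis using that(1) n by metis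
  next
    case False
    then have *: "n mod a = a - 1" using mod_cases a by blast
    then have "a \<noteq> 2" using False by auto
    moreover have "n = (n div a + 1) * a - 1" using n * a2 by simp
    ultimately show ?thesis using that(2) a2 by (metis Suc_leI le_neq_implies_less numeral_3_eq_3 numeral_2_eq_2)
  qed
  then show ?thesis
  proof cases
    case 1
    \<comment> \<open>This is where n > 5 a^2 enters: it becomes the bound k at least 5 a.\<close>
    have "5 * a * a \<le> k * a" using a(2) unfolding 1 power2_eq_square mult.assoc by linarith
    then have k: "k \<ge> 5 * a" using a2 by (intro mult_right_le_imp_le[of "5 * a" a k]) auto
    have T: "q_den (of_int r / of_nat n) = P_plus k a \<or>
        q_den (of_int r / of_nat n) = reflect_poly (P_plus k a)"
      using k a2 by (intro q_den_plus_cases[OF a2 _ 1 r]) simp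
    have lead: "lead_coeff (P_plus k a) = 1"
    proof -
      have "lead_coeff (P_plus k a) = coeff (reflect_poly (P_plus k a)) 0" by simp
      also have "\<dots> = 1"
        using k a2 by (subst reflect_P_plus) (auto simp: coeff_mult_0 coeff_0_qint)
      finally show ?thesis .
    qed
    show ?thesis
    proof (rule irreducible_cofactor_C_poly[OF a2 a(2) _ lead _ _ _ _ _ T])
      show "coeff (P_plus k a) 0 = 1" using coeff_0_P_plus k a2 by simp
      show "poly (P_plus k a) 1 = int n" by (simp add: P_plus_def poly_monom 1)
      show "V \<in> {P_plus k a, - P_plus k a, reflect_poly (P_plus k a), - reflect_poly (P_plus k a)}"
        if "V * reflect_poly V = P_plus k a * reflect_poly (P_plus k a)" for V
        using ljunggren_plus[OF a2 k that] .
      show "z \<in> cyclotomic_part_roots a n" if "z \<noteq> 0" "poly (cpoly (P_plus k a)) z = 0"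
        "poly (cpoly (P_plus k a)) (inverse z) = 0" for z
        using common_roots_plus[OF _ that] a2 1 by simp
      show "poly (cpoly (P_plus k a)) z = 0" "poly (pderiv (cpoly (P_plus k a))) z \<noteq> 0"
        if "z \<in> cyclotomic_part_roots a n" for z
        using cyclotomic_part_simple_plus[of a k z] that a2 k 1 by auto
    qed
  next
    case 2
    have "5 * a * a \<le> k * a" using a(2) unfolding 2(2) power2_eq_square mult.assoc by linarith
    then have k: "k \<ge> 5 * a" using a2 by (intro mult_right_le_imp_le[of "5 * a" a k]) auto
    have "k * a \<ge> 2 * 1" using k a2 by (intro mult_le_mono) auto
    then have ka: "k * a \<ge> 2" by simp
    have T: "q_den (of_int r / of_nat n) = P_minus k a \<or>
        q_den (of_int r / of_nat n) = reflect_poly (P_minus k a)"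
      using k a2 by (intro q_den_minus_cases[OF a2 _ 2(2) r]) simp
    have lead: "lead_coeff (P_minus k a) = 1"
    proof -
      have "lead_coeff (P_minus k a) = coeff (reflect_poly (P_minus k a)) 0" by simp
      also have "\<dots> = 1"
        using k a2 by (subst reflect_P_minus) (auto simp: coeff_mult_0 coeff_0_qint)
      finally show ?thesis .
    qed
    show ?thesis
    proof (rule irreducible_cofactor_C_poly[OF a2 a(2) _ lead _ _ _ _ _ T])
      show "coeff (P_minus k a) 0 = 1" using coeff_0_P_minus k a2 by simp
      show "poly (P_minus k a) 1 = int n"
      proof -
        have "1 \<le> k * a" using ka by linarith
        then have "int n = int (k * a) - int 1" unfolding 2(2) by (rule of_nat_diff)
        then show ?thesis by (simp add: P_minus_def poly_monom)
      qed
      show "V \<in> {P_minus k a, - P_minus k a, reflect_poly (P_minus k a), - reflect_poly (P_minus k a)}"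
        if "V * reflect_poly V = P_minus k a * reflect_poly (P_minus k a)" for V
        using ljunggren_minus[OF 2(1) k that] .
      show "z \<in> cyclotomic_part_roots a n" if "z \<noteq> 0" "poly (cpoly (P_minus k a)) z = 0"
        "poly (cpoly (P_minus k a)) (inverse z) = 0" for z
        using common_roots_minus[OF _ ka that] a2 2 by simp
      show "poly (cpoly (P_minus k a)) z = 0" "poly (pderiv (cpoly (P_minus k a))) z \<noteq> 0"
        if "z \<in> cyclotomic_part_roots a n" for z
        using cyclotomic_part_simple_minus[of a k z] that a2 k 2 by auto
    qed
  qed
qed

lemma C_poly_prime:
  assumes "prime p" "p > a + 1" "a \<ge> 2"
  shows "C_poly a p = 1"
proof -
  have "{d \<in> D_set a. d dvd p} = {}"
  proof (rule ccontr)
    assume "{d \<in> D_set a. d dvd p} \<noteq> {}"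
    then obtain d where d: "d \<ge> 2" "d dvd a - 1 \<or> d dvd a + 1" "d dvd p"
      by (auto simp: D_set_def)
    then have "d = p" using assms(1) prime_nat_iff by force
    moreover have "d \<le> a + 1" using d(2) assms(3) dvd_imp_le[of d "a - 1"] dvd_imp_le[of d "a + 1"] by auto
    ultimately show False using assms(2) by simp
  qed
  then show ?thesis unfolding C_poly_def by (simp only: prod.empty)
qed

theorem corollary1p8:
  shows
   "(\<forall>(a::nat) (n::nat) (r::int).
       a \<in> {2, 3, 4, 6} \<and> n > 5 * a\<^sup>2 \<and> coprime n a \<and>
       ([r = int a] (mod int n) \<or> [r = - int a] (mod int n) \<or>
        [int a * r = 1] (mod int n) \<or> [int a * r = - 1] (mod int n)) \<longrightarrow>
       (\<exists>g :: int poly.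
          q_den (of_int r / of_nat n) = C_poly a n * g \<and>
          irreducible (map_poly of_int g :: rat poly) \<and>
          (\<forall>(z::complex) (m::nat). m > 0 \<and> z ^ m = 1 \<longrightarrow> poly (map_poly of_int g) z \<noteq> 0) \<and>
          rat_of_int (poly g 1) = of_nat n / of_int (poly (C_poly a n) 1) \<and>
          rat_of_nat n / of_int (poly (C_poly a n) 1) \<ge> 2)) \<and>
    (\<forall>(b::nat) (p::nat) (r::int).
       b \<in> {2, 3, 4, 6} \<and> prime p \<and> p > 5 * b\<^sup>2 \<and>
       ([r = int b] (mod int p) \<or> [r = - int b] (mod int p) \<or>
        [int b * r = 1] (mod int p) \<or> [int b * r = - 1] (mod int p)) \<longrightarrow>
       irreducible (map_poly of_int (q_den (of_int r / of_nat p)) :: rat poly))"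
proof (intro conjI allI impI; elim conjE)
  fix a n :: nat and r :: int
  assume "a \<in> {2, 3, 4, 6}" "5 * a\<^sup>2 < n" "coprime n a"
    "[r = int a] (mod int n) \<or> [r = - int a] (mod int n) \<or>
        [int a * r = 1] (mod int n) \<or> [int a * r = - 1] (mod int n)"
  from cofactor[OF this] show "\<exists>g :: int poly.
          q_den (of_int r / of_nat n) = C_poly a n * g \<and>
          irreducible (map_poly of_int g :: rat poly) \<and>
          (\<forall>(z::complex) (m::nat). m > 0 \<and> z ^ m = 1 \<longrightarrow> poly (map_poly of_int g) z \<noteq> 0) \<and>
          rat_of_int (poly g 1) = of_nat n / of_int (poly (C_poly a n) 1) \<and>
          rat_of_nat n / of_int (poly (C_poly a n) 1) \<ge> 2" .
next
  fix b p :: nat and r :: int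
  assume b: "b \<in> {2, 3, 4, 6}" and p: "prime p" "5 * b\<^sup>2 < p"
    and r: "[r = int b] (mod int p) \<or> [r = - int b] (mod int p) \<or>
        [int b * r = 1] (mod int p) \<or> [int b * r = - 1] (mod int p)"
  have b2: "b \<ge> 2" using b by auto
  \<comment> \<open>The resulting bound p > b + 1 gives both coprimality with b and a trivial
    cyclotomic part.\<close>
  have "b * b \<ge> 2 * b" using b2 by (intro mult_le_mono) auto
  then have pb: "p > b + 1" using p(2) b2 unfolding power2_eq_square by linarith
  have "\<not> p dvd b" using pb b2 by (auto dest: dvd_imp_le)
  then have "coprime p b" using p(1) by (simp add: prime_imp_coprime)
  from cofactor[OF b p(2) this r] show
    "irreducible (map_poly of_int (q_den (of_int r / of_nat p)) :: rat poly)"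
    unfolding C_poly_prime[OF p(1) pb b2] by auto
qed

end
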